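(* Let $A$ be small and let $\mathfrak p(x),\mathfrak q(y)$ be global types which are regular over $A$, convex over $A$ and $A$-asymmetric, such that $\mathfrak p_{\restriction A}$ and $\mathfrak q_{\restriction A}$ are not weakly orthogonal. Let $M\supseteq A$ be any small model. (i) Suppose the non-orthogonality is of bounded type. (1) If $(\mathfrak p\otimes\mathfrak q)_{\restriction A}\neq(\mathfrak q\otimes\mathfrak p)_{\restriction A}$, then ${\rm Inv}_{\mathfrak p,A}(M)$ and ${\rm Inv}_{\mathfrak q,A}(M)$ are isomorphic. (2) If $(\mathfrak p\otimes\mathfrak q)_{\restriction A}=(\mathfrak q\otimes\mathfrak p)_{\restriction A}$, then ${\rm Inv}_{\mathfrak p,A}(M)$ and ${\rm Inv}_{\mathfrak q,A}(M)$ are anti-isomorphic. (ii) Suppose moreover that $\mathfrak p,\mathfrak q$ are strongly regular and the non-orthogonality is of unbounded type. Then both $\mathfrak p$ and $\mathfrak q$ are simple over $A$, and: (1) if $(\mathfrak p\otimes\mathfrak q)_{\restriction A}\neq(\mathfrak q\otimes\mathfrak p)_{\restriction A}$, the Dedekind completions of ${\rm Inv}_{\mathfrak p,A}(M)$ and ${\rm Inv}_{\mathfrak q,A}(M)$ are isomorphic; (2) if $(\mathfrak p\otimes\mathfrak q)_{\restriction A}=(\mathfrak q\otimes\mathfrak p)_{\restriction A}$, these Dedekind completions are anti-isomorphic.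
   Context: Monster model $\mathfrak C$. Regular over $A$: non-algebraic, $A$-invariant, and for all $B\supseteq A$ and $a\models\mathfrak p_{\restriction A}$, either $a\models\mathfrak p_{\restriction B}$ or $\mathfrak p_{\restriction B}\vdash\mathfrak p_{\restriction Ba}$. Strongly regular: for some formula $\phi(x)\in\mathfrak p_{\restriction A}$ the same dichotomy holds for all $B\supseteq A$ and all $a\in\phi(\mathfrak C)$. Morley sequence in $\mathfrak p$ over $A$: $(a_i)_{i\in I}$ with $a_i\models\mathfrak p_{\restriction A\{a_j:j<i\}}$. $A$-asymmetric: $A$-invariant and ${\rm tp}(a,b/A)\neq{\rm tp}(b,a/A)$ for a Morley sequence $(a,b)$. Convex over $A$: some $A$-definable partial order $\leq$ making all Morley sequences in $\mathfrak p$ over $A$ strictly increasing makes $\mathfrak p_{\restriction A}(\mathfrak C)$ $\leq$-convex. $\mathfrak p\otimes\mathfrak q={\rm tp}(a,b/\mathfrak C)$ for $a\models\mathfrak p$, $b\models\mathfrak q_{\restriction\mathfrak C a}$. ${\mathcal E}_{\mathfrak p}(a)=\{c\models\mathfrak p_{\restriction A}\mid c\not\models\mathfrak p_{\restriction Aa},\ a\not\models\mathfrak p_{\restriction Ac}\}$; classes are linearly ordered by ${\mathcal E}_{\mathfrak p}(c)<{\mathcal E}_{\mathfrak p}(c')$ iff $(c,c')$ is a Morley sequence; a set $D$ is $\mathfrak q$-bounded over $A$ if it meets $\mathfrak q_{\restriction A}(\mathfrak C)$ and the set of ${\mathcal E}_{\mathfrak q}$-classes it meets is bounded on both sides. Simple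 over $A$: $x\in{\mathcal E}_{\mathfrak p}(y)$ is relatively definable over $A$ within $\mathfrak p_{\restriction A}(\mathfrak C)^2$. The non-orthogonality is of bounded type if there are $a\models\mathfrak p_{\restriction A}$, $b\models\mathfrak q_{\restriction A}$ and $\theta(x,y)\in{\rm tp}(a,b/A)$ with $\theta(a,\mathfrak C)$ $\mathfrak q$-bounded over $A$; of unbounded type otherwise. ${\rm Inv}_{\mathfrak p,A}(M)$: order type of any maximal Morley sequence in $\mathfrak p$ over $A$ consisting of elements of $M$ (well defined; empty if none). Convention: the Dedekind completion of the empty order is a one-element order. *)

theory Defs
  imports Main
begin

section \<open>First-order logic with parameters\<close>

text \<open>
  Formulas carry their parameters from the universe \<open>'a\<close> as constants, so that an
  \<open>L(B)\<close>-formula is a formula whose set of parameters is contained in \<open>B\<close>.  Variables are natural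
  numbers; an \<open>n\<close>-tuple is a list of length \<open>n\<close> and interprets the variables \<open>0,\<dots>,n - 1\<close>.
\<close>

datatype (dead 'f, pars_trm: 'a) trm =
    Var nat
  | Par 'a
  | App 'f "('f, 'a) trm list"
  for map: map_pars_trm

datatype (dead 'f, dead 'r, pars: 'a) fm =
    Equal "('f, 'a) trm" "('f, 'a) trm"
  | Pred 'r "('f, 'a) trm list"
  | Neg "('f, 'r, 'a) fm"
  | And "('f, 'r, 'a) fm" "('f, 'r, 'a) fm"
  | Exi nat "('f, 'r, 'a) fm"
  for map: map_pars

record ('f, 'r, 'a) struct =
  farity :: "'f \<Rightarrow> nat"
  rarity :: "'r \<Rightarrow> nat"
  fint :: "'f \<Rightarrow> 'a list \<Rightarrow> 'a"
  rint :: "'r \<Rightarrow> 'a list \<Rightarrow> bool"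

primrec wf_trm :: "('f, 'r, 'a) struct \<Rightarrow> ('f, 'a) trm \<Rightarrow> bool" where
  "wf_trm C (Var x) = True"
| "wf_trm C (Par a) = True"
| "wf_trm C (App f ts) = (length ts = farity C f \<and> list_all id (map (wf_trm C) ts))"

primrec wf_fm :: "('f, 'r, 'a) struct \<Rightarrow> ('f, 'r, 'a) fm \<Rightarrow> bool" where
  "wf_fm C (Equal s t) = (wf_trm C s \<and> wf_trm C t)"
| "wf_fm C (Pred R ts) = (length ts = rarity C R \<and> list_all (wf_trm C) ts)"
| "wf_fm C (Neg \<phi>) = wf_fm C \<phi>"
| "wf_fm C (And \<phi> \<psi>) = (wf_fm C \<phi> \<and> wf_fm C \<psi>)"
| "wf_fm C (Exi x \<phi>) = wf_fm C \<phi>"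

primrec fv_trm :: "('f, 'a) trm \<Rightarrow> nat set" where
  "fv_trm (Var x) = {x}"
| "fv_trm (Par a) = {}"
| "fv_trm (App f ts) = \<Union> (set (map fv_trm ts))"

primrec fv :: "('f, 'r, 'a) fm \<Rightarrow> nat set" where
  "fv (Equal s t) = fv_trm s \<union> fv_trm t"
| "fv (Pred R ts) = \<Union> (set (map fv_trm ts))"
| "fv (Neg \<phi>) = fv \<phi>"
| "fv (And \<phi> \<psi>) = fv \<phi> \<union> fv \<psi>"
| "fv (Exi x \<phi>) = fv \<phi> - {x}"

primrec eval :: "('f, 'r, 'a) struct \<Rightarrow> (nat \<Rightarrow> 'a) \<Rightarrow> ('f, 'a) trm \<Rightarrow> 'a" where
  "eval C e (Var x) = e x"
| "eval C e (Par a) = a"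
| "eval C e (App f ts) = fint C f (map (eval C e) ts)"

text \<open>Quantifiers range over \<open>D\<close>, so that satisfaction in a substructure can be expressed.\<close>

primrec sat :: "('f, 'r, 'a) struct \<Rightarrow> 'a set \<Rightarrow> (nat \<Rightarrow> 'a) \<Rightarrow> ('f, 'r, 'a) fm \<Rightarrow> bool" where
  "sat C D e (Equal s t) = (eval C e s = eval C e t)"
| "sat C D e (Pred R ts) = rint C R (map (eval C e) ts)"
| "sat C D e (Neg \<phi>) = (\<not> sat C D e \<phi>)"
| "sat C D e (And \<phi> \<psi>) = (sat C D e \<phi> \<and> sat C D e \<psi>)"
| "sat C D e (Exi x \<phi>) = (\<exists>d\<in>D. sat C D (e(x := d)) \<phi>)"

definition formulas :: "('f, 'r, 'a) struct \<Rightarrow> nat \<Rightarrow> 'a set \<Rightarrow> ('f, 'r, 'a) fm set" where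
  "formulas C n B = {\<phi>. wf_fm C \<phi> \<and> fv \<phi> \<subseteq> {..<n} \<and> pars \<phi> \<subseteq> B}"

text \<open>
  \<open>holds\<close> is only used for formulas with free variables among \<open>0,\<dots>,length a - 1\<close>; the values of
  \<open>(!) a\<close> beyond the length of the list are then irrelevant.
\<close>

definition holds :: "('f, 'r, 'a) struct \<Rightarrow> 'a list \<Rightarrow> ('f, 'r, 'a) fm \<Rightarrow> bool" where
  "holds C a \<phi> \<longleftrightarrow> sat C UNIV ((!) a) \<phi>"

definition realizes ::
  "('f, 'r, 'a) struct \<Rightarrow> nat \<Rightarrow> 'a list \<Rightarrow> ('f, 'r, 'a) fm set \<Rightarrow> bool" where
  "realizes C n a \<pi> \<longleftrightarrow> length a = n \<and> (\<forall>\<phi>\<in>\<pi>. holds C a \<phi>)"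

definition tp :: "('f, 'r, 'a) struct \<Rightarrow> 'a list \<Rightarrow> 'a set \<Rightarrow> ('f, 'r, 'a) fm set" where
  "tp C a B = {\<phi> \<in> formulas C (length a) B. holds C a \<phi>}"

definition finitely_satisfiable ::
  "('f, 'r, 'a) struct \<Rightarrow> nat \<Rightarrow> ('f, 'r, 'a) fm set \<Rightarrow> bool" where
  "finitely_satisfiable C n \<pi> \<longleftrightarrow>
     (\<forall>\<pi>0. finite \<pi>0 \<and> \<pi>0 \<subseteq> \<pi> \<longrightarrow> (\<exists>a. realizes C n a \<pi>0))"

definition entails ::
  "('f, 'r, 'a) struct \<Rightarrow> nat \<Rightarrow> ('f, 'r, 'a) fm set \<Rightarrow> ('f, 'r, 'a) fm set \<Rightarrow> bool" where
  "entails C n \<pi> \<rho> \<longleftrightarrow>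
     (\<forall>\<psi>\<in>\<rho>. \<exists>\<pi>0. finite \<pi>0 \<and> \<pi>0 \<subseteq> \<pi> \<and> (\<forall>a. realizes C n a \<pi>0 \<longrightarrow> holds C a \<psi>))"


section \<open>The monster model\<close>

definition automorphism :: "('f, 'r, 'a) struct \<Rightarrow> ('a \<Rightarrow> 'a) \<Rightarrow> bool" where
  "automorphism C \<sigma> \<longleftrightarrow> bij \<sigma> \<and>
     (\<forall>f as. length as = farity C f \<longrightarrow> \<sigma> (fint C f as) = fint C f (map \<sigma> as)) \<and>
     (\<forall>R as. length as = rarity C R \<longrightarrow> rint C R as = rint C R (map \<sigma> as))"

definition partial_elementary :: "('f, 'r, 'a) struct \<Rightarrow> 'a set \<Rightarrow> ('a \<Rightarrow> 'a) \<Rightarrow> bool" where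
  "partial_elementary C B g \<longleftrightarrow>
     (\<forall>\<phi> \<in> formulas C 0 B. holds C [] \<phi> \<longleftrightarrow> holds C [] (map_pars g \<phi>))"

definition elementary_substructure :: "('f, 'r, 'a) struct \<Rightarrow> 'a set \<Rightarrow> bool" where
  "elementary_substructure C M \<longleftrightarrow> M \<noteq> {} \<and>
     (\<forall>f as. length as = farity C f \<and> set as \<subseteq> M \<longrightarrow> fint C f as \<in> M) \<and>
     (\<forall>\<phi> e. wf_fm C \<phi> \<and> pars \<phi> \<subseteq> M \<and> range e \<subseteq> M \<longrightarrow> sat C M e \<phi> = sat C UNIV e \<phi>)"

definition small :: "'k rel \<Rightarrow> 'a set \<Rightarrow> bool" where
  "small \<kappa> B \<longleftrightarrow> (card_of B, \<kappa>) \<in> ordLess"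

definition saturated :: "('f, 'r, 'a) struct \<Rightarrow> 'k rel \<Rightarrow> bool" where
  "saturated C \<kappa> \<longleftrightarrow>
     (\<forall>B n \<pi>. small \<kappa> B \<and> \<pi> \<subseteq> formulas C n B \<and> finitely_satisfiable C n \<pi> \<longrightarrow>
        (\<exists>a. realizes C n a \<pi>))"

definition strongly_homogeneous :: "('f, 'r, 'a) struct \<Rightarrow> 'k rel \<Rightarrow> bool" where
  "strongly_homogeneous C \<kappa> \<longleftrightarrow>
     (\<forall>B g. small \<kappa> B \<and> partial_elementary C B g \<longrightarrow>
        (\<exists>\<sigma>. automorphism C \<sigma> \<and> (\<forall>b\<in>B. \<sigma> b = g b)))"

text \<open>
  The universe of the monster model is the type \<open>'a\<close>, its theory is \<open>T\<close>, and \<open>\<kappa>\<close> is an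
  uncountable cardinal exceeding the number of symbols of the language.
\<close>

definition monster :: "('f, 'r, 'a) struct \<Rightarrow> 'k rel \<Rightarrow> bool" where
  "monster C \<kappa> \<longleftrightarrow> Card_order \<kappa> \<and> small \<kappa> (UNIV :: nat set) \<and>
     small \<kappa> (UNIV :: 'f set) \<and> small \<kappa> (UNIV :: 'r set) \<and>
     saturated C \<kappa> \<and> strongly_homogeneous C \<kappa>"


section \<open>Global types\<close>

definition global_type :: "('f, 'r, 'a) struct \<Rightarrow> nat \<Rightarrow> ('f, 'r, 'a) fm set \<Rightarrow> bool" where
  "global_type C n p \<longleftrightarrow> p \<subseteq> formulas C n UNIV \<and> finitely_satisfiable C n p \<and>
     (\<forall>\<phi> \<in> formulas C n UNIV. \<phi> \<in> p \<or> Neg \<phi> \<in> p)"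

definition restr :: "('f, 'r, 'a) fm set \<Rightarrow> 'a set \<Rightarrow> ('f, 'r, 'a) fm set" where
  "restr p B = {\<phi> \<in> p. pars \<phi> \<subseteq> B}"

definition non_algebraic :: "('f, 'r, 'a) struct \<Rightarrow> nat \<Rightarrow> ('f, 'r, 'a) fm set \<Rightarrow> bool" where
  "non_algebraic C n p \<longleftrightarrow> (\<forall>\<phi>\<in>p. infinite {a. length a = n \<and> holds C a \<phi>})"

definition invariant :: "('f, 'r, 'a) struct \<Rightarrow> 'a set \<Rightarrow> ('f, 'r, 'a) fm set \<Rightarrow> bool" where
  "invariant C A p \<longleftrightarrow>
     (\<forall>\<sigma>. automorphism C \<sigma> \<and> (\<forall>a\<in>A. \<sigma> a = a) \<longrightarrow> map_pars \<sigma> ` p = p)"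

definition dichotomy ::
  "('f, 'r, 'a) struct \<Rightarrow> 'k rel \<Rightarrow> 'a set \<Rightarrow> nat \<Rightarrow> ('f, 'r, 'a) fm set \<Rightarrow> 'a list \<Rightarrow> bool" where
  "dichotomy C \<kappa> A n p a \<longleftrightarrow>
     (\<forall>B. small \<kappa> B \<and> A \<subseteq> B \<longrightarrow>
        realizes C n a (restr p B) \<or> entails C n (restr p B) (restr p (B \<union> set a)))"

definition regular ::
  "('f, 'r, 'a) struct \<Rightarrow> 'k rel \<Rightarrow> 'a set \<Rightarrow> nat \<Rightarrow> ('f, 'r, 'a) fm set \<Rightarrow> bool" where
  "regular C \<kappa> A n p \<longleftrightarrow> non_algebraic C n p \<and> invariant C A p \<and>
     (\<forall>a. realizes C n a (restr p A) \<longrightarrow> dichotomy C \<kappa> A n p a)"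

definition strongly_regular ::
  "('f, 'r, 'a) struct \<Rightarrow> 'k rel \<Rightarrow> 'a set \<Rightarrow> nat \<Rightarrow> ('f, 'r, 'a) fm set \<Rightarrow> bool" where
  "strongly_regular C \<kappa> A n p \<longleftrightarrow> non_algebraic C n p \<and> invariant C A p \<and>
     (\<exists>\<phi> \<in> restr p A. \<forall>a. length a = n \<and> holds C a \<phi> \<longrightarrow> dichotomy C \<kappa> A n p a)"

definition weakly_orthogonal ::
  "('f, 'r, 'a) struct \<Rightarrow> 'a set \<Rightarrow> nat \<Rightarrow> ('f, 'r, 'a) fm set \<Rightarrow> nat \<Rightarrow> ('f, 'r, 'a) fm set \<Rightarrow> bool"
  where
  "weakly_orthogonal C A n \<pi> m \<rho> \<longleftrightarrow>
     (\<forall>a a' b b'. realizes C n a \<pi> \<and> realizes C n a' \<pi> \<and> realizes C m b \<rho> \<and> realizes C m b' \<rho> \<longrightarrow>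
        tp C (a @ b) A = tp C (a' @ b') A)"

text \<open>
  The product of the \<open>A\<close>-invariant global types \<open>p(x)\<close> and \<open>q(y)\<close>, where \<open>x\<close> stands for the first
  \<open>n\<close> variables and \<open>y\<close> for the next \<open>m\<close>.  The defining realizations of \<open>p\<close>
  and of the extension of \<open>q\<close> live outside the universe; by \<open>A\<close>-invariance, whether a given formula
  belongs to the product can be tested inside the universe over \<open>A\<close> and the parameters of that
  formula.  The second definition is the product \<open>q(y) \<otimes> p(x)\<close>, written in the same variables
  \<open>(x,y)\<close> so that it can be compared with the first.
\<close>

definition product_pq ::
  "('f, 'r, 'a) struct \<Rightarrow> 'a set \<Rightarrow> nat \<Rightarrow> ('f, 'r, 'a) fm set \<Rightarrow> nat \<Rightarrow> ('f, 'r, 'a) fm set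
     \<Rightarrow> ('f, 'r, 'a) fm set" where
  "product_pq C A n p m q = {\<phi> \<in> formulas C (n + m) UNIV.
     \<exists>a b. realizes C n a (restr p (A \<union> pars \<phi>)) \<and>
           realizes C m b (restr q (A \<union> pars \<phi> \<union> set a)) \<and> holds C (a @ b) \<phi>}"

definition product_qp ::
  "('f, 'r, 'a) struct \<Rightarrow> 'a set \<Rightarrow> nat \<Rightarrow> ('f, 'r, 'a) fm set \<Rightarrow> nat \<Rightarrow> ('f, 'r, 'a) fm set
     \<Rightarrow> ('f, 'r, 'a) fm set" where
  "product_qp C A n p m q = {\<phi> \<in> formulas C (n + m) UNIV.
     \<exists>b a. realizes C m b (restr q (A \<union> pars \<phi>)) \<and>
           realizes C n a (restr p (A \<union> pars \<phi> \<union> set b)) \<and> holds C (a @ b) \<phi>}"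


section \<open>Morley sequences\<close>

text \<open>
  Realizations of \<open>p\<close> over a set containing a given tuple differ from that tuple when \<open>p\<close> is
  non-algebraic, so a Morley sequence indexed by a linear order has pairwise distinct entries.  It is
  therefore represented by the (reflexive) linear order which it induces on the set of its entries.
\<close>

definition morley ::
  "('f, 'r, 'a) struct \<Rightarrow> 'a set \<Rightarrow> nat \<Rightarrow> ('f, 'r, 'a) fm set \<Rightarrow> 'a list rel \<Rightarrow> bool" where
  "morley C A n p r \<longleftrightarrow> Linear_order r \<and>
     (\<forall>a \<in> Field r. realizes C n a (restr p (A \<union> \<Union> (set ` {b. (b, a) \<in> r \<and> b \<noteq> a}))))"

definition morley_pair ::
  "('f, 'r, 'a) struct \<Rightarrow> 'a set \<Rightarrow> nat \<Rightarrow> ('f, 'r, 'a) fm set \<Rightarrow> 'a list \<Rightarrow> 'a list \<Rightarrow> bool" where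
  "morley_pair C A n p a b \<longleftrightarrow>
     realizes C n a (restr p A) \<and> realizes C n b (restr p (A \<union> set a))"

definition asymmetric ::
  "('f, 'r, 'a) struct \<Rightarrow> 'a set \<Rightarrow> nat \<Rightarrow> ('f, 'r, 'a) fm set \<Rightarrow> bool" where
  "asymmetric C A n p \<longleftrightarrow> invariant C A p \<and>
     (\<exists>a b. morley_pair C A n p a b \<and> tp C (a @ b) A \<noteq> tp C (b @ a) A)"

definition convex ::
  "('f, 'r, 'a) struct \<Rightarrow> 'a set \<Rightarrow> nat \<Rightarrow> ('f, 'r, 'a) fm set \<Rightarrow> bool" where
  "convex C A n p \<longleftrightarrow> (\<exists>\<psi> \<in> formulas C (n + n) A.
     partial_order_on {a. length a = n}
       {(a, b). length a = n \<and> length b = n \<and> holds C (a @ b) \<psi>} \<and>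
     (\<forall>r a b. morley C A n p r \<and> (a, b) \<in> r \<and> a \<noteq> b \<longrightarrow> holds C (a @ b) \<psi>) \<and>
     (\<forall>a b c. realizes C n a (restr p A) \<and> realizes C n b (restr p A) \<and> length c = n \<and>
        holds C (a @ c) \<psi> \<and> holds C (c @ b) \<psi> \<longrightarrow> realizes C n c (restr p A)))"

definition cls ::
  "('f, 'r, 'a) struct \<Rightarrow> 'a set \<Rightarrow> nat \<Rightarrow> ('f, 'r, 'a) fm set \<Rightarrow> 'a list \<Rightarrow> 'a list set" where
  "cls C A n p a = {c. realizes C n c (restr p A) \<and>
     \<not> realizes C n c (restr p (A \<union> set a)) \<and> \<not> realizes C n a (restr p (A \<union> set c))}"

definition cls_le ::
  "('f, 'r, 'a) struct \<Rightarrow> 'a set \<Rightarrow> nat \<Rightarrow> ('f, 'r, 'a) fm set \<Rightarrow> 'a list \<Rightarrow> 'a list \<Rightarrow> bool" where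
  "cls_le C A n p a b \<longleftrightarrow> cls C A n p a = cls C A n p b \<or> morley_pair C A n p a b"

definition bounded_set ::
  "('f, 'r, 'a) struct \<Rightarrow> 'a set \<Rightarrow> nat \<Rightarrow> ('f, 'r, 'a) fm set \<Rightarrow> 'a list set \<Rightarrow> bool" where
  "bounded_set C A n q D \<longleftrightarrow>
     (\<exists>d\<in>D. realizes C n d (restr q A)) \<and>
     (\<exists>l u. realizes C n l (restr q A) \<and> realizes C n u (restr q A) \<and>
        (\<forall>d\<in>D. realizes C n d (restr q A) \<longrightarrow> cls_le C A n q l d \<and> cls_le C A n q d u))"

definition simple ::
  "('f, 'r, 'a) struct \<Rightarrow> 'a set \<Rightarrow> nat \<Rightarrow> ('f, 'r, 'a) fm set \<Rightarrow> bool" where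
  "simple C A n p \<longleftrightarrow> (\<exists>\<psi> \<in> formulas C (n + n) A.
     \<forall>a b. realizes C n a (restr p A) \<and> realizes C n b (restr p A) \<longrightarrow>
        (a \<in> cls C A n p b \<longleftrightarrow> holds C (a @ b) \<psi>))"

definition bounded_type ::
  "('f, 'r, 'a) struct \<Rightarrow> 'a set \<Rightarrow> nat \<Rightarrow> ('f, 'r, 'a) fm set \<Rightarrow> nat \<Rightarrow> ('f, 'r, 'a) fm set \<Rightarrow> bool"
  where
  "bounded_type C A n p m q \<longleftrightarrow>
     (\<exists>a b. realizes C n a (restr p A) \<and> realizes C m b (restr q A) \<and>
        (\<exists>\<theta> \<in> tp C (a @ b) A. bounded_set C A m q {d. length d = m \<and> holds C (a @ d) \<theta>}))"

definition morley_in ::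
  "('f, 'r, 'a) struct \<Rightarrow> 'a set \<Rightarrow> nat \<Rightarrow> ('f, 'r, 'a) fm set \<Rightarrow> 'a set \<Rightarrow> 'a list rel \<Rightarrow> bool" where
  "morley_in C A n p M r \<longleftrightarrow> morley C A n p r \<and> (\<forall>a \<in> Field r. set a \<subseteq> M)"

text \<open>
  \<open>is_Inv C A n p M r\<close>: the linear order \<open>r\<close> is a maximal Morley sequence in \<open>p\<close> over \<open>A\<close>
  of elements of \<open>M\<close>, i.e. a representative of the order type \<open>Inv\<^bsub>p,A\<^esub>(M)\<close>.
  For linear orders \<open>r \<subseteq> s\<close>, the order \<open>r\<close> is the restriction of \<open>s\<close> to the field of \<open>r\<close>, hence
  inclusion is extension of sequences.
\<close>

definition is_Inv ::
  "('f, 'r, 'a) struct \<Rightarrow> 'a set \<Rightarrow> nat \<Rightarrow> ('f, 'r, 'a) fm set \<Rightarrow> 'a set \<Rightarrow> 'a list rel \<Rightarrow> bool" where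
  "is_Inv C A n p M r \<longleftrightarrow> morley_in C A n p M r \<and>
     (\<forall>s. morley_in C A n p M s \<and> r \<subseteq> s \<longrightarrow> s = r)"


section \<open>Linear orders\<close>

definition isomorphic :: "'b rel \<Rightarrow> 'c rel \<Rightarrow> bool" where
  "isomorphic r s \<longleftrightarrow> (\<exists>h. bij_betw h (Field r) (Field s) \<and>
     (\<forall>x \<in> Field r. \<forall>y \<in> Field r. (x, y) \<in> r \<longleftrightarrow> (h x, h y) \<in> s))"

definition anti_isomorphic :: "'b rel \<Rightarrow> 'c rel \<Rightarrow> bool" where
  "anti_isomorphic r s \<longleftrightarrow> isomorphic r (s\<inverse>)"

definition upper_bounds :: "'b rel \<Rightarrow> 'b set \<Rightarrow> 'b set" where
  "upper_bounds r X = {u \<in> Field r. \<forall>x\<in>X. (x, u) \<in> r}"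

definition lower_bounds :: "'b rel \<Rightarrow> 'b set \<Rightarrow> 'b set" where
  "lower_bounds r X = {l \<in> Field r. \<forall>x\<in>X. (l, x) \<in> r}"

text \<open>
  The Dedekind (Dedekind--MacNeille) completion: the set of lower parts of cuts, ordered by
  inclusion.  It has a least and a greatest element, and the completion of the empty order
  consists of the single cut \<open>{}\<close>.
\<close>

definition cuts :: "'b rel \<Rightarrow> 'b set set" where
  "cuts r = {L. L \<subseteq> Field r \<and> lower_bounds r (upper_bounds r L) = L}"

definition dedekind_completion :: "'b rel \<Rightarrow> 'b set rel" where
  "dedekind_completion r = {(L, L'). L \<in> cuts r \<and> L' \<in> cuts r \<and> L \<subseteq> L'}"

lemma dedekind_completion_empty: "dedekind_completion {} = {({}, {})}"
  by (auto simp: dedekind_completion_def cuts_def lower_bounds_def upper_bounds_def)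


section \<open>Existence of maximal Morley sequences\<close>

lemma finite_pars_trm: "finite (pars_trm t)"
  by (induction t) auto

lemma finite_pars: "finite (pars \<phi>)"
  by (induction \<phi>) (auto simp: finite_pars_trm)

lemma Linear_order_Union_chain:
  assumes "subset.chain S \<R>" "\<And>r. r \<in> \<R> \<Longrightarrow> Linear_order r"
  shows "Linear_order (\<Union>\<R>)"
proof -
  have two: "\<exists>r\<in>\<R>. x \<in> r \<and> y \<in> r" if "x \<in> \<Union>\<R>" "y \<in> \<Union>\<R>" for x y
    using that assms(1) unfolding subset.chain_def by blast
  have lin: "refl_on (Field r) r" "trans r" "antisym r" "total_on (Field r) r" if "r \<in> \<R>" for r
    using assms(2)[OF that] by (auto simp: order_on_defs)
  have 0: "\<Union>\<R> \<subseteq> Field (\<Union>\<R>) \<times> Field (\<Union>\<R>)"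
    by (auto simp: Field_def)
  have 1: "refl_on (Field (\<Union>\<R>)) (\<Union>\<R>)"
  proof (rule refl_onI)
    fix x assume "x \<in> Field (\<Union>\<R>)"
    then obtain r where "r \<in> \<R>" "x \<in> Field r" by (auto simp: Field_def)
    then show "(x, x) \<in> \<Union>\<R>" using lin(1) by (blast dest: refl_onD)
  qed
  have 2: "trans (\<Union>\<R>)"
    by (rule transI) (meson UnionI lin(2) transD two)
  have 3: "antisym (\<Union>\<R>)"
    by (rule antisymI) (meson lin(3) antisymD two)
  have 4: "total_on (Field (\<Union>\<R>)) (\<Union>\<R>)"
  proof (rule total_onI)
    fix x y assume xy: "x \<in> Field (\<Union>\<R>)" "y \<in> Field (\<Union>\<R>)" "x \<noteq> y"
    have "(x, x) \<in> \<Union>\<R>" "(y, y) \<in> \<Union>\<R>" using xy 1 by (auto dest: refl_onD)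
    then obtain r where "r \<in> \<R>" "(x, x) \<in> r" "(y, y) \<in> r" using two by blast
    then have "(x, y) \<in> r \<or> (y, x) \<in> r"
      using lin(4)[of r] xy(3) by (metis FieldI1 total_on_def)
    with \<open>r \<in> \<R>\<close> show "(x, y) \<in> \<Union>\<R> \<or> (y, x) \<in> \<Union>\<R>" by blast
  qed
  show ?thesis using 0 1 2 3 4 by (simp add: order_on_defs)
qed

lemma is_Inv_exists: "\<exists>r. is_Inv C A n p M r"
proof -
  let ?S = "{r. morley_in C A n p M r}"
  have "{} \<in> ?S"
    by (simp add: morley_in_def morley_def)
  moreover have "\<Union>\<R> \<in> ?S" if ne: "\<R> \<noteq> {}" and ch: "subset.chain ?S \<R>" for \<R>
  proof -
    have mor: "morley_in C A n p M r" if "r \<in> \<R>" for r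
      using that ch by (auto simp: subset.chain_def)
    have lin: "Linear_order (\<Union>\<R>)"
      by (rule Linear_order_Union_chain[OF ch]) (use mor in \<open>auto simp: morley_in_def morley_def\<close>)
    have el: "set a \<subseteq> M" if "a \<in> Field (\<Union>\<R>)" for a
      using that mor by (fastforce simp: morley_in_def Field_def)
    have "realizes C n a (restr p (A \<union> \<Union> (set ` {b. (b, a) \<in> \<Union>\<R> \<and> b \<noteq> a})))"
      if a: "a \<in> Field (\<Union>\<R>)" for a
    proof -
      have len: "length a = n"
        using a mor by (fastforce simp: morley_in_def morley_def realizes_def Field_def)
      have "holds C a \<phi>"
        if \<phi>: "\<phi> \<in> p" "pars \<phi> \<subseteq> A \<union> \<Union> (set ` {b. (b, a) \<in> \<Union>\<R> \<and> b \<noteq> a})" for \<phi>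
      proof -
        have "pars \<phi> - A \<subseteq> \<Union> (set ` {b. (b, a) \<in> \<Union>\<R> \<and> b \<noteq> a})" using \<phi>(2) by blast
        then obtain F where F: "finite F" "F \<subseteq> set ` {b. (b, a) \<in> \<Union>\<R> \<and> b \<noteq> a}"
            "pars \<phi> - A \<subseteq> \<Union> F"
          by (rule finite_subset_Union[OF finite_Diff[OF finite_pars]])
        from finite_subset_image[OF F(1,2)] obtain Bs where
            Bs: "Bs \<subseteq> {b. (b, a) \<in> \<Union>\<R> \<and> b \<noteq> a}" "finite Bs" "F = set ` Bs"
          by blast
        have aa: "(a, a) \<in> \<Union>\<R>"
          using lin a by (auto simp: order_on_defs dest: refl_onD)
        have "finite (insert (a, a) ((\<lambda>b. (b, a)) ` Bs))" using Bs(2) by simp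
        moreover have "insert (a, a) ((\<lambda>b. (b, a)) ` Bs) \<subseteq> \<Union>\<R>" using Bs(1) aa by blast
        ultimately obtain r where r: "r \<in> \<R>" "insert (a, a) ((\<lambda>b. (b, a)) ` Bs) \<subseteq> r"
          by (rule finite_subset_Union_chain[OF _ _ ne ch])
        then have "a \<in> Field r" by (auto simp: Field_def)
        then have re: "realizes C n a (restr p (A \<union> \<Union> (set ` {b. (b, a) \<in> r \<and> b \<noteq> a})))"
          using mor[OF r(1)] by (simp add: morley_in_def morley_def)
        have "Bs \<subseteq> {b. (b, a) \<in> r \<and> b \<noteq> a}" using r(2) Bs(1) by blast
        then have "pars \<phi> \<subseteq> A \<union> \<Union> (set ` {b. (b, a) \<in> r \<and> b \<noteq> a})" using F(3) Bs(3) by blast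
        with re \<phi>(1) show ?thesis unfolding realizes_def restr_def by blast
      qed
      with len show ?thesis by (simp add: realizes_def restr_def)
    qed
    with lin el show ?thesis by (simp add: morley_in_def morley_def)
  qed
  ultimately obtain r where "r \<in> ?S" "\<forall>s\<in>?S. r \<subseteq> s \<longrightarrow> s = r"
    using subset_Zorn_nonempty[of ?S] by blast
  then show ?thesis by (auto simp: is_Inv_def)
qed

end

theory Submission
  imports Defs
begin

text \<open>
  Write \<open>a < b\<close> for ``\<open>(a, b)\<close> is a Morley sequence''.  Regularity makes the elements not generic over a
  set a closure of that set, and together with asymmetry this turns \<open><\<close> into a strict weak order whose
  chains are the Morley sequences; a maximal one in \<open>M\<close> is a transversal of the classes meeting \<open>M\<close>.
  If the products differ, a realization of either type lies in the closure of every realization of the other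
  type generic over it, and both orders merge into one; if they agree, this happens after reversing the
  order of the second type.

  In the bounded case a bounded formula \<open>\<theta>(x,y)\<close> is strictly monotone with respect to these orders, so it
  links classes to classes.  In the unbounded case no class of one type is tied to a class of the other,
  the cuts that realizations of one type make in the other are relatively definable, and the two orders
  lie densely in one another.  Convexity serves to find realizations inside \<open>M\<close>.
\<close>

section \<open>Linear orders\<close>

text \<open>The model \<open>M\<close> sees formulas, while genericity over a tuple is a priori only
  type-definable; this tension shapes the proof. Failure of genericity (dependence) is open: one
  formula witnesses it, and by invariance its negation holds at every generic pair. In the unbounded
  case compactness makes dependence relatively definable, since otherwise some formula would have a
  bounded fibre. The two types communicate through one transfer principle: a tuple that disturbs no
  realization of one type disturbs none of the other (\<open>gen_extends\<close>,
  \<open>gen_extends_base\<close>). It makes links increasing when the products differ, and it lets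
  non-realizations be ignored when the order is defined by a formula. In the unbounded case an
  element of one order is only a cut in the other, so just the completions can be compared.
  Separating each other's points is not enough for that: one point placed between two points
  separates them, but the completions have one and two elements. Hence density inside each order is
  proved as well.\<close>

lemma isomorphicI_link:
  assumes "Linear_order r" and s: "Linear_order s"
    and "\<And>x. x \<in> Field r \<Longrightarrow> \<exists>y \<in> Field s. T x y"
    and "\<And>y. y \<in> Field s \<Longrightarrow> \<exists>x \<in> Field r. T x y"
    and T: "\<And>x y x' y'. x \<in> Field r \<Longrightarrow> x' \<in> Field r \<Longrightarrow> y \<in> Field s \<Longrightarrow> y' \<in> Field s \<Longrightarrow>
       T x y \<Longrightarrow> T x' y' \<Longrightarrow> (x, x') \<in> r \<and> x \<noteq> x' \<longleftrightarrow> (y, y') \<in> s \<and> y \<noteq> y'"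
  shows "isomorphic r s"
proof -
  \<comment> \<open>Any choice works: two partners of the same \<open>x\<close> are incomparable by
    the strict equivalence, hence equal in a linear order.\<close>
  obtain h where h: "\<And>x. x \<in> Field r \<Longrightarrow> h x \<in> Field s \<and> T x (h x)"
    using assms(3) by metis
  have tr: "x = y \<or> (x, y) \<in> r \<or> (y, x) \<in> r" "(x, x) \<in> r" if "x \<in> Field r" "y \<in> Field r" for x y
    using assms(1) that unfolding order_on_defs by (auto simp: total_on_def dest: refl_onD)
  have ts: "x = y \<or> (x, y) \<in> s \<or> (y, x) \<in> s" "(x, x) \<in> s" if "x \<in> Field s" "y \<in> Field s" for x y
    using s that unfolding order_on_defs by (auto simp: total_on_def dest: refl_onD)
  have inj: "inj_on h (Field r)"
    by (rule inj_onI) (metis T h tr(1))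
  have "h ` Field r = Field s"
  proof
    show "Field s \<subseteq> h ` Field r"
    proof
      fix y assume y: "y \<in> Field s"
      then obtain x where x: "x \<in> Field r" "T x y" using assms(4) by blast
      then have "h x = y" using T[OF x(1) x(1) _ y _ x(2)] T[OF x(1) x(1) y _ x(2)] h[OF x(1)] ts(1) y
        by blast
      then show "y \<in> h ` Field r" using x(1) by blast
    qed
  qed (use h in blast)
  then have "bij_betw h (Field r) (Field s)" using inj by (simp add: bij_betw_def)
  moreover have "(x, y) \<in> r \<longleftrightarrow> (h x, h y) \<in> s" if "x \<in> Field r" "y \<in> Field r" for x y
    using T[OF that, of "h x" "h y"] h[OF that(1)] h[OF that(2)] that tr(2) ts(2)
    by (cases "x = y") (simp_all add: inj_on_eq_iff[OF inj], blast)
  ultimately show ?thesis unfolding isomorphic_def by blast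
qed

lemma isomorphic_trans: "isomorphic r s \<Longrightarrow> isomorphic s t \<Longrightarrow> isomorphic r t"
  unfolding isomorphic_def
proof (elim exE conjE)
  fix h k assume h: "bij_betw h (Field r) (Field s)" "\<forall>x\<in>Field r. \<forall>y\<in>Field r. ((x, y) \<in> r) = ((h x, h y) \<in> s)"
    and k: "bij_betw k (Field s) (Field t)" "\<forall>x\<in>Field s. \<forall>y\<in>Field s. ((x, y) \<in> s) = ((k x, k y) \<in> t)"
  have "h x \<in> Field s" if "x \<in> Field r" for x using h(1) that by (auto simp: bij_betw_def)
  then show "\<exists>g. bij_betw g (Field r) (Field t) \<and>
    (\<forall>x\<in>Field r. \<forall>y\<in>Field r. ((x, y) \<in> r) = ((g x, g y) \<in> t))"
    using bij_betw_trans[OF h(1) k(1)] h(2) k(2) by (intro exI[of _ "k \<circ> h"]) simp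
qed

lemma Field_dedekind_completion: "Field (dedekind_completion r) = cuts r"
  by (auto simp: Field_def dedekind_completion_def)

text \<open>The target order \<open>t\<close> on \<open>cuts s\<close> is left open so that
  inclusion and reverse inclusion are both covered.\<close>

lemma isomorphicI_dedekind:
  assumes "\<And>L. L \<in> cuts r \<Longrightarrow> f L \<in> cuts s \<and> g (f L) = L"
    and "\<And>K. K \<in> cuts s \<Longrightarrow> g K \<in> cuts r \<and> f (g K) = K"
    and "\<And>L L'. L \<in> cuts r \<Longrightarrow> L' \<in> cuts r \<Longrightarrow> L \<subseteq> L' \<longleftrightarrow> (f L, f L') \<in> t"
    and "Field t = cuts s"
  shows "isomorphic (dedekind_completion r) t"
  unfolding isomorphic_def Field_dedekind_completion assms(4)
proof (intro exI conjI ballI)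
  show "bij_betw f (cuts r) (cuts s)"
    by (rule bij_betw_byWitness[where f' = g]) (use assms(1,2) in auto)
  show "(L, L') \<in> dedekind_completion r \<longleftrightarrow> (f L, f L') \<in> t" if "L \<in> cuts r" "L' \<in> cuts r" for L L'
    using assms(3)[OF that] that by (simp add: dedekind_completion_def)
qed

lemma lower_upper_lower: "X \<subseteq> Field r \<Longrightarrow> lower_bounds r (upper_bounds r (lower_bounds r X)) = lower_bounds r X"
  by (fastforce simp: lower_bounds_def upper_bounds_def)

text \<open>Upper and lower bounds form a Galois connection, so every set closes up to a
  cut.\<close>

lemma closure_in_cuts: "lower_bounds r (upper_bounds r X) \<in> cuts r"
proof -
  have "upper_bounds r X \<subseteq> Field r" by (auto simp: upper_bounds_def)
  then show ?thesis
    unfolding cuts_def using lower_upper_lower[of "upper_bounds r X" r] by (auto simp: lower_bounds_def)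
qed

text \<open>A cut of the reversed order is the upper half of a cut of \<open>s\<close>, and passing
  to the lower half reverses inclusion. This turns an isomorphism onto the completion of the
  reversed order into an anti-isomorphism.\<close>

lemma isomorphic_dedekind_completion_converse:
  "isomorphic (dedekind_completion (s\<inverse>)) ((dedekind_completion s)\<inverse>)"
proof (rule isomorphicI_dedekind[where f = "lower_bounds s" and g = "upper_bounds s" and s = s])
  have eq: "lower_bounds (s\<inverse>) = upper_bounds s" "upper_bounds (s\<inverse>) = lower_bounds s"
    by (auto simp: lower_bounds_def upper_bounds_def fun_eq_iff)
  have sub: "lower_bounds s X \<subseteq> Field s" "upper_bounds s X \<subseteq> Field s" for X
    by (auto simp: lower_bounds_def upper_bounds_def)
  have *: "lower_bounds s L \<in> cuts s \<and> upper_bounds s (lower_bounds s L) = L" if "L \<in> cuts (s\<inverse>)" for L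
    using that sub unfolding cuts_def eq by auto
  show "lower_bounds s L \<in> cuts s \<and> upper_bounds s (lower_bounds s L) = L" if "L \<in> cuts (s\<inverse>)" for L
    by (rule *[OF that])
  show "upper_bounds s K \<in> cuts (s\<inverse>) \<and> lower_bounds s (upper_bounds s K) = K" if "K \<in> cuts s" for K
    using that sub unfolding cuts_def eq by auto
  show "L \<subseteq> L' \<longleftrightarrow> (lower_bounds s L, lower_bounds s L') \<in> (dedekind_completion s)\<inverse>"
    if "L \<in> cuts (s\<inverse>)" "L' \<in> cuts (s\<inverse>)" for L L'
  proof -
    have "L \<subseteq> L' \<longleftrightarrow> lower_bounds s L' \<subseteq> lower_bounds s L"
    proof
      assume "lower_bounds s L' \<subseteq> lower_bounds s L"
      then have "upper_bounds s (lower_bounds s L) \<subseteq> upper_bounds s (lower_bounds s L')"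
        by (auto simp: upper_bounds_def)
      then show "L \<subseteq> L'" using *[OF that(1)] *[OF that(2)] by simp
    qed (auto simp: lower_bounds_def)
    then show ?thesis using *[OF that(1)] *[OF that(2)] by (simp add: dedekind_completion_def)
  qed
qed (simp add: Field_dedekind_completion)

text \<open>\<open>L x y\<close> places \<open>x\<close> below \<open>y\<close> and \<open>\<not> L x y\<close> places \<open>y\<close> below \<open>x\<close>, so that \<open>L\<close> amalgamates two
  linear orders into one in which each of them is dense in the other.\<close>

locale interleaved =
  fixes r :: "'b rel" and s :: "'c rel" and L :: "'b \<Rightarrow> 'c \<Rightarrow> bool"
  assumes lin: "Linear_order r" "Linear_order s"
    and left: "(x', x) \<in> r \<Longrightarrow> y \<in> Field s \<Longrightarrow> L x y \<Longrightarrow> L x' y"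
    and right: "(y, y') \<in> s \<Longrightarrow> x \<in> Field r \<Longrightarrow> L x y \<Longrightarrow> L x y'"
    and dense_left: "(x, x') \<in> r \<Longrightarrow> x \<noteq> x' \<Longrightarrow> \<exists>z. (x, z) \<in> r \<and> (z, x') \<in> r \<and> z \<noteq> x \<and> z \<noteq> x'"
    and dense_right: "(y, y') \<in> s \<Longrightarrow> y \<noteq> y' \<Longrightarrow> \<exists>z. (y, z) \<in> s \<and> (z, y') \<in> s \<and> z \<noteq> y \<and> z \<noteq> y'"
    and cross_left: "(x, x') \<in> r \<Longrightarrow> x \<noteq> x' \<Longrightarrow> \<exists>y \<in> Field s. L x y \<and> \<not> L x' y"
    and cross_right: "(y, y') \<in> s \<Longrightarrow> y \<noteq> y' \<Longrightarrow> \<exists>x \<in> Field r. \<not> L x y \<and> L x y'"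
begin

lemma swap: "interleaved s r (\<lambda>y x. \<not> L x y)"
  by (unfold_locales; use lin left right dense_left dense_right cross_left cross_right in blast)

text \<open>The elements placed below some member of \<open>K\<close> form an initial segment that
  may miss its limit; taking bounds twice closes it to a cut.\<close>

definition to_right :: "'b set \<Rightarrow> 'c set" where
  "to_right K = lower_bounds s (upper_bounds s {y \<in> Field s. \<exists>x\<in>K. \<not> L x y})"

definition to_left :: "'c set \<Rightarrow> 'b set" where
  "to_left K = lower_bounds r (upper_bounds r {x \<in> Field r. \<exists>y\<in>K. L x y})"

lemma to_left_to_right:
  assumes K: "K \<in> cuts r"
  shows "to_left (to_right K) = K"
proof -
  have K': "K \<subseteq> Field r" "lower_bounds r (upper_bounds r K) = K" using K by (auto simp: cuts_def)
  have r: "trans r" "antisym r" "\<And>x. x \<in> Field r \<Longrightarrow> (x, x) \<in> r"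
      "\<And>x y. x \<in> Field r \<Longrightarrow> y \<in> Field r \<Longrightarrow> x \<noteq> y \<Longrightarrow> (x, y) \<in> r \<or> (y, x) \<in> r"
    using lin(1) by (auto simp: order_on_defs total_on_def dest: refl_onD)
  have s: "trans s" "antisym s" "\<And>x. x \<in> Field s \<Longrightarrow> (x, x) \<in> s"
      "\<And>x y. x \<in> Field s \<Longrightarrow> y \<in> Field s \<Longrightarrow> x \<noteq> y \<Longrightarrow> (x, y) \<in> s \<or> (y, x) \<in> s"
    using lin(2) by (auto simp: order_on_defs total_on_def dest: refl_onD)
  define S where "S = {y \<in> Field s. \<exists>x\<in>K. \<not> L x y}"
  define T where "T = {x \<in> Field r. \<exists>y\<in>to_right K. L x y}"
  have "T \<subseteq> K"
  proof
    fix a assume "a \<in> T"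
    then obtain b where a: "a \<in> Field r" and b: "b \<in> to_right K" "L a b" by (auto simp: T_def)
    have bs: "b \<in> Field s" using b(1) by (simp add: to_right_def lower_bounds_def)
    have "(a, u) \<in> r" if u: "u \<in> upper_bounds r K" for u
    proof (rule ccontr)
      assume n: "(a, u) \<notin> r"
      have uf: "u \<in> Field r" using u by (simp add: upper_bounds_def)
      then have "(u, a) \<in> r" "u \<noteq> a" using n r(3,4) a by blast+
      \<comment> \<open>If an upper bound \<open>u\<close> of \<open>K\<close> lay below
        \<open>a\<close>, the separating \<open>b'\<close> would bound everything that
        \<open>K\<close> contributes, hence also \<open>b\<close>, although \<open>b\<close> lies
        above \<open>a\<close>.\<close>
      from cross_left[OF this] obtain b' where b': "b' \<in> Field s" "L u b'" "\<not> L a b'" by blast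
      have "(y, b') \<in> s" if y: "y \<in> S" for y
      proof (rule ccontr)
        assume "(y, b') \<notin> s"
        then have 1: "(b', y) \<in> s" using b'(1) y s(3,4) by (auto simp: S_def)
        obtain x where x: "x \<in> K" "\<not> L x y" using y by (auto simp: S_def)
        have "L u y" using right[OF 1 uf b'(2)] .
        moreover have "(x, u) \<in> r" using u x(1) by (simp add: upper_bounds_def)
        ultimately show False using x(2) left y by (auto simp: S_def)
      qed
      then have "(b, b') \<in> s" using b(1) b'(1)
        by (auto simp: to_right_def lower_bounds_def upper_bounds_def S_def)
      from right[OF this a b(2)] b'(3) show False by blast
    qed
    then have "a \<in> lower_bounds r (upper_bounds r K)" using a by (auto simp: lower_bounds_def)
    then show "a \<in> K" using K'(2) by simp
  qed
  then have "lower_bounds r (upper_bounds r T) \<subseteq> lower_bounds r (upper_bounds r K)"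
    by (auto simp: lower_bounds_def upper_bounds_def)
  moreover have "K \<subseteq> lower_bounds r (upper_bounds r T)"
  proof
    fix x assume x: "x \<in> K"
    have xf: "x \<in> Field r" using x K'(1) by blast
    have "(x, v) \<in> r" if v: "v \<in> upper_bounds r T" for v
    proof (rule ccontr)
      assume n: "(x, v) \<notin> r"
      have vf: "v \<in> Field r" using v by (simp add: upper_bounds_def)
      then have "(v, x) \<in> r" "v \<noteq> x" using n r(3,4) xf by blast+
      \<comment> \<open>Separating \<open>v\<close> from \<open>x\<close> directly would only put
        \<open>v\<close> into \<open>T\<close>, which is no contradiction; a member of
        \<open>T\<close> strictly above \<open>v\<close> is wanted.\<close>
      from dense_left[OF this] obtain v' where
          v': "(v, v') \<in> r" "(v', x) \<in> r" "v' \<noteq> v" "v' \<noteq> x" by blast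
      from cross_left[OF v'(2,4)] obtain b where b: "b \<in> Field s" "L v' b" "\<not> L x b" by blast
      have "b \<in> to_right K"
        using b(1,3) x by (auto simp: to_right_def lower_bounds_def upper_bounds_def)
      then have "v' \<in> T" using b(2) v'(1) by (auto simp: T_def Field_def)
      then have "(v', v) \<in> r" using v by (simp add: upper_bounds_def)
      then show False using v'(1,3) r(2) by (auto dest: antisymD)
    qed
    then show "x \<in> lower_bounds r (upper_bounds r T)" using xf by (auto simp: lower_bounds_def)
  qed
  ultimately show ?thesis using K'(2) by (simp add: to_left_def T_def)
qed

lemma isomorphic_dedekind_completion: "isomorphic (dedekind_completion r) (dedekind_completion s)"
proof (rule isomorphicI_dedekind[where f = to_right and g = to_left and s = s])
  interpret sw: interleaved s r "\<lambda>y x. \<not> L x y" by (rule swap)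
  have eq: "sw.to_right = to_left" "sw.to_left = to_right"
    by (simp_all add: fun_eq_iff sw.to_right_def sw.to_left_def to_left_def to_right_def)
  have cuts: "to_right K \<in> cuts s" "to_left K' \<in> cuts r" for K K'
    by (simp_all add: to_right_def to_left_def closure_in_cuts)
  have mono: "K \<subseteq> K' \<Longrightarrow> to_right K \<subseteq> to_right K'" "J \<subseteq> J' \<Longrightarrow> to_left J \<subseteq> to_left J'" for K K' J J'
    unfolding to_right_def to_left_def lower_bounds_def upper_bounds_def by blast+
  show "to_right K \<in> cuts s \<and> to_left (to_right K) = K" if "K \<in> cuts r" for K
    using that cuts to_left_to_right by blast
  show "to_left K \<in> cuts r \<and> to_right (to_left K) = K" if "K \<in> cuts s" for K
    using sw.to_left_to_right[OF that] cuts unfolding eq by blast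
  show "K \<subseteq> K' \<longleftrightarrow> (to_right K, to_right K') \<in> dedekind_completion s"
    if "K \<in> cuts r" "K' \<in> cuts r" for K K'
    using mono to_left_to_right[OF that(1)] to_left_to_right[OF that(2)] cuts
    by (metis (no_types, lifting) case_prodD case_prodI dedekind_completion_def mem_Collect_eq)
qed (simp add: Field_dedekind_completion)

end

section \<open>Substitution\<close>

text \<open>Variables and parameters are replaced simultaneously, so one operation serves for
  reindexing, for instances (variables become parameters) and for abstraction (parameters become
  variables).\<close>

primrec subst_trm :: "(nat \<Rightarrow> ('f, 'a) trm) \<Rightarrow> ('a \<Rightarrow> ('f, 'a) trm) \<Rightarrow> ('f, 'a) trm \<Rightarrow> ('f, 'a) trm" where
  "subst_trm s t (Var x) = s x"
| "subst_trm s t (Par a) = t a"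
| "subst_trm s t (App f ts) = App f (map (subst_trm s t) ts)"

definition fresh :: "nat set \<Rightarrow> nat" where
  "fresh X = (SOME z. z \<notin> X)"

text \<open>The bound variable is renamed away from every term inserted for a variable or a
  parameter, which rules out capture.\<close>

primrec subst ::
  "('f, 'r, 'a) fm \<Rightarrow> (nat \<Rightarrow> ('f, 'a) trm) \<Rightarrow> ('a \<Rightarrow> ('f, 'a) trm) \<Rightarrow> ('f, 'r, 'a) fm" where
  "subst (Equal u v) s t = Equal (subst_trm s t u) (subst_trm s t v)"
| "subst (Pred R ts) s t = Pred R (map (subst_trm s t) ts)"
| "subst (Neg \<phi>) s t = Neg (subst \<phi> s t)"
| "subst (And \<phi> \<psi>) s t = And (subst \<phi> s t) (subst \<psi> s t)"
| "subst (Exi x \<phi>) s t =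
     (let z = fresh ((\<Union>i\<in>fv \<phi>. fv_trm (s i)) \<union> (\<Union>c\<in>pars \<phi>. fv_trm (t c)))
      in Exi z (subst \<phi> (s(x := Var z)) t))"

lemma finite_fv_trm: "finite (fv_trm t)"
  by (induction t) auto

lemma finite_fv: "finite (fv \<phi>)"
  by (induction \<phi>) (auto simp: finite_fv_trm)

lemma fresh: "finite X \<Longrightarrow> fresh X \<notin> X"
  unfolding fresh_def by (rule someI_ex) (rule ex_new_if_finite[OF infinite_UNIV_nat])

lemma eval_cong: "(\<And>x. x \<in> fv_trm t \<Longrightarrow> e x = e' x) \<Longrightarrow> eval C e t = eval C e' t"
proof (induction t)
  case (App f ts)
  then have "map (eval C e) ts = map (eval C e') ts" by auto
  then show ?case by (metis eval.simps(3))
qed auto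

lemma sat_cong: "(\<And>x. x \<in> fv \<phi> \<Longrightarrow> e x = e' x) \<Longrightarrow> sat C D e \<phi> = sat C D e' \<phi>"
proof (induction \<phi> arbitrary: e e')
  case (Equal u v)
  then show ?case using eval_cong[of u e e' C] eval_cong[of v e e' C] by auto
next
  case (Pred R ts)
  have "map (eval C e) ts = map (eval C e') ts"
    by (rule map_cong[OF refl], rule eval_cong) (use Pred in auto)
  then show ?case by (metis sat.simps(2))
next
  case (Neg \<phi>)
  then show ?case by (metis fv.simps(3) sat.simps(3))
next
  case (And \<phi> \<psi>)
  then show ?case by (metis UnCI fv.simps(4) sat.simps(4))
next
  case (Exi x \<phi>)
  have "sat C D (e(x := d)) \<phi> = sat C D (e'(x := d)) \<phi>" for d
    by (rule Exi.IH) (use Exi.prems in auto)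
  then show ?case by simp
qed

lemma eval_subst_trm:
  "eval C e (subst_trm s t u) = eval C (\<lambda>i. eval C e (s i)) (map_pars_trm (\<lambda>c. eval C e (t c)) u)"
  by (induction u) (auto simp: comp_def intro!: arg_cong[where f = "fint C _"])

lemma fv_trm_map_pars: "fv_trm (map_pars_trm g t) = fv_trm t"
  by (induction t) auto

lemma fv_map_pars: "fv (map_pars g \<phi>) = fv \<phi>"
  by (induction \<phi>) (auto simp: fv_trm_map_pars)

lemma sat_subst:
  "sat C D e (subst \<phi> s t) = sat C D (\<lambda>i. eval C e (s i)) (map_pars (\<lambda>c. eval C e (t c)) \<phi>)"
proof (induction \<phi> arbitrary: s e)
  case (Pred R ts)
  then show ?case by (simp add: eval_subst_trm comp_def)
next
  case (Exi x \<phi>)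
  let ?X = "(\<Union>i\<in>fv \<phi>. fv_trm (s i)) \<union> (\<Union>c\<in>pars \<phi>. fv_trm (t c))"
  define z where "z = fresh ?X"
  have "z \<notin> ?X" unfolding z_def by (rule fresh) (simp add: finite_fv finite_fv_trm finite_pars)
  have z1: "z \<notin> fv_trm (s i)" if "i \<in> fv \<phi>" for i using \<open>z \<notin> ?X\<close> that by auto
  have z2: "z \<notin> fv_trm (t c)" if "c \<in> pars \<phi>" for c using \<open>z \<notin> ?X\<close> that by auto
  have "sat C D (e(z := d)) (subst \<phi> (s(x := Var z)) t) =
      sat C D ((\<lambda>i. eval C e (s i))(x := d)) (map_pars (\<lambda>c. eval C e (t c)) \<phi>)" for d
  proof -
    have "map_pars (\<lambda>c. eval C (e(z := d)) (t c)) \<phi> = map_pars (\<lambda>c. eval C e (t c)) \<phi>"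
    proof (rule fm.map_cong)
      fix c assume "c \<in> pars \<phi>"
      from z2[OF this] show "eval C (e(z := d)) (t c) = eval C e (t c)" by (intro eval_cong) auto
    qed simp
    moreover have "eval C (e(z := d)) ((s(x := Var z)) i) = ((\<lambda>i. eval C e (s i))(x := d)) i"
      if "i \<in> fv \<phi>" for i
      using z1[OF that] by (auto intro!: eval_cong)
    ultimately show ?thesis unfolding Exi.IH by (auto intro!: sat_cong simp: fv_map_pars)
  qed
  then show ?case unfolding subst.simps Let_def z_def[symmetric] by simp
qed (auto simp: eval_subst_trm)

lemma wf_subst_trm: "wf_trm C u \<Longrightarrow> (\<And>i. wf_trm C (s i)) \<Longrightarrow> (\<And>c. wf_trm C (t c)) \<Longrightarrow> wf_trm C (subst_trm s t u)"
  by (induction u) (auto simp: list_all_iff)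

lemma wf_subst: "wf_fm C \<phi> \<Longrightarrow> (\<And>i. wf_trm C (s i)) \<Longrightarrow> (\<And>c. wf_trm C (t c)) \<Longrightarrow> wf_fm C (subst \<phi> s t)"
  by (induction \<phi> arbitrary: s) (auto simp: wf_subst_trm list_all_iff Let_def)

lemma fv_subst_trm: "fv_trm (subst_trm s t u) = (\<Union>i\<in>fv_trm u. fv_trm (s i)) \<union> (\<Union>c\<in>pars_trm u. fv_trm (t c))"
  by (induction u) auto

lemma pars_subst_trm: "pars_trm (subst_trm s t u) = (\<Union>i\<in>fv_trm u. pars_trm (s i)) \<union> (\<Union>c\<in>pars_trm u. pars_trm (t c))"
  by (induction u) auto

lemma fv_subst: "fv (subst \<phi> s t) \<subseteq> (\<Union>i\<in>fv \<phi>. fv_trm (s i)) \<union> (\<Union>c\<in>pars \<phi>. fv_trm (t c))"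
proof (induction \<phi> arbitrary: s)
  case (Exi x \<phi>)
  have "fv (subst \<phi> (s(x := Var z)) t) - {z} \<subseteq> (\<Union>i\<in>fv \<phi> - {x}. fv_trm (s i)) \<union> (\<Union>c\<in>pars \<phi>. fv_trm (t c))" for z
  proof
    fix y assume "y \<in> fv (subst \<phi> (s(x := Var z)) t) - {z}"
    then have "(\<exists>i\<in>fv \<phi>. y \<in> fv_trm ((s(x := Var z)) i)) \<or> (\<exists>c\<in>pars \<phi>. y \<in> fv_trm (t c))" "y \<noteq> z"
      using Exi.IH[of "s(x := Var z)"] by blast+
    then show "y \<in> (\<Union>i\<in>fv \<phi> - {x}. fv_trm (s i)) \<union> (\<Union>c\<in>pars \<phi>. fv_trm (t c))"
      by (auto split: if_splits)
  qed
  then show ?case by (simp add: Let_def)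
qed (auto simp: fv_subst_trm, blast+)

lemma pars_subst: "pars (subst \<phi> s t) \<subseteq> (\<Union>i\<in>fv \<phi>. pars_trm (s i)) \<union> (\<Union>c\<in>pars \<phi>. pars_trm (t c))"
proof (induction \<phi> arbitrary: s)
  case (Exi x \<phi>)
  have "pars (subst \<phi> (s(x := Var z)) t) \<subseteq> (\<Union>i\<in>fv \<phi> - {x}. pars_trm (s i)) \<union> (\<Union>c\<in>pars \<phi>. pars_trm (t c))" for z
  proof
    fix y assume "y \<in> pars (subst \<phi> (s(x := Var z)) t)"
    then have "(\<exists>i\<in>fv \<phi>. y \<in> pars_trm ((s(x := Var z)) i)) \<or> (\<exists>c\<in>pars \<phi>. y \<in> pars_trm (t c))"
      using Exi.IH[of "s(x := Var z)"] by blast+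
    then show "y \<in> (\<Union>i\<in>fv \<phi> - {x}. pars_trm (s i)) \<union> (\<Union>c\<in>pars \<phi>. pars_trm (t c))"
      by (auto split: if_splits)
  qed
  then show ?case by (simp add: Let_def)
qed (auto simp: pars_subst_trm, blast+)

lemma subst_formulas:
  assumes "\<phi> \<in> formulas C n B" "\<And>i. wf_trm C (s i)" "\<And>c. wf_trm C (t c)"
    and "\<And>i. i < n \<Longrightarrow> fv_trm (s i) \<subseteq> {..<k} \<and> pars_trm (s i) \<subseteq> B'"
    and "\<And>c. c \<in> B \<Longrightarrow> fv_trm (t c) \<subseteq> {..<k} \<and> pars_trm (t c) \<subseteq> B'"
  shows "subst \<phi> s t \<in> formulas C k B'"
proof -
  have \<phi>: "wf_fm C \<phi>" "\<And>i. i \<in> fv \<phi> \<Longrightarrow> i < n" "\<And>c. c \<in> pars \<phi> \<Longrightarrow> c \<in> B"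
    using assms(1) by (auto simp: formulas_def)
  have "fv (subst \<phi> s t) \<subseteq> {..<k}"
    by (rule order_trans[OF fv_subst Un_least[OF UN_least UN_least]]) (use assms(4,5) \<phi> in blast)+
  moreover have "pars (subst \<phi> s t) \<subseteq> B'"
    by (rule order_trans[OF pars_subst Un_least[OF UN_least UN_least]]) (use assms(4,5) \<phi> in blast)+
  ultimately show ?thesis using wf_subst[OF \<phi>(1) assms(2,3)] by (simp add: formulas_def)
qed

lemma holds_subst:
  assumes "\<phi> \<in> formulas C n B" "\<And>i. i < n \<Longrightarrow> eval C ((!) a) (s i) = b ! i"
    and "\<And>c. c \<in> B \<Longrightarrow> eval C ((!) a) (t c) = c"
  shows "holds C a (subst \<phi> s t) = holds C b \<phi>"
proof -
  have "map_pars (\<lambda>c. eval C ((!) a) (t c)) \<phi> = map_pars (\<lambda>c. c) \<phi>"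
    by (rule fm.map_cong) (use assms in \<open>auto simp: formulas_def\<close>)
  then show ?thesis
    unfolding holds_def sat_subst using assms(1,2)
    by (auto simp: fm.map_ident formulas_def intro!: sat_cong)
qed

subsection \<open>Blocks of existential quantifiers\<close>

text \<open>The block binds the variables \<open>n,...,n + m - 1\<close>, so a quantified tuple is
  appended on the right of the free one.\<close>

definition exis :: "nat \<Rightarrow> nat \<Rightarrow> ('f, 'r, 'a) fm \<Rightarrow> ('f, 'r, 'a) fm" where
  "exis n m \<phi> = foldr Exi [n..<n + m] \<phi>"

lemma exis_Suc: "exis n (Suc m) \<phi> = Exi n (exis (Suc n) m \<phi>)"
proof -
  have "[n..<n + Suc m] = n # [Suc n..<Suc n + m]" by (simp add: upt_conv_Cons del: upt_Suc)
  then show ?thesis unfolding exis_def by (metis comp_apply foldr.simps(2))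
qed

lemma sat_exis:
  "sat C D e (exis n m \<phi>) \<longleftrightarrow>
     (\<exists>d. length d = m \<and> set d \<subseteq> D \<and> sat C D (\<lambda>i. if n \<le> i \<and> i < n + m then d ! (i - n) else e i) \<phi>)"
proof (induction m arbitrary: n e)
  case 0
  have "(\<lambda>i. if n \<le> i \<and> i < n + 0 then [] ! (i - n) else e i) = e" by (auto simp: fun_eq_iff)
  then show ?case unfolding exis_def by simp
next
  case (Suc m)
  have eq: "(\<lambda>i. if Suc n \<le> i \<and> i < Suc n + m then d ! (i - Suc n) else (e(n := x)) i) =
      (\<lambda>i. if n \<le> i \<and> i < n + Suc m then (x # d) ! (i - n) else e i)" for d :: "'c list" and x
    by (auto simp: fun_eq_iff nth_Cons')
  show ?case
    unfolding exis_Suc sat.simps(5) Suc.IH eq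
  proof
    assume "\<exists>d\<in>D. \<exists>da. length da = m \<and> set da \<subseteq> D \<and>
        sat C D (\<lambda>i. if n \<le> i \<and> i < n + Suc m then (d # da) ! (i - n) else e i) \<phi>"
    then obtain x d where "x \<in> D" "length d = m" "set d \<subseteq> D"
      "sat C D (\<lambda>i. if n \<le> i \<and> i < n + Suc m then (x # d) ! (i - n) else e i) \<phi>" by blast
    then show "\<exists>d. length d = Suc m \<and> set d \<subseteq> D \<and>
        sat C D (\<lambda>i. if n \<le> i \<and> i < n + Suc m then d ! (i - n) else e i) \<phi>"
      by (intro exI[of _ "x # d"]) simp
  next
    assume "\<exists>d. length d = Suc m \<and> set d \<subseteq> D \<and>
        sat C D (\<lambda>i. if n \<le> i \<and> i < n + Suc m then d ! (i - n) else e i) \<phi>"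
    then obtain d' where d': "length d' = Suc m" "set d' \<subseteq> D"
      "sat C D (\<lambda>i. if n \<le> i \<and> i < n + Suc m then d' ! (i - n) else e i) \<phi>"
      by blast
    obtain x d where "d' = x # d" using d'(1) by (cases d') auto
    with d' have "length d = m" "set (x # d) \<subseteq> D"
      "sat C D (\<lambda>i. if n \<le> i \<and> i < n + Suc m then (x # d) ! (i - n) else e i) \<phi>"
      by auto
    then show "\<exists>d\<in>D. \<exists>da. length da = m \<and> set da \<subseteq> D \<and>
        sat C D (\<lambda>i. if n \<le> i \<and> i < n + Suc m then (d # da) ! (i - n) else e i) \<phi>"
      by (intro bexI[of _ x] exI[of _ d]) simp_all
  qed
qed

lemma fv_exis: "fv (exis n m \<phi>) = fv \<phi> - {n..<n + m}"
  by (induction m arbitrary: n) (auto simp: exis_Suc, auto simp: exis_def)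

lemma pars_exis: "pars (exis n m \<phi>) = pars \<phi>"
  by (induction m arbitrary: n) (auto simp: exis_Suc, auto simp: exis_def)

lemma wf_exis: "wf_fm C (exis n m \<phi>) = wf_fm C \<phi>"
  by (induction m arbitrary: n) (auto simp: exis_Suc, auto simp: exis_def)

lemma exis_formulas: "\<phi> \<in> formulas C (n + m) B \<Longrightarrow> exis n m \<phi> \<in> formulas C n B"
  by (force simp: formulas_def fv_exis pars_exis wf_exis)

lemma holds_exis:
  assumes "\<phi> \<in> formulas C (n + m) B" "length a = n"
  shows "holds C a (exis n m \<phi>) \<longleftrightarrow> (\<exists>d. length d = m \<and> holds C (a @ d) \<phi>)"
proof -
  have "sat C UNIV (\<lambda>i. if n \<le> i \<and> i < n + m then d ! (i - n) else a ! i) \<phi> = sat C UNIV ((!) (a @ d)) \<phi>" for d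
    by (rule sat_cong) (use assms in \<open>auto simp: formulas_def nth_append\<close>)
  then show ?thesis by (simp add: holds_def sat_exis)
qed

section \<open>Automorphisms\<close>

lemma eval_automorphism:
  assumes "automorphism C \<sigma>"
  shows "wf_trm C t \<Longrightarrow> eval C (\<lambda>i. \<sigma> (e i)) (map_pars_trm \<sigma> t) = \<sigma> (eval C e t)"
proof (induction t)
  case (App f ts)
  then have "map (eval C (\<lambda>i. \<sigma> (e i))) (map (map_pars_trm \<sigma>) ts) = map \<sigma> (map (eval C e) ts)"
    by (auto simp: list_all_iff)
  moreover have "\<sigma> (fint C f (map (eval C e) ts)) = fint C f (map \<sigma> (map (eval C e) ts))"
    using App.prems assms by (simp add: automorphism_def del: map_map)
  ultimately show ?case by (simp del: map_map)
qed auto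

lemma sat_automorphism:
  assumes "automorphism C \<sigma>"
  shows "wf_fm C \<phi> \<Longrightarrow> sat C UNIV (\<lambda>i. \<sigma> (e i)) (map_pars \<sigma> \<phi>) = sat C UNIV e \<phi>"
proof (induction \<phi> arbitrary: e)
  case (Equal u v)
  have "inj \<sigma>" using assms by (auto simp: automorphism_def bij_def)
  then show ?case using Equal by (simp add: eval_automorphism[OF assms] inj_eq)
next
  case (Pred R ts)
  then have "map (eval C (\<lambda>i. \<sigma> (e i))) (map (map_pars_trm \<sigma>) ts) = map \<sigma> (map (eval C e) ts)"
    by (auto simp: list_all_iff eval_automorphism[OF assms])
  moreover have "rint C R (map (eval C e) ts) = rint C R (map \<sigma> (map (eval C e) ts))"
    using Pred.prems assms unfolding automorphism_def wf_fm.simps by (metis length_map)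
  ultimately show ?case by (simp del: map_map)
next
  case (Exi x \<phi>)
  have "(\<lambda>i. \<sigma> (e i))(x := \<sigma> d) = (\<lambda>i. \<sigma> ((e(x := d)) i))" for d by auto
  then have "sat C UNIV ((\<lambda>i. \<sigma> (e i))(x := \<sigma> d)) (map_pars \<sigma> \<phi>) = sat C UNIV (e(x := d)) \<phi>" for d
    using Exi.IH[of "e(x := d)"] Exi.prems by (simp only: wf_fm.simps)
  moreover have "surj \<sigma>" using assms by (auto simp: automorphism_def bij_def)
  ultimately show ?case unfolding fm.map sat.simps by (metis UNIV_I surjE)
qed auto

lemma holds_automorphism:
  assumes "automorphism C \<sigma>" "\<phi> \<in> formulas C (length a) B"
  shows "holds C (map \<sigma> a) (map_pars \<sigma> \<phi>) = holds C a \<phi>"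
proof -
  have "holds C (map \<sigma> a) (map_pars \<sigma> \<phi>) = sat C UNIV (\<lambda>i. \<sigma> (a ! i)) (map_pars \<sigma> \<phi>)"
    unfolding holds_def by (rule sat_cong) (use assms(2) in \<open>auto simp: formulas_def fv_map_pars\<close>)
  then show ?thesis using sat_automorphism[OF assms(1)] assms(2) by (simp add: formulas_def holds_def)
qed

lemma automorphism_inv:
  assumes "automorphism C \<sigma>"
  shows "automorphism C (inv \<sigma>)"
proof -
  have b: "bij \<sigma>" using assms by (simp add: automorphism_def)
  then have c: "\<sigma> (inv \<sigma> x) = x" "inv \<sigma> (\<sigma> x) = x" for x by (simp_all add: bij_is_surj bij_is_inj surj_f_inv_f)
  then have m: "map \<sigma> (map (inv \<sigma>) as) = as" for as by (simp add: map_idI)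
  have "inv \<sigma> (fint C f as) = fint C f (map (inv \<sigma>) as)" if "length as = farity C f" for f as
  proof -
    have "\<sigma> (fint C f (map (inv \<sigma>) as)) = fint C f as"
      using assms that m[of as] by (simp add: automorphism_def del: map_map)
    then show ?thesis using c(2) by metis
  qed
  moreover have "rint C R as = rint C R (map (inv \<sigma>) as)" if "length as = rarity C R" for R as
    using assms that m[of as] by (metis automorphism_def length_map)
  ultimately show ?thesis unfolding automorphism_def using bij_imp_bij_inv[OF b] by blast
qed

lemma automorphism_comp: "automorphism C \<sigma> \<Longrightarrow> automorphism C \<tau> \<Longrightarrow> automorphism C (\<tau> \<circ> \<sigma>)"
  unfolding automorphism_def by (metis bij_comp comp_apply length_map map_map)

section \<open>Definable sets of tuples\<close>

text \<open>From here on predicates on tuples take the place of formulas; only their values on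
  tuples of length \<open>n\<close> matter.\<close>

definition definable :: "('f, 'r, 'a) struct \<Rightarrow> nat \<Rightarrow> 'a set \<Rightarrow> ('a list \<Rightarrow> bool) \<Rightarrow> bool" where
  "definable C n B X \<longleftrightarrow> (\<exists>\<phi> \<in> formulas C n B. \<forall>a. length a = n \<longrightarrow> (holds C a \<phi> \<longleftrightarrow> X a))"

lemma definableI: "\<phi> \<in> formulas C n B \<Longrightarrow> definable C n B (\<lambda>a. holds C a \<phi>)"
  by (auto simp: definable_def)

lemma definable_cong: "definable C n B X \<Longrightarrow> (\<And>a. length a = n \<Longrightarrow> X a \<longleftrightarrow> Y a) \<Longrightarrow> definable C n B Y"
  by (auto simp: definable_def)

lemma definable_mono: "definable C n B X \<Longrightarrow> B \<subseteq> B' \<Longrightarrow> definable C n B' X"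
  unfolding definable_def formulas_def by blast

lemma definable_not: "definable C n B X \<Longrightarrow> definable C n B (\<lambda>a. \<not> X a)"
  unfolding definable_def
proof (elim bexE)
  fix \<phi> assume "\<phi> \<in> formulas C n B" "\<forall>a. length a = n \<longrightarrow> holds C a \<phi> = X a"
  then show "\<exists>\<phi>\<in>formulas C n B. \<forall>a. length a = n \<longrightarrow> holds C a \<phi> = (\<not> X a)"
    by (intro bexI[of _ "Neg \<phi>"]) (auto simp: formulas_def holds_def)
qed

lemma definable_conj: "definable C n B X \<Longrightarrow> definable C n B Y \<Longrightarrow> definable C n B (\<lambda>a. X a \<and> Y a)"
  unfolding definable_def
proof (elim bexE)
  fix \<phi> \<psi> assume "\<phi> \<in> formulas C n B" "\<forall>a. length a = n \<longrightarrow> holds C a \<phi> = X a"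
    "\<psi> \<in> formulas C n B" "\<forall>a. length a = n \<longrightarrow> holds C a \<psi> = Y a"
  then show "\<exists>\<phi>\<in>formulas C n B. \<forall>a. length a = n \<longrightarrow> holds C a \<phi> = (X a \<and> Y a)"
    by (intro bexI[of _ "And \<phi> \<psi>"]) (auto simp: formulas_def holds_def)
qed

lemma definable_True: "definable C n B (\<lambda>a. True)"
  unfolding definable_def
  \<comment> \<open>There is no truth constant, and a closed sentence is also available for
    \<open>n = 0\<close>.\<close>
  by (rule bexI[of _ "Exi 0 (Equal (Var 0) (Var 0))"]) (auto simp: formulas_def holds_def)

lemma definable_nth_eq: "i < n \<Longrightarrow> c \<in> B \<Longrightarrow> definable C n B (\<lambda>a. a ! i = c)"
  unfolding definable_def
  by (rule bexI[of _ "Equal (Var i) (Par c)"]) (auto simp: formulas_def holds_def)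

lemma definable_ex: "definable C (n + m) B X \<Longrightarrow> definable C n B (\<lambda>a. \<exists>d. length d = m \<and> X (a @ d))"
  unfolding definable_def
proof (elim bexE)
  fix \<phi> assume "\<phi> \<in> formulas C (n + m) B" "\<forall>a. length a = n + m \<longrightarrow> holds C a \<phi> = X a"
  then show "\<exists>\<phi>\<in>formulas C n B. \<forall>a. length a = n \<longrightarrow> holds C a \<phi> = (\<exists>d. length d = m \<and> X (a @ d))"
    by (intro bexI[of _ "exis n m \<phi>"]) (auto simp: holds_exis exis_formulas)
qed

lemma definable_reindex:
  assumes "definable C k B X" "\<And>i. i < k \<Longrightarrow> f i < l"
  shows "definable C l B (\<lambda>c. X (map (\<lambda>i. c ! f i) [0..<k]))"
proof -
  obtain \<phi> where \<phi>: "\<phi> \<in> formulas C k B" "\<And>a. length a = k \<Longrightarrow> holds C a \<phi> = X a"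
    using assms(1) by (auto simp: definable_def)
  have "subst \<phi> (\<lambda>i. Var (f i)) Par \<in> formulas C l B"
    by (rule subst_formulas[OF \<phi>(1)]) (use assms(2) in auto)
  moreover have "holds C c (subst \<phi> (\<lambda>i. Var (f i)) Par) = X (map (\<lambda>i. c ! f i) [0..<k])" for c
    by (subst holds_subst[OF \<phi>(1), where b = "map (\<lambda>i. c ! f i) [0..<k]"]) (use \<phi>(2) in auto)
  ultimately show ?thesis unfolding definable_def by blast
qed

lemma definable_swap:
  assumes "definable C (n + m) B X"
  shows "\<exists>Y. definable C (m + n) B Y \<and> (\<forall>a b. length a = n \<longrightarrow> length b = m \<longrightarrow> Y (b @ a) = X (a @ b))"
proof (intro exI conjI allI impI)
  let ?f = "\<lambda>i. if i < n then m + i else i - n"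
  show "definable C (m + n) B (\<lambda>c. X (map (\<lambda>i. c ! ?f i) [0..<n + m]))"
    by (rule definable_reindex[OF assms]) auto
  fix a b :: "'c list" assume l: "length a = n" "length b = m"
  have "map (\<lambda>i. (b @ a) ! ?f i) [0..<n + m] = a @ b"
    by (rule nth_equalityI) (use l in \<open>auto simp: nth_append\<close>)
  then show "X (map (\<lambda>i. (b @ a) ! ?f i) [0..<n + m]) = X (a @ b)" by simp
qed

lemma definable_instance_left:
  assumes "definable C (n + m) B X" "length a = n"
  shows "definable C m (B \<union> set a) (\<lambda>d. X (a @ d))"
proof -
  obtain \<phi> where \<phi>: "\<phi> \<in> formulas C (n + m) B" "\<And>a. length a = n + m \<Longrightarrow> holds C a \<phi> = X a"
    using assms(1) by (auto simp: definable_def)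
  let ?s = "\<lambda>i. if i < n then Par (a ! i) else Var (i - n)"
  have "subst \<phi> ?s Par \<in> formulas C m (B \<union> set a)"
    by (rule subst_formulas[OF \<phi>(1)]) (use assms(2) in auto)
  moreover have "holds C d (subst \<phi> ?s Par) = X (a @ d)" if "length d = m" for d
    by (subst holds_subst[OF \<phi>(1), where b = "a @ d"])
      (use \<phi>(2) that assms(2) in \<open>auto simp: nth_append\<close>)
  ultimately show ?thesis unfolding definable_def by blast
qed

lemma definable_instance_right:
  assumes "definable C (n + m) B X" "length b = m"
  shows "definable C n (B \<union> set b) (\<lambda>d. X (d @ b))"
proof -
  obtain Y where Y: "definable C (m + n) B Y" "\<And>a b. length a = n \<Longrightarrow> length b = m \<Longrightarrow> Y (b @ a) = X (a @ b)"
    using definable_swap[OF assms(1)] by blast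
  show ?thesis by (rule definable_cong[OF definable_instance_left[OF Y(1) assms(2)]]) (use Y(2) assms(2) in simp)
qed

text \<open>Each parameter from \<open>a\<close> outside \<open>B\<close> becomes a variable
  pointing to a position of \<open>a\<close> where it occurs; the choice of position is harmless
  because agreement is claimed only at \<open>a\<close> itself.\<close>

lemma definable_abstract:
  assumes "definable C m (B \<union> set a) X" "length a = n"
  shows "\<exists>Y. definable C (n + m) B Y \<and> (\<forall>d. length d = m \<longrightarrow> Y (a @ d) = X d)"
proof -
  obtain \<phi> where \<phi>: "\<phi> \<in> formulas C m (B \<union> set a)" "\<And>a. length a = m \<Longrightarrow> holds C a \<phi> = X a"
    using assms(1) by (auto simp: definable_def)
  have "\<exists>i<n. a ! i = c" if "c \<in> set a" for c using that assms(2) by (auto simp: in_set_conv_nth)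
  then obtain g where g: "g c < n \<and> a ! g c = c" if "c \<in> set a" for c by metis
  let ?s = "\<lambda>i. Var (n + i)" and ?t = "\<lambda>c. if c \<in> B then Par c else if c \<in> set a then Var (g c) else Par c"
  have "subst \<phi> ?s ?t \<in> formulas C (n + m) B"
    by (rule subst_formulas[OF \<phi>(1)]) (use g in \<open>auto simp: trans_less_add1\<close>)
  moreover have "holds C (a @ d) (subst \<phi> ?s ?t) = X d" if "length d = m" for d
    by (subst holds_subst[OF \<phi>(1), where b = d]) (use \<phi>(2) that g assms(2) in \<open>auto simp: nth_append\<close>)
  ultimately show ?thesis
    by (intro exI[of _ "\<lambda>c. holds C c (subst \<phi> ?s ?t)"]) (auto intro: definableI)
qed

text \<open>The Tarski-Vaught property: a block of quantifiers gives a sentence over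
  \<open>M\<close>; its truth passes down to \<open>M\<close> and the witness passes back
  up.\<close>

lemma elementary_substructure_definable:
  assumes M: "elementary_substructure C M" and X: "definable C n M X" "X d" "length d = n"
  shows "\<exists>d. length d = n \<and> set d \<subseteq> M \<and> X d"
proof -
  obtain \<phi> where \<phi>: "\<phi> \<in> formulas C n M" "\<And>a. length a = n \<Longrightarrow> holds C a \<phi> = X a"
    using X(1) by (auto simp: definable_def)
  \<comment> \<open>Elementarity speaks of assignments into \<open>M\<close>, so the irrelevant
    variables receive a default value from \<open>M\<close>.\<close>
  obtain c where c: "c \<in> M" using M by (auto simp: elementary_substructure_def)
  let ?e = "\<lambda>i::nat. c"
  let ?f = "\<lambda>d i. if 0 \<le> i \<and> i < 0 + n then d ! (i - 0) else ?e i"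
  have sub: "sat C D (?f d) \<phi> = sat C D ((!) d) \<phi>" for d D
    by (rule sat_cong) (use \<phi>(1) in \<open>auto simp: formulas_def\<close>)
  have "sat C UNIV ?e (exis 0 n \<phi>)"
    unfolding sat_exis sub using X(2,3) \<phi>(2) by (auto simp: holds_def)
  moreover have "sat C M ?e (exis 0 n \<phi>) = sat C UNIV ?e (exis 0 n \<phi>)"
    using M c \<phi>(1) by (auto simp: elementary_substructure_def wf_exis pars_exis formulas_def)
  ultimately obtain d where d: "length d = n" "set d \<subseteq> M" "sat C M (?f d) \<phi>"
    by (auto simp only: sat_exis)
  have "range (?f d) \<subseteq> M" using d(1,2) c by auto
  then have "sat C UNIV (?f d) \<phi>"
    using M d(3) \<phi>(1) unfolding elementary_substructure_def formulas_def by blast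
  then show ?thesis using d(1,2) \<phi>(2) unfolding sub holds_def by blast
qed

section \<open>Types over small sets\<close>

text \<open>For small \<open>B\<close> and tuples of equal length this is equality of types over
  \<open>B\<close>. Automorphisms are preferred because they carry auxiliary tuples along and
  preserve genericity for invariant types.\<close>

definition conjugate :: "('f, 'r, 'a) struct \<Rightarrow> 'a set \<Rightarrow> 'a list \<Rightarrow> 'a list \<Rightarrow> bool" where
  "conjugate C B a b \<longleftrightarrow> (\<exists>\<sigma>. automorphism C \<sigma> \<and> (\<forall>x\<in>B. \<sigma> x = x) \<and> map \<sigma> a = b)"

lemma conjugate_sym:
  assumes "conjugate C B a b" shows "conjugate C B b a"
proof -
  obtain \<sigma> where \<sigma>: "automorphism C \<sigma>" "\<forall>x\<in>B. \<sigma> x = x" "map \<sigma> a = b" using assms by (auto simp: conjugate_def)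
  have i: "inv \<sigma> (\<sigma> x) = x" for x using \<sigma>(1) by (simp add: automorphism_def bij_is_inj)
  have "\<forall>x\<in>B. inv \<sigma> x = x" using i \<sigma>(2) by metis
  moreover have "map (inv \<sigma>) b = a" using \<sigma>(3) i by (auto simp: map_idI)
  ultimately show ?thesis unfolding conjugate_def using automorphism_inv[OF \<sigma>(1)] by blast
qed

lemma conjugate_trans: "conjugate C B a b \<Longrightarrow> conjugate C B b c \<Longrightarrow> conjugate C B a c"
  unfolding conjugate_def
proof (elim exE conjE)
  fix \<sigma> \<tau> assume "automorphism C \<sigma>" "\<forall>x\<in>B. \<sigma> x = x" "map \<sigma> a = b"
    "automorphism C \<tau>" "\<forall>x\<in>B. \<tau> x = x" "map \<tau> b = c"
  then show "\<exists>\<sigma>. automorphism C \<sigma> \<and> (\<forall>x\<in>B. \<sigma> x = x) \<and> map \<sigma> a = c"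
    using automorphism_comp[of C \<sigma> \<tau>] by (intro exI[of _ "\<tau> \<circ> \<sigma>"]) auto
qed

lemma conjugate_mono: "conjugate C B a b \<Longrightarrow> B' \<subseteq> B \<Longrightarrow> conjugate C B' a b"
  unfolding conjugate_def by blast

lemma conjugate_length: "conjugate C B a b \<Longrightarrow> length a = length b"
  unfolding conjugate_def by auto

lemma holds_fixing_automorphism:
  assumes "automorphism C \<sigma>" "\<forall>x\<in>B. \<sigma> x = x" "\<phi> \<in> formulas C (length a) B"
  shows "holds C (map \<sigma> a) \<phi> = holds C a \<phi>"
proof -
  have "map_pars \<sigma> \<phi> = map_pars (\<lambda>c. c) \<phi>"
    by (rule fm.map_cong) (use assms in \<open>auto simp: formulas_def\<close>)
  then show ?thesis using holds_automorphism[OF assms(1,3)] by (simp add: fm.map_ident)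
qed

lemma conjugate_definable:
  assumes "conjugate C B a b" "definable C (length a) B X"
  shows "X a \<longleftrightarrow> X b"
  using assms unfolding conjugate_def definable_def
  by (metis holds_fixing_automorphism length_map)

lemma conjugate_tp:
  assumes "conjugate C B a b" shows "tp C a B = tp C b B"
  using conjugate_definable[OF assms definableI] conjugate_length[OF assms]
  by (auto simp: tp_def)

lemma conjugate_append:
  assumes "conjugate C B (a @ b) (a' @ b')" "length a = length a' \<or> length b = length b'"
  shows "conjugate C B a a'" "conjugate C B b b'"
  using assms unfolding conjugate_def by auto

lemma conjugate_swap:
  assumes "conjugate C B (a @ b) (a' @ b')" "length a = length a' \<or> length b = length b'"
  shows "conjugate C B (b @ a) (b' @ a')"
  using assms unfolding conjugate_def by auto

lemma conjugate_over_left: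
  assumes "conjugate C (B \<union> set a) b c"
  shows "conjugate C B (a @ b) (a @ c)"
proof -
  obtain \<sigma> where "automorphism C \<sigma>" "\<forall>x\<in>B \<union> set a. \<sigma> x = x" "map \<sigma> b = c"
    using assms unfolding conjugate_def by blast
  moreover from this have "map \<sigma> a = a" by (auto intro: map_idI)
  ultimately show ?thesis unfolding conjugate_def by (intro exI[of _ \<sigma>]) auto
qed

lemma conjugate_over_right:
  assumes "conjugate C (B \<union> set a) b c"
  shows "conjugate C B (b @ a) (c @ a)"
proof -
  obtain \<sigma> where "automorphism C \<sigma>" "\<forall>x\<in>B \<union> set a. \<sigma> x = x" "map \<sigma> b = c"
    using assms unfolding conjugate_def by blast
  moreover from this have "map \<sigma> a = a" by (auto intro: map_idI)
  ultimately show ?thesis unfolding conjugate_def by (intro exI[of _ \<sigma>]) auto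
qed

lemma conjugate_extend:
  assumes "conjugate C B a a'"
  shows "\<exists>b'. conjugate C B (a @ b) (a' @ b')"
  using assms unfolding conjugate_def by auto

lemma conjugate_cancel_right:
  assumes "conjugate C B (c @ l) (d @ l)" "length c = length d"
  shows "conjugate C (B \<union> set l) c d"
proof -
  obtain \<sigma> where \<sigma>: "automorphism C \<sigma>" "\<forall>x\<in>B. \<sigma> x = x" "map \<sigma> (c @ l) = d @ l"
    using assms(1) unfolding conjugate_def by blast
  then have "map \<sigma> c = d" "map \<sigma> l = map id l" using assms(2) by auto
  then show ?thesis using \<sigma>(1,2) unfolding conjugate_def map_eq_conv by auto
qed

locale monster_model =
  fixes C :: "('f, 'r, 'a) struct" and \<kappa> :: "'k rel" and A :: "'a set"
  assumes monster: "monster C \<kappa>" and small_base: "small \<kappa> A"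
begin

lemma infinite_\<kappa>: "Card_order \<kappa>" "infinite (Field \<kappa>)"
proof -
  have k: "Card_order \<kappa>" "(card_of (UNIV :: nat set), \<kappa>) \<in> ordLess"
    using monster by (auto simp: monster_def small_def)
  show "Card_order \<kappa>" by (rule k(1))
  have "(card_of (UNIV :: nat set), card_of (Field \<kappa>)) \<in> ordLeq"
    using k by (meson card_of_Field_ordIso ordIso_symmetric ordLeq_ordIso_trans ordLess_imp_ordLeq)
  then show "infinite (Field \<kappa>)" by (simp add: infinite_iff_card_of_nat)
qed

lemma small_Un: "small \<kappa> B \<Longrightarrow> small \<kappa> B' \<Longrightarrow> small \<kappa> (B \<union> B')"
  unfolding small_def using infinite_\<kappa> by (intro card_of_Un_ordLess_infinite_Field)

lemma small_finite:
  assumes "finite B" shows "small \<kappa> B"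
proof -
  have "(card_of B, card_of (UNIV :: nat set)) \<in> ordLess"
    using assms infinite_iff_card_of_nat[of B] by (metis card_of_Well_order not_ordLess_iff_ordLeq)
  then show ?thesis using monster unfolding monster_def small_def by (metis ordLess_transitive)
qed

lemma small_set [simp]: "small \<kappa> B \<Longrightarrow> small \<kappa> (B \<union> set a)"
  by (simp add: small_Un small_finite)

text \<open>Equality of types makes the map from \<open>a\<close> to \<open>b\<close> that fixes
  \<open>B\<close> partial elementary, and strong homogeneity extends it. One implication suffices
  because negations are definable.\<close>

lemma conjugateI:
  assumes B: "small \<kappa> B" and len: "length a = length b"
    and eq: "\<And>X. definable C (length a) B X \<Longrightarrow> X a \<Longrightarrow> X b"
  shows "conjugate C B a b"
proof -
  have eq': "X a \<longleftrightarrow> X b" if "definable C (length a) B X" for X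
    using eq[OF that] eq[OF definable_not[OF that]] by blast
  define g where "g c = (if c \<in> set a \<and> c \<notin> B then b ! (SOME i. i < length a \<and> a ! i = c) else c)" for c
  have gB: "g c = c" if "c \<in> B" for c using that by (simp add: g_def)
  have ga: "g (a ! i) = b ! i" if i: "i < length a" for i
  proof (cases "a ! i \<in> B")
    case True
    then have "b ! i = a ! i" using eq[OF definable_nth_eq[OF i True]] by simp
    then show ?thesis using True gB by simp
  next
    case False
    \<comment> \<open>The tuple \<open>a\<close> may repeat entries, so \<open>g\<close> reads
      \<open>b\<close> at a chosen position \<open>j\<close>; the formula equating positions
      \<open>j\<close> and \<open>i\<close> transfers from \<open>a\<close> to
      \<open>b\<close>.\<close>
    define j where "j = (SOME j. j < length a \<and> a ! j = a ! i)"
    have j: "j < length a" "a ! j = a ! i" unfolding j_def using someI[of "\<lambda>j. j < length a \<and> a ! j = a ! i" i] i by auto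
    have "Equal (Var j) (Var i) \<in> formulas C (length a) B" using i j by (auto simp: formulas_def)
    from eq[OF definableI[OF this]] have "b ! j = b ! i" using j by (simp add: holds_def)
    then show ?thesis using False i by (simp add: g_def j_def)
  qed
  have "partial_elementary C (B \<union> set a) g"
    unfolding partial_elementary_def
  proof
    fix \<phi> assume \<phi>: "\<phi> \<in> formulas C 0 (B \<union> set a)"
    let ?t = "\<lambda>c. if c \<in> B then Par c else if c \<in> set a then Var (SOME i. i < length a \<and> a ! i = c) else Par c"
    have some: "(SOME i. i < length a \<and> a ! i = c) < length a \<and> a ! (SOME i. i < length a \<and> a ! i = c) = c"
      if "c \<in> set a" for c by (rule someI_ex) (use that in \<open>simp add: in_set_conv_nth\<close>)
    have 1: "subst \<phi> Var ?t \<in> formulas C (length a) B"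
      by (rule subst_formulas[OF \<phi>]) (use some in auto)
    have 2: "holds C a (subst \<phi> Var ?t) = holds C [] \<phi>"
      by (rule holds_subst[OF \<phi>]) (use some in auto)
    have "map_pars (\<lambda>c. eval C ((!) b) (?t c)) \<phi> = map_pars g \<phi>"
      by (rule fm.map_cong) (use \<phi> in \<open>auto simp: formulas_def g_def\<close>)
    then have "holds C b (subst \<phi> Var ?t) = sat C UNIV ((!) b) (map_pars g \<phi>)"
      unfolding holds_def sat_subst by simp
    also have "\<dots> = holds C [] (map_pars g \<phi>)"
      unfolding holds_def by (rule sat_cong) (use \<phi> in \<open>simp add: fv_map_pars formulas_def\<close>)
    finally show "holds C [] \<phi> = holds C [] (map_pars g \<phi>)"
      using eq'[OF definableI[OF 1]] 2 by simp
  qed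
  moreover have "small \<kappa> (B \<union> set a)" by (simp add: B)
  ultimately obtain \<sigma> where "automorphism C \<sigma>" "\<forall>c \<in> B \<union> set a. \<sigma> c = g c"
    using monster unfolding monster_def strongly_homogeneous_def by blast
  moreover from this have "map \<sigma> a = b"
    by (intro nth_equalityI) (use len ga in auto)
  ultimately show ?thesis unfolding conjugate_def using gB by auto
qed

lemma conjugate_iff_tp:
  assumes "small \<kappa> B" "length a = length b"
  shows "conjugate C B a b \<longleftrightarrow> tp C a B = tp C b B"
proof
  assume t: "tp C a B = tp C b B"
  show "conjugate C B a b"
  proof (rule conjugateI[OF assms])
    fix X assume "definable C (length a) B X" "X a"
    then show "X b" using t assms(2) by (auto simp: definable_def tp_def)
  qed
qed (rule conjugate_tp)

text \<open>Saturation for the type of \<open>b\<close> over \<open>B\<close> together with the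
  family: since both are closed under conjunction, finite satisfiability is tested against one
  member of each.\<close>

lemma realize_directed:
  assumes B: "small \<kappa> B" "small \<kappa> B'" and b: "length b = n"
    and Y: "\<And>Y. Y \<in> \<Y> \<Longrightarrow> definable C n B' Y" "\<Y> \<noteq> {}"
      "\<And>Y Y'. Y \<in> \<Y> \<Longrightarrow> Y' \<in> \<Y> \<Longrightarrow> (\<lambda>d. Y d \<and> Y' d) \<in> \<Y>"
    and fs: "\<And>X Y. definable C n B X \<Longrightarrow> X b \<Longrightarrow> Y \<in> \<Y> \<Longrightarrow> \<exists>d. length d = n \<and> X d \<and> Y d"
  shows "\<exists>d. length d = n \<and> conjugate C B b d \<and> (\<forall>Y\<in>\<Y>. Y d)"
proof -
  define \<pi> where "\<pi> = tp C b B \<union> {\<phi> \<in> formulas C n B'. \<exists>Y\<in>\<Y>. \<forall>a. length a = n \<longrightarrow> (holds C a \<phi> \<longleftrightarrow> Y a)}"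
  have "\<exists>X Y. definable C n B X \<and> X b \<and> Y \<in> \<Y> \<and>
      (\<forall>d. length d = n \<and> X d \<and> Y d \<longrightarrow> (\<forall>\<phi>\<in>\<pi>0. holds C d \<phi>))"
    if "finite \<pi>0" "\<pi>0 \<subseteq> \<pi>" for \<pi>0
    using that
  proof (induction \<pi>0)
    case empty
    then show ?case using definable_True Y(2) by fast
  next
    case (insert \<phi> \<pi>0)
    then obtain X Y1 where XY: "definable C n B X" "X b" "Y1 \<in> \<Y>"
      "\<forall>d. length d = n \<and> X d \<and> Y1 d \<longrightarrow> (\<forall>\<phi>\<in>\<pi>0. holds C d \<phi>)" by blast
    consider "\<phi> \<in> tp C b B" | Y2 where "Y2 \<in> \<Y>" "\<forall>a. length a = n \<longrightarrow> (holds C a \<phi> \<longleftrightarrow> Y2 a)"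
      using insert.prems by (auto simp: \<pi>_def)
    then show ?case
    proof cases
      case 1
      then have "definable C n B (\<lambda>a. X a \<and> holds C a \<phi>)" "holds C b \<phi>"
        using b XY(1) by (auto simp: tp_def intro: definable_conj definableI)
      then show ?thesis using XY by (intro exI[of _ "\<lambda>a. X a \<and> holds C a \<phi>"] exI[of _ Y1]) auto
    next
      case 2
      then show ?thesis using XY Y(3)[OF XY(3) 2(1)]
        by (intro exI[of _ X] exI[of _ "\<lambda>d. Y1 d \<and> Y2 d"]) auto
    qed
  qed
  then have "finitely_satisfiable C n \<pi>"
    unfolding finitely_satisfiable_def realizes_def using fs by meson
  moreover have "\<pi> \<subseteq> formulas C n (B \<union> B')" using b by (auto simp: \<pi>_def tp_def formulas_def)
  ultimately obtain d where d: "realizes C n d \<pi>"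
    using monster small_Un[OF B] unfolding monster_def saturated_def by blast
  then have l: "length d = n" by (simp add: realizes_def)
  have "conjugate C B b d"
  proof (rule conjugateI[OF B(1)])
    show "length b = length d" using l b by simp
    fix X assume "definable C (length b) B X" "X b"
    then obtain \<phi> where "\<phi> \<in> formulas C (length b) B" "\<And>a. length a = n \<Longrightarrow> holds C a \<phi> = X a"
      using b by (auto simp: definable_def)
    then show "X d" using d \<open>X b\<close> b l by (auto simp: realizes_def \<pi>_def tp_def)
  qed
  moreover have "Y d" if "Y \<in> \<Y>" for Y
    using Y(1)[OF that] d that l unfolding definable_def realizes_def \<pi>_def by blast
  ultimately show ?thesis using l by blast
qed

lemma realize_definable:
  assumes "small \<kappa> B" "small \<kappa> B'" "length b = n" "definable C n B' Y"
    and "\<And>X. definable C n B X \<Longrightarrow> X b \<Longrightarrow> \<exists>d. length d = n \<and> X d \<and> Y d"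
  shows "\<exists>d. length d = n \<and> conjugate C B b d \<and> Y d"
  using realize_directed[OF assms(1-3), of "{Y}"] assms(4,5) by auto

text \<open>The formulas true of \<open>c\<close> over \<open>B'\<close> form a directed family, so
  two types over different small sets are realized together once their formulas are pairwise
  consistent.\<close>

lemma realize_both:
  assumes "small \<kappa> B" "small \<kappa> B'" "length b = n" "length c = n"
    and "\<And>X Y. definable C n B X \<Longrightarrow> X b \<Longrightarrow> definable C n B' Y \<Longrightarrow> Y c \<Longrightarrow> \<exists>d. length d = n \<and> X d \<and> Y d"
  shows "\<exists>d. conjugate C B b d \<and> conjugate C B' c d"
proof -
  have "\<exists>d. length d = n \<and> conjugate C B b d \<and> (\<forall>Y\<in>{Y. definable C n B' Y \<and> Y c}. Y d)"
    by (rule realize_directed[OF assms(1-3)])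
      (use assms(5) in \<open>auto intro: definable_conj definable_True exI[of _ "\<lambda>_. True"]\<close>)
  then obtain d where "length d = n" "conjugate C B b d" "\<forall>Y\<in>{Y. definable C n B' Y \<and> Y c}. Y d" by blast
  moreover from this have "conjugate C B' c d"
    by (intro conjugateI[OF assms(2)]) (use assms(4) in auto)
  ultimately show ?thesis by blast
qed

end

section \<open>Regular asymmetric types\<close>

locale regular_type = monster_model C \<kappa> A
  for C :: "('f, 'r, 'a) struct" and \<kappa> :: "'k rel" and A :: "'a set" +
  fixes n :: nat and p :: "('f, 'r, 'a) fm set"
  assumes global: "global_type C n p" and regular: "regular C \<kappa> A n p"
    and asymmetric: "asymmetric C A n p" and convex: "convex C A n p"
begin

abbreviation gen :: "'a set \<Rightarrow> 'a list \<Rightarrow> bool" where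
  "gen B a \<equiv> realizes C n a (restr p B)"

abbreviation lt :: "'a list \<Rightarrow> 'a list \<Rightarrow> bool" where
  "lt a b \<equiv> morley_pair C A n p a b"

lemma gen_length: "gen B a \<Longrightarrow> length a = n"
  by (simp add: realizes_def)

lemma gen_mono: "gen B' a \<Longrightarrow> B \<subseteq> B' \<Longrightarrow> gen B a"
  unfolding realizes_def restr_def by blast

lemma lt_def: "lt a b \<longleftrightarrow> gen A a \<and> gen (A \<union> set a) b"
  by (simp add: morley_pair_def)

lemma lt_gen: "lt a b \<Longrightarrow> gen A a" "lt a b \<Longrightarrow> gen A b"
  by (auto simp: lt_def intro: gen_mono)

lemma in_p: "\<phi> \<in> p \<Longrightarrow> \<phi> \<in> formulas C n UNIV"
  using global by (auto simp: global_type_def)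

lemma gen_holds:
  assumes "gen B a" "\<phi> \<in> formulas C n B"
  shows "holds C a \<phi> \<longleftrightarrow> \<phi> \<in> p"
proof -
  have "\<phi> \<in> formulas C n UNIV" using assms(2) by (simp add: formulas_def)
  then have "\<phi> \<in> p \<or> Neg \<phi> \<in> p" using global by (auto simp: global_type_def)
  moreover have "holds C a \<phi>" if "\<phi> \<in> p"
    using that assms by (simp add: realizes_def restr_def formulas_def)
  moreover have "holds C a (Neg \<phi>)" if "Neg \<phi> \<in> p"
    using that assms by (simp add: realizes_def restr_def formulas_def)
  ultimately show ?thesis by (auto simp: holds_def)
qed

lemma gen_exists:
  assumes "small \<kappa> B" shows "\<exists>a. gen B a"
proof -
  have "restr p B \<subseteq> formulas C n B" using in_p by (auto simp: restr_def formulas_def)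
  moreover have "finitely_satisfiable C n (restr p B)"
    using global unfolding global_type_def finitely_satisfiable_def restr_def by blast
  ultimately show ?thesis using monster assms unfolding monster_def saturated_def by blast
qed

lemma gen_conjugate: "small \<kappa> B \<Longrightarrow> gen B a \<Longrightarrow> gen B b \<Longrightarrow> conjugate C B a b"
  by (rule conjugateI) (metis definable_def gen_holds gen_length)+

lemma conjugate_gen: "conjugate C B a b \<Longrightarrow> gen B a \<Longrightarrow> gen B b"
proof -
  assume c: "conjugate C B a b" and a: "gen B a"
  have "holds C b \<phi>" if "\<phi> \<in> restr p B" for \<phi>
  proof -
    have "\<phi> \<in> formulas C (length a) B" using that in_p gen_length[OF a] by (auto simp: restr_def formulas_def)
    from conjugate_definable[OF c definableI[OF this]] show ?thesis
      using that a by (simp add: realizes_def)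
  qed
  then show ?thesis using conjugate_length[OF c] gen_length[OF a] by (simp add: realizes_def)
qed

lemma invariant: "invariant C A p"
  using regular by (simp add: regular_def)

lemma gen_automorphism:
  assumes "automorphism C \<sigma>" "\<forall>x\<in>A. \<sigma> x = x" "gen B a"
  shows "gen (\<sigma> ` B) (map \<sigma> a)"
proof -
  have "holds C (map \<sigma> a) \<phi>" if "\<phi> \<in> p" "pars \<phi> \<subseteq> \<sigma> ` B" for \<phi>
  proof -
    have "map_pars \<sigma> ` p = p" using invariant assms(1,2) by (simp add: invariant_def)
    then have "\<phi> \<in> map_pars \<sigma> ` p" using that(1) by simp
    then obtain \<psi> where \<psi>: "\<psi> \<in> p" "\<phi> = map_pars \<sigma> \<psi>" by (elim imageE)
    have "inj \<sigma>" using assms(1) by (simp add: automorphism_def bij_def)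
    then have "pars \<psi> \<subseteq> B" using that(2) unfolding \<psi>(2) fm.set_map by (simp add: inj_image_subset_iff)
    then have "holds C a \<psi>" using assms(3) \<psi>(1) by (simp add: realizes_def restr_def)
    then show ?thesis
      using holds_automorphism[OF assms(1), of \<psi> a UNIV] in_p[OF \<psi>(1)] gen_length[OF assms(3)]
      unfolding \<psi>(2) by simp
  qed
  then show ?thesis using assms(3) by (auto simp: realizes_def restr_def)
qed

text \<open>Invariance moves genericity along an automorphism that also moves part of the base; the
  condition on lengths locates the border inside the concatenations.\<close>

lemma gen_transfer:
  assumes "conjugate C B (x @ a) (y @ b)" "length x = length y \<or> length a = length b" "A \<subseteq> B"
    and "gen (B \<union> set x) a"
  shows "gen (B \<union> set y) b"
proof -
  obtain \<sigma> where \<sigma>: "automorphism C \<sigma>" "\<forall>x\<in>B. \<sigma> x = x" "map \<sigma> x = y" "map \<sigma> a = b"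
    using assms(1,2) by (auto simp: conjugate_def)
  have "\<sigma> ` (B \<union> set x) = B \<union> set y" using \<sigma>(2,3) by (auto simp: image_Un image_iff)
  then show ?thesis using gen_automorphism[of \<sigma> a "B \<union> set x"] \<sigma> assms(3,4) by (simp add: subset_iff)
qed

lemma dichotomy_gen:
  assumes "dichotomy C \<kappa> A n p a" "A \<subseteq> B" "small \<kappa> B" "\<not> gen B a" "gen B c"
  shows "gen (B \<union> set a) c"
proof -
  have "entails C n (restr p B) (restr p (B \<union> set a))"
    using assms(1-4) by (auto simp: dichotomy_def)
  then show ?thesis using assms(5) unfolding entails_def realizes_def by blast
qed

text \<open>The realizations of the type over \<open>A\<close> that do not realize it over \<open>B\<close> form a closure of \<open>B\<close>:
  adjoining one of them does not enlarge this set.\<close>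

lemma gen_closure:
  assumes "A \<subseteq> B" "small \<kappa> B" "gen A a" "\<not> gen B a" "gen B c"
  shows "gen (B \<union> set a) c"
  using regular assms dichotomy_gen unfolding regular_def by blast

text \<open>The dichotomy is used with base \<open>A\<close> itself: a solution of the formula that
  fails the type over \<open>A\<close> falls under the second alternative.\<close>

lemma strongly_regular_definable:
  assumes "strongly_regular C \<kappa> A n p"
  shows "\<exists>X. definable C n A X \<and> (\<forall>a. gen A a \<longrightarrow> X a) \<and>
    (\<forall>y. length y = n \<and> X y \<and> \<not> gen A y \<longrightarrow> (\<forall>c. gen A c \<longrightarrow> gen (A \<union> set y) c))"
proof -
  obtain \<phi> where \<phi>: "\<phi> \<in> restr p A" "\<And>a. length a = n \<Longrightarrow> holds C a \<phi> \<Longrightarrow> dichotomy C \<kappa> A n p a"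
    using assms by (auto simp: strongly_regular_def)
  have "\<phi> \<in> formulas C n A" using \<phi>(1) in_p by (auto simp: restr_def formulas_def)
  moreover have "holds C a \<phi>" if "gen A a" for a using that \<phi>(1) by (simp add: realizes_def)
  ultimately show ?thesis using \<phi>(2) dichotomy_gen[OF _ order_refl small_base]
    by (intro exI[of _ "\<lambda>a. holds C a \<phi>"]) (auto intro: definableI)
qed

text \<open>After the first entries are moved onto each other, the second entries realize the same
  restriction of \<open>p\<close>. So Morley pairs form a single type over \<open>A\<close>.\<close>

lemma lt_conjugate:
  assumes "lt a b" "lt a' b'"
  shows "conjugate C A (a @ b) (a' @ b')"
proof -
  obtain b1 where b1: "conjugate C A (a @ b) (a' @ b1)"
    using conjugate_extend gen_conjugate[OF small_base] assms by (meson lt_gen)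
  then have "gen (A \<union> set a') b1"
    using assms by (intro gen_transfer[OF b1]) (auto simp: lt_def gen_length)
  then have "conjugate C (A \<union> set a') b1 b'"
    using assms(2) by (intro gen_conjugate) (auto simp: lt_def small_base)
  then show ?thesis using b1 conjugate_over_left conjugate_trans by blast
qed

lemma lt_transfer:
  assumes "lt a b" "conjugate C A (a @ b) (a' @ b')" "length a = length a' \<or> length b = length b'"
  shows "lt a' b'"
  using assms conjugate_gen[OF conjugate_append(1)[OF assms(2,3)]] gen_transfer[OF assms(2,3)]
  by (auto simp: lt_def)

text \<open>Otherwise uniqueness of the type of Morley pairs would make the pair witnessing
  asymmetry conjugate to its reversal.\<close>

lemma lt_asym: "lt a b \<Longrightarrow> \<not> lt b a"
proof
  assume ab: "lt a b" "lt b a"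
  obtain a0 b0 where 0: "lt a0 b0" "tp C (a0 @ b0) A \<noteq> tp C (b0 @ a0) A"
    using asymmetric by (auto simp: asymmetric_def)
  have "conjugate C A (b0 @ a0) (b @ a)"
    by (rule conjugate_swap[OF lt_conjugate[OF 0(1) ab(1)]]) (metis ab(1) 0(1) lt_gen(1) gen_length)
  then have "conjugate C A (a0 @ b0) (b0 @ a0)"
    using lt_conjugate[OF 0(1) ab(2)] conjugate_sym conjugate_trans by blast
  then show False using conjugate_tp 0(2) by blast
qed

lemma lt_irrefl: "\<not> lt a a"
  by (auto dest: lt_asym)

text \<open>An element outside the closure of \<open>B\<close> stays generic when an element of the
  closure is adjoined, so it lies above it. Comparisons are obtained from this by choosing
  \<open>B\<close>.\<close>

lemma lt_if_gen:
  assumes "A \<subseteq> B" "small \<kappa> B" "gen A a" "\<not> gen B a" "gen B b"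
  shows "lt a b"
  using gen_closure[OF assms] assms(1,3) by (auto simp: lt_def intro: gen_mono)

lemma gen_upward:
  assumes "A \<subseteq> B" "small \<kappa> B" "gen B a" "gen A b" "\<not> lt b a"
  shows "gen B b"
  using lt_if_gen[OF assms(1,2,4) _ assms(3)] assms(5) by blast

lemma lt_trans: "lt a b \<Longrightarrow> lt b c \<Longrightarrow> lt a c"
proof -
  assume ab: "lt a b" and bc: "lt b c"
  have "\<not> gen (A \<union> set b) a" using lt_asym[OF ab] lt_gen(2)[OF ab] by (auto simp: lt_def)
  then show "lt a c"
    using lt_if_gen[of "A \<union> set b" a c] lt_gen[OF ab] bc by (auto simp: lt_def small_base)
qed

text \<open>If \<open>b\<close> is not above \<open>a\<close>, it lies in the closure of
  \<open>a\<close>, whereas \<open>c\<close> does not. This is negative transitivity, which makes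
  incomparability an equivalence relation.\<close>

lemma lt_cases: "lt a c \<Longrightarrow> gen A b \<Longrightarrow> lt a b \<or> lt b c"
  using lt_if_gen[of "A \<union> set a" b c] by (auto simp: lt_def small_base)

lemma lt_left: "\<not> lt a b \<Longrightarrow> lt a c \<Longrightarrow> gen A b \<Longrightarrow> lt b c"
  using lt_cases by blast

lemma lt_right: "\<not> lt b c \<Longrightarrow> lt a c \<Longrightarrow> gen A b \<Longrightarrow> lt a b"
  using lt_cases by blast

lemma ex_above: "gen A a \<Longrightarrow> \<exists>b. lt a b"
  using gen_exists[of "A \<union> set a"] by (auto simp: lt_def small_base)

text \<open>Take some \<open>b\<close> above \<open>a\<close>; an automorphism moving
  \<open>b\<close> to \<open>a\<close> moves \<open>a\<close> to an element below
  \<open>a\<close>.\<close>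

lemma ex_below: "gen A a \<Longrightarrow> \<exists>b. lt b a"
proof -
  assume a: "gen A a"
  obtain b where b: "lt a b" using ex_above[OF a] by blast
  have "conjugate C A b a" using gen_conjugate[OF small_base] lt_gen(2)[OF b] a by blast
  from conjugate_extend[OF this] obtain c where c: "conjugate C A (b @ a) (a @ c)" by blast
  have "length a = n" "length b = n" using lt_gen[OF b] gen_length by auto
  then have "conjugate C A (a @ b) (c @ a)" using conjugate_swap[OF c] by simp
  then have "lt c a" by (rule lt_transfer[OF b]) (simp add: \<open>length a = n\<close> \<open>length b = n\<close>)
  then show "\<exists>b. lt b a" by blast
qed

lemma ex_conjugate: "gen A a \<Longrightarrow> gen A a' \<Longrightarrow> \<exists>b'. conjugate C A (a @ b) (a' @ b')"
  using conjugate_extend gen_conjugate[OF small_base] by blast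

subsection \<open>Morley sequences as chains\<close>

lemma gen_below:
  assumes "A \<subseteq> B" "small \<kappa> B" "gen B a" "finite F" "\<And>b. b \<in> F \<Longrightarrow> gen A b \<and> \<not> gen B b"
  shows "gen (B \<union> \<Union> (set ` F)) a"
proof -
  have "small \<kappa> (B \<union> \<Union> (set ` F)) \<and> gen (B \<union> \<Union> (set ` F)) a"
    using assms(4,5)
  proof (induction F)
    case empty
    then show ?case using assms by simp
  next
    case (insert b F)
    let ?B = "B \<union> \<Union> (set ` F)"
    have B: "small \<kappa> ?B" "gen ?B a" using insert by auto
    have "\<not> gen ?B b" using insert.prems gen_mono[of b ?B B] by blast
    then have "gen (?B \<union> set b) a" using gen_closure[of ?B b a] B assms(1) insert.prems by auto
    then show ?case using small_set[OF B(1), of b] by (simp add: ac_simps)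
  qed
  then show ?thesis by blast
qed

text \<open>In a finite part, all other elements are below a maximal one \<open>m\<close>, hence in
  the closure of \<open>m\<close>, and adjoining them to \<open>m\<close> disturbs nothing. Each
  formula has finitely many parameters, which settles the infinite case.\<close>

lemma gen_chain:
  assumes "gen A a" "\<And>b. b \<in> S \<Longrightarrow> lt b a" "\<And>b c. b \<in> S \<Longrightarrow> c \<in> S \<Longrightarrow> b = c \<or> lt b c \<or> lt c b"
  shows "gen (A \<union> \<Union> (set ` S)) a"
proof -
  have fin: "gen (A \<union> \<Union> (set ` F)) a" if F: "finite F" "F \<subseteq> S" for F
  proof (cases "F = {}")
    case False
    obtain m where m: "m \<in> F" "\<And>b. b \<in> F \<Longrightarrow> \<not> lt m b"
      using F(1) False
    proof (induction F arbitrary: thesis rule: finite_ne_induct)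
      case (singleton x)
      then show ?case using lt_irrefl by blast
    next
      case (insert x F)
      then obtain m where m: "m \<in> F" "\<And>b. b \<in> F \<Longrightarrow> \<not> lt m b" by blast
      show ?case
      proof (cases "lt m x")
        case True
        then show ?thesis using insert(5)[of x] m(2) lt_trans lt_irrefl by blast
      next
        case False
        then show ?thesis using insert(5)[of m] m by blast
      qed
    qed
    have mS: "m \<in> S" using m(1) F(2) by blast
    have *: "gen A b \<and> \<not> gen (A \<union> set m) b" if "b \<in> F - {m}" for b
    proof -
      have "lt b m" using that m(2) F(2) mS assms(3)[of b m] by blast
      then show ?thesis using lt_asym lt_gen[OF \<open>lt b m\<close>] by (auto simp: lt_def)
    qed
    have "gen (A \<union> set m \<union> \<Union> (set ` (F - {m}))) a"
      by (rule gen_below) (use * assms(2)[OF mS] F(1) in \<open>auto simp: lt_def small_base\<close>)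
    moreover have "A \<union> set m \<union> \<Union> (set ` (F - {m})) = A \<union> \<Union> (set ` F)" using m(1) by auto
    ultimately show ?thesis by simp
  qed (use assms(1) in simp)
  have "holds C a \<phi>" if \<phi>: "\<phi> \<in> p" "pars \<phi> \<subseteq> A \<union> \<Union> (set ` S)" for \<phi>
  proof -
    have "pars \<phi> - A \<subseteq> \<Union> (set ` S)" using \<phi>(2) by blast
    then obtain F where F: "finite F" "F \<subseteq> set ` S" "pars \<phi> - A \<subseteq> \<Union> F"
      by (rule finite_subset_Union[OF finite_Diff[OF finite_pars]])
    from finite_subset_image[OF F(1,2)] obtain G where "G \<subseteq> S" "finite G" "F = set ` G" by blast
    then show ?thesis using fin[of G] F(3) \<phi>(1) unfolding realizes_def restr_def by blast
  qed
  then show ?thesis using gen_length[OF assms(1)] by (auto simp: realizes_def restr_def)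
qed

lemma morley_lt:
  assumes "morley C A n p r" "(a, b) \<in> r" "a \<noteq> b"
  shows "lt a b"
proof -
  have r: "gen (A \<union> \<Union> (set ` {b. (b, a) \<in> r \<and> b \<noteq> a})) a" if "a \<in> Field r" for a
    using assms(1) that by (simp add: morley_def)
  have "a \<in> Field r" "b \<in> Field r" using assms(2) by (auto simp: Field_def)
  then show ?thesis unfolding lt_def using r[of a] r[of b] assms(2,3)
    by (auto elim!: gen_mono)
qed

definition chain_order :: "'a list set \<Rightarrow> 'a list rel" where
  "chain_order S = {(a, b). a \<in> S \<and> b \<in> S \<and> (a = b \<or> lt a b)}"

lemma Field_chain_order: "Field (chain_order S) = S"
  by (auto simp: chain_order_def Field_def)

lemma morley_chain_order:
  assumes "\<And>a. a \<in> S \<Longrightarrow> gen A a" "\<And>a b. a \<in> S \<Longrightarrow> b \<in> S \<Longrightarrow> a = b \<or> lt a b \<or> lt b a"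
  shows "morley C A n p (chain_order S)"
  unfolding morley_def
proof
  have "refl_on S (chain_order S)" "trans (chain_order S)" "antisym (chain_order S)"
      "total_on S (chain_order S)" "chain_order S \<subseteq> S \<times> S"
    using assms(2) by (auto simp: chain_order_def refl_on_def trans_def antisym_def total_on_def
        dest: lt_trans lt_asym)
  then show "Linear_order (chain_order S)" by (simp add: order_on_defs Field_chain_order)
  show "\<forall>a\<in>Field (chain_order S). gen (A \<union> \<Union> (set ` {b. (b, a) \<in> chain_order S \<and> b \<noteq> a})) a"
    unfolding Field_chain_order
    by (intro ballI gen_chain) (use assms in \<open>auto simp: chain_order_def\<close>)
qed

text \<open>Chains are Morley sequences, so an element of \<open>M\<close> comparable to every entry
  could be inserted, against maximality.\<close>

lemma is_Inv_transversal:
  assumes "is_Inv C A n p M r"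
  shows "Linear_order r" and "a \<in> Field r \<Longrightarrow> gen A a \<and> set a \<subseteq> M"
    and "a \<in> Field r \<Longrightarrow> b \<in> Field r \<Longrightarrow> (a, b) \<in> r \<longleftrightarrow> a = b \<or> lt a b"
    and "gen A c \<Longrightarrow> set c \<subseteq> M \<Longrightarrow> \<exists>a\<in>Field r. \<not> lt a c \<and> \<not> lt c a"
proof -
  have mor: "morley C A n p r" "\<And>a. a \<in> Field r \<Longrightarrow> set a \<subseteq> M"
    and mx: "\<And>s. morley_in C A n p M s \<Longrightarrow> r \<subseteq> s \<Longrightarrow> s = r"
    using assms by (auto simp: is_Inv_def morley_in_def)
  show lin: "Linear_order r" using mor(1) by (simp add: morley_def)
  have gen: "gen A a" if "a \<in> Field r" for a
    using mor(1) that by (auto simp: morley_def intro: gen_mono)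
  show "a \<in> Field r \<Longrightarrow> gen A a \<and> set a \<subseteq> M" using gen mor(2) by blast
  have tot: "(a, a) \<in> r" "a \<noteq> b \<Longrightarrow> (a, b) \<in> r \<or> (b, a) \<in> r" if "a \<in> Field r" "b \<in> Field r" for a b
    using lin that by (auto simp: order_on_defs total_on_def dest: refl_onD)
  show iff: "(a, b) \<in> r \<longleftrightarrow> a = b \<or> lt a b" if "a \<in> Field r" "b \<in> Field r" for a b
    using tot[OF that] tot[OF that(2,1)] morley_lt[OF mor(1)] lt_asym by blast
  show "\<exists>a\<in>Field r. \<not> lt a c \<and> \<not> lt c a" if c: "gen A c" "set c \<subseteq> M"
  proof (rule ccontr)
    assume no: "\<not> (\<exists>a\<in>Field r. \<not> lt a c \<and> \<not> lt c a)"
    let ?S = "insert c (Field r)"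
    have "a = b \<or> lt a b \<or> lt b a" if "a \<in> ?S" "b \<in> ?S" for a b
      using that no tot morley_lt[OF mor(1)] by blast
    then have "morley C A n p (chain_order ?S)" using gen c(1) by (intro morley_chain_order) auto
    then have "morley_in C A n p M (chain_order ?S)"
      using mor(2) c(2) by (auto simp: morley_in_def Field_chain_order)
    moreover have "r \<subseteq> chain_order ?S"
      using morley_lt[OF mor(1)] by (auto simp: chain_order_def intro: FieldI1 FieldI2)
    ultimately have "chain_order ?S = r" by (rule mx)
    then have "c \<in> Field r" using Field_chain_order[of ?S] by auto
    then show False using no lt_irrefl by blast
  qed
qed

subsection \<open>Classes, convexity and simplicity\<close>

lemma mem_cls: "gen A a \<Longrightarrow> c \<in> cls C A n p a \<longleftrightarrow> gen A c \<and> \<not> lt a c \<and> \<not> lt c a"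
  by (auto simp: cls_def lt_def)

text \<open>In a strict weak order incomparable elements have the same elements above and below
  them, so their classes coincide.\<close>

lemma cls_le_iff:
  assumes "gen A a" "gen A b" shows "cls_le C A n p a b \<longleftrightarrow> \<not> lt b a"
proof
  assume "cls_le C A n p a b"
  then consider "cls C A n p a = cls C A n p b" | "lt a b" by (auto simp: cls_le_def)
  then show "\<not> lt b a"
  proof cases
    case 1
    moreover have "a \<in> cls C A n p a" using assms(1) lt_irrefl by (simp add: mem_cls)
    ultimately show ?thesis using assms(2) by (auto simp: mem_cls)
  qed (rule lt_asym)
next
  assume n: "\<not> lt b a"
  have "cls C A n p a = cls C A n p b" if n': "\<not> lt a b"
  proof -
    have "lt a c \<longleftrightarrow> lt b c" "lt c a \<longleftrightarrow> lt c b" if "gen A c" for c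
      using lt_left lt_right n n' assms by blast+
    then show ?thesis using assms by (auto simp: mem_cls)
  qed
  then show "cls_le C A n p a b" unfolding cls_le_def by blast
qed

lemma bounded_set_iff:
  "bounded_set C A n p D \<longleftrightarrow> (\<exists>d\<in>D. gen A d) \<and>
     (\<exists>l u. gen A l \<and> gen A u \<and> (\<forall>d\<in>D. gen A d \<longrightarrow> \<not> lt d l \<and> \<not> lt u d))"
  unfolding bounded_set_def by (auto simp: cls_le_iff cong: conj_cong)

lemma convex_definable:
  "\<exists>X. definable C (n + n) A X \<and> (\<forall>a b. lt a b \<longrightarrow> X (a @ b)) \<and>
    (\<forall>a b c. gen A a \<and> gen A b \<and> length c = n \<and> X (a @ c) \<and> X (c @ b) \<longrightarrow> gen A c)"
proof -
  obtain \<psi> where \<psi>: "\<psi> \<in> formulas C (n + n) A"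
    "\<And>r a b. morley C A n p r \<Longrightarrow> (a, b) \<in> r \<Longrightarrow> a \<noteq> b \<Longrightarrow> holds C (a @ b) \<psi>"
    "\<And>a b c. gen A a \<Longrightarrow> gen A b \<Longrightarrow> length c = n \<Longrightarrow> holds C (a @ c) \<psi> \<Longrightarrow> holds C (c @ b) \<psi> \<Longrightarrow> gen A c"
    using convex unfolding convex_def by blast
  have "holds C (a @ b) \<psi>" if ab: "lt a b" for a b
  \<comment> \<open>Convexity speaks of arbitrary Morley sequences; the pair is one with two
    entries.\<close>
  proof (rule \<psi>(2)[of "chain_order {a, b}"])
    show "morley C A n p (chain_order {a, b})"
      using ab lt_gen[OF ab] by (intro morley_chain_order) auto
    show "a \<noteq> b" using ab lt_irrefl by blast
    show "(a, b) \<in> chain_order {a, b}" using ab by (simp add: chain_order_def)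
  qed
  then show ?thesis using \<psi>(1,3) by (intro exI[of _ "\<lambda>c. holds C c \<psi>"]) (blast intro: definableI)
qed

text \<open>By convexity and compactness a bounded definable set of realizations can be cut out by a formula
  all of whose solutions are realizations.\<close>

lemma bounded_in_model:
  assumes M: "elementary_substructure C M" "small \<kappa> M" "A \<subseteq> M"
    and X: "definable C n M X" "gen A d" "X d"
    and lu: "gen A l" "gen A u" "\<And>d. gen A d \<Longrightarrow> X d \<Longrightarrow> \<not> lt d l \<and> \<not> lt u d"
  shows "\<exists>d. gen A d \<and> X d \<and> set d \<subseteq> M"
proof -
  \<comment> \<open>The bounds \<open>l\<close> and \<open>u\<close> are weak. One step outwards
    makes them strict, and strict inequalities entail the convexity formula.\<close>
  obtain l' where l': "lt l' l" using ex_below[OF lu(1)] by blast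
  obtain u' where u': "lt u u'" using ex_above[OF lu(2)] by blast
  obtain Z where Z: "definable C (n + n) A Z" "\<And>a b. lt a b \<Longrightarrow> Z (a @ b)"
    "\<And>a b c. gen A a \<Longrightarrow> gen A b \<Longrightarrow> length c = n \<Longrightarrow> Z (a @ c) \<Longrightarrow> Z (c @ b) \<Longrightarrow> gen A c"
    using convex_definable by blast
  have len: "length l' = n" "length u' = n" "length d = n"
    using l' u' X(2) lt_gen gen_length by blast+
  let ?B = "M \<union> set l' \<union> set u'"
  have "definable C n ?B (\<lambda>c. Z (l' @ c))" "definable C n ?B (\<lambda>c. Z (c @ u'))" "definable C n ?B X"
    using definable_instance_left[OF Z(1) len(1)] definable_instance_right[OF Z(1) len(2)] X(1) M(3)
    by (auto elim!: definable_mono)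
  then have def: "definable C n ?B (\<lambda>c. X c \<and> \<not> (Z (l' @ c) \<and> Z (c @ u')))"
    by (intro definable_conj definable_not)
  have small: "small \<kappa> ?B" using M(2) by simp
  \<comment> \<open>Otherwise compactness yields a solution of \<open>X\<close> with the type of
    \<open>d\<close> over \<open>A\<close> that escapes the bounds; but it is a realization of
    \<open>p\<close> over \<open>A\<close>, so it respects them.\<close>
  have "\<exists>Y. definable C n A Y \<and> Y d \<and> (\<forall>c. length c = n \<and> Y c \<and> X c \<longrightarrow> Z (l' @ c) \<and> Z (c @ u'))"
  proof (rule ccontr)
    assume "\<not> ?thesis"
    then have "\<exists>c. length c = n \<and> Y c \<and> (X c \<and> \<not> (Z (l' @ c) \<and> Z (c @ u')))"
      if "definable C n A Y" "Y d" for Y using that by blast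
    from realize_definable[OF small_base small len(3) def this] obtain c where
      c: "conjugate C A d c" "X c" "\<not> (Z (l' @ c) \<and> Z (c @ u'))" by blast
    have g: "gen A c" using conjugate_gen[OF c(1) X(2)] .
    have "lt l' c" using lt_right[OF _ l' g] lu(3)[OF g c(2)] by blast
    moreover have "lt c u'" using lt_left[OF _ u' g] lu(3)[OF g c(2)] by blast
    ultimately show False using c(3) Z(2) by blast
  qed
  then obtain Y where Y: "definable C n A Y" "Y d"
    "\<And>c. length c = n \<Longrightarrow> Y c \<Longrightarrow> X c \<Longrightarrow> Z (l' @ c) \<and> Z (c @ u')" by blast
  \<comment> \<open>The formula solved in \<open>M\<close> avoids \<open>l'\<close> and
    \<open>u'\<close>, which may lie outside \<open>M\<close>; convexity is applied to the solution
    afterwards.\<close>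
  have "definable C n M (\<lambda>c. X c \<and> Y c)" using X(1) Y(1) M(3) definable_mono definable_conj by blast
  from elementary_substructure_definable[OF M(1) this, of d] obtain c where
    "length c = n" "set c \<subseteq> M" "X c" "Y c" using X(3) Y(2) len(3) by blast
  then show ?thesis using Y(3) Z(3) lt_gen(1)[OF l'] lt_gen(2)[OF u'] by blast
qed

lemma simpleI:
  assumes "definable C (n + n) A X" "\<And>a b. gen A a \<Longrightarrow> gen A b \<Longrightarrow> X (a @ b) \<longleftrightarrow> lt a b"
  shows "simple C A n p"
proof -
  obtain Y where Y: "definable C (n + n) A Y" "\<And>a b. length a = n \<Longrightarrow> length b = n \<Longrightarrow> Y (b @ a) = X (a @ b)"
    using definable_swap[OF assms(1)] by blast
  have "definable C (n + n) A (\<lambda>c. \<not> X c \<and> \<not> Y c)"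
    by (intro definable_conj definable_not assms(1) Y(1))
  then obtain \<psi> where "\<psi> \<in> formulas C (n + n) A" "\<And>c. length c = n + n \<Longrightarrow> holds C c \<psi> \<longleftrightarrow> \<not> X c \<and> \<not> Y c"
    by (auto simp: definable_def)
  then show ?thesis
    unfolding simple_def using assms(2) Y(2) by (intro bexI[of _ \<psi>]) (auto simp: gen_length mem_cls)
qed

end

section \<open>Pairs of regular types\<close>

locale regular_pair = P: regular_type C \<kappa> A n p + Q: regular_type C \<kappa> A m q
  for C :: "('f, 'r, 'a) struct" and \<kappa> :: "'k rel" and A :: "'a set"
    and n :: nat and p :: "('f, 'r, 'a) fm set" and m :: nat and q :: "('f, 'r, 'a) fm set"
begin

lemma swap: "regular_pair C \<kappa> A m q n p"
  by unfold_locales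

text \<open>A formula of \<open>q\<close> over \<open>a\<close> that fails at \<open>b\<close>
  holds, by invariance, at every generic pair once its parameters are abstracted; its negation is
  the witness.\<close>

lemma dependence_open:
  assumes "P.gen A a" "Q.gen A b" "\<not> Q.gen (A \<union> set a) b"
  shows "\<exists>X. definable C (n + m) A X \<and> X (a @ b) \<and>
    (\<forall>a' d. P.gen A a' \<and> Q.gen A d \<and> X (a' @ d) \<longrightarrow> \<not> Q.gen (A \<union> set a') d)"
proof -
  have len: "length a = n" "length b = m" using assms P.gen_length Q.gen_length by auto
  obtain \<phi> where \<phi>: "\<phi> \<in> restr q (A \<union> set a)" "\<not> holds C b \<phi>"
    using assms(3) len by (auto simp: realizes_def)
  have "\<phi> \<in> formulas C m (A \<union> set a)" using \<phi>(1) Q.in_p by (auto simp: restr_def formulas_def)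
  from definable_abstract[OF definableI[OF this] len(1)] obtain Y where
    Y: "definable C (n + m) A Y" "\<And>d. length d = m \<Longrightarrow> Y (a @ d) = holds C d \<phi>" by blast
  have "Y (a' @ d)" if g: "P.gen A a'" "Q.gen (A \<union> set a') d" for a' d
  proof -
    obtain d' where d': "conjugate C A (a' @ d) (a @ d')" using P.ex_conjugate[OF g(1) assms(1)] by blast
    have l: "length a' = n" "length d = m" using g P.gen_length Q.gen_length by auto
    have "Q.gen (A \<union> set a) d'" by (rule Q.gen_transfer[OF d' _ order_refl g(2)]) (simp add: len l)
    then have "Y (a @ d')" using Y(2) \<phi>(1) by (simp add: realizes_def)
    moreover have "definable C (length (a' @ d)) A Y" using Y(1) l by simp
    ultimately show ?thesis using conjugate_definable[OF d'] by blast
  qed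
  then show ?thesis using definable_not[OF Y(1)] Y(2) \<phi>(2) len
    by (intro exI[of _ "\<lambda>c. \<not> Y c"]) blast
qed

text \<open>A witness of bounded type, spread over all realizations of both types. Bounds are
  demanded only for the fibres in \<open>q\<close>; for those in \<open>p\<close> they come from
  monotonicity.\<close>

definition bounded_link :: "('a list \<Rightarrow> bool) \<Rightarrow> bool" where
  "bounded_link X \<longleftrightarrow> definable C (n + m) A X \<and>
     (\<forall>a. P.gen A a \<longrightarrow> (\<exists>b. Q.gen A b \<and> X (a @ b)) \<and>
        (\<exists>l u. Q.gen A l \<and> Q.gen A u \<and> (\<forall>d. Q.gen A d \<longrightarrow> X (a @ d) \<longrightarrow> \<not> Q.lt d l \<and> \<not> Q.lt u d))) \<and>
     (\<forall>b. Q.gen A b \<longrightarrow> (\<exists>a. P.gen A a \<and> X (a @ b)))"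

lemma bounded_linkD:
  assumes "bounded_link X"
  shows "definable C (n + m) A X"
    and "P.gen A a \<Longrightarrow> \<exists>b. Q.gen A b \<and> X (a @ b)"
    and "P.gen A a \<Longrightarrow> \<exists>l u. Q.gen A l \<and> Q.gen A u \<and>
      (\<forall>d. Q.gen A d \<longrightarrow> X (a @ d) \<longrightarrow> \<not> Q.lt d l \<and> \<not> Q.lt u d)"
    and "Q.gen A b \<Longrightarrow> \<exists>a. P.gen A a \<and> X (a @ b)"
  using assms unfolding bounded_link_def by simp_all

lemma bounded_typeI:
  assumes "definable C (n + m) A X" "P.gen A a" "Q.gen A b" "X (a @ b)" "Q.gen A l" "Q.gen A u"
    and "\<And>d. Q.gen A d \<Longrightarrow> X (a @ d) \<Longrightarrow> \<not> Q.lt d l \<and> \<not> Q.lt u d"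
  shows "bounded_type C A n p m q"
proof -
  obtain \<theta> where \<theta>: "\<theta> \<in> formulas C (n + m) A" "\<And>c. length c = n + m \<Longrightarrow> holds C c \<theta> \<longleftrightarrow> X c"
    using assms(1) by (auto simp: definable_def)
  have len: "length a = n" "length b = m" using assms P.gen_length Q.gen_length by auto
  have "bounded_set C A m q {d. length d = m \<and> holds C (a @ d) \<theta>}"
    unfolding Q.bounded_set_iff
  proof (intro conjI exI ballI impI)
    show "\<exists>d\<in>{d. length d = m \<and> holds C (a @ d) \<theta>}. Q.gen A d"
      using assms(3,4) \<theta>(2) len by (intro bexI[of _ b]) auto
    fix d assume "d \<in> {d. length d = m \<and> holds C (a @ d) \<theta>}" "Q.gen A d"
    then show "\<not> Q.lt d l" "\<not> Q.lt u d" using assms(7)[of d] \<theta>(2)[of "a @ d"] len by auto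
  qed (use assms(5,6) in auto)
  then show ?thesis
    unfolding bounded_type_def using assms(2-4) \<theta> len by (intro exI[of _ a] exI[of _ b] conjI bexI[of _ \<theta>])
      (auto simp: tp_def)
qed

text \<open>Automorphisms over \<open>A\<close> carry the fibre at \<open>a\<close> with its bounds
  to any other \<open>a'\<close>, and others move \<open>b\<close> to any \<open>b'\<close>.\<close>

lemma bounded_typeE:
  assumes "bounded_type C A n p m q"
  shows "\<exists>X. bounded_link X"
proof -
  obtain a b \<theta> where ab: "P.gen A a" "Q.gen A b" and \<theta>: "\<theta> \<in> tp C (a @ b) A"
    "bounded_set C A m q {d. length d = m \<and> holds C (a @ d) \<theta>}"
    using assms by (auto simp: bounded_type_def)
  have len: "length a = n" "length b = m" using ab P.gen_length Q.gen_length by auto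
  have f: "\<theta> \<in> formulas C (n + m) A" "holds C (a @ b) \<theta>" using \<theta>(1) len by (auto simp: tp_def)
  obtain l u where lu: "Q.gen A l" "Q.gen A u"
    "\<And>d. Q.gen A d \<Longrightarrow> holds C (a @ d) \<theta> \<Longrightarrow> \<not> Q.lt d l \<and> \<not> Q.lt u d"
    using \<theta>(2) Q.gen_length unfolding Q.bounded_set_iff by blast
  let ?X = "\<lambda>c. holds C c \<theta>"
  have def: "definable C (n + m) A ?X" using f(1) by (rule definableI)
  have tr: "?X c \<longleftrightarrow> ?X d" if "conjugate C A c d" "length c = n + m" for c d
    using conjugate_definable[OF that(1)] def that(2) by simp
  have "(\<exists>b. Q.gen A b \<and> ?X (a' @ b)) \<and>
      (\<exists>l u. Q.gen A l \<and> Q.gen A u \<and> (\<forall>d. Q.gen A d \<longrightarrow> ?X (a' @ d) \<longrightarrow> \<not> Q.lt d l \<and> \<not> Q.lt u d))"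
    if a': "P.gen A a'" for a'
  proof -
    have l': "length a' = n" using P.gen_length[OF a'] .
    obtain bs where bs: "conjugate C A (a @ (b @ l @ u)) (a' @ bs)" using P.ex_conjugate[OF ab(1) a'] by blast
    then obtain \<sigma> where \<sigma>: "automorphism C \<sigma>" "\<forall>x\<in>A. \<sigma> x = x" "map \<sigma> (a @ (b @ l @ u)) = a' @ bs"
      by (auto simp: conjugate_def)
    have sa: "map \<sigma> a = a'" using \<sigma>(3) l' len by simp
    have cj: "conjugate C A x (map \<sigma> x)" for x using \<sigma>(1,2) by (auto simp: conjugate_def)
    have gQ: "Q.gen A (map \<sigma> x)" if "Q.gen A x" for x by (rule Q.conjugate_gen[OF cj that])
    have "?X (a' @ map \<sigma> b)" using tr[OF cj[of "a @ b"]] f(2) len sa by simp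
    moreover have "\<not> Q.lt d (map \<sigma> l) \<and> \<not> Q.lt (map \<sigma> u) d" if d: "Q.gen A d" "?X (a' @ d)" for d
    proof -
      obtain d' where d': "d = map \<sigma> d'"
        using \<sigma>(1) by (metis automorphism_def bij_is_surj ex_map_conv surjD)
      have g: "Q.gen A d'" using Q.conjugate_gen[OF conjugate_sym[OF cj]] d(1) d' by blast
      have "?X (a @ d')" using tr[OF cj[of "a @ d'"]] d(2) sa d' len Q.gen_length[OF g] by simp
      then have n: "\<not> Q.lt d' l" "\<not> Q.lt u d'" using lu(3)[OF g] by auto
      have "length d' = m" "length l = m" "length u = m" using g lu(1,2) Q.gen_length by auto
      then have "Q.lt d' l" if "Q.lt d (map \<sigma> l)"
        using Q.lt_transfer[OF that, of d' l] conjugate_sym[OF cj[of "d' @ l"]] d' by simp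
      moreover have "Q.lt u d'" if "Q.lt (map \<sigma> u) d"
        using Q.lt_transfer[OF that, of u d'] conjugate_sym[OF cj[of "u @ d'"]] d' \<open>length d' = m\<close> by simp
      ultimately show ?thesis using n by blast
    qed
    ultimately show ?thesis using gQ ab(2) lu(1,2) by blast
  qed
  moreover have "\<exists>a'. P.gen A a' \<and> ?X (a' @ b')" if b': "Q.gen A b'" for b'
  proof -
    obtain a' where a': "conjugate C A (b @ a) (b' @ a')" using Q.ex_conjugate[OF ab(2) b'] by blast
    have l: "length b' = m" using Q.gen_length[OF b'] .
    then have "conjugate C A (a @ b) (a' @ b')" "conjugate C A a a'"
      using conjugate_swap[OF a'] conjugate_append(2)[OF a'] len by auto
    then have "?X (a' @ b')" "P.gen A a'"
      using tr[of "a @ b" "a' @ b'"] f(2) len P.conjugate_gen[OF _ ab(1)] by simp_all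
    then show ?thesis by blast
  qed
  ultimately show ?thesis unfolding bounded_link_def using def by blast
qed

text \<open>The elements generic over \<open>a\<close> have one type over it and are cofinal, so a
  generic \<open>b\<close> in the fibre would make the fibre unbounded.\<close>

lemma bounded_link_dependent:
  assumes X: "bounded_link X" and ab: "P.gen A a" "X (a @ b)"
  shows "\<not> Q.gen (A \<union> set a) b"
proof
  assume b: "Q.gen (A \<union> set a) b"
  obtain u where u: "Q.gen A u" "\<And>d. Q.gen A d \<Longrightarrow> X (a @ d) \<Longrightarrow> \<not> Q.lt u d"
    using bounded_linkD(3)[OF X ab(1)] by blast
  have small: "small \<kappa> (A \<union> set a)" by (simp add: P.small_base)
  obtain u' where u': "Q.gen (A \<union> set a \<union> set u) u'" using Q.gen_exists[OF P.small_set[OF small]] by blast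
  then have g: "Q.gen (A \<union> set a) u'" "Q.lt u u'"
    using u(1) unfolding Q.lt_def by (auto elim: Q.gen_mono)
  have "conjugate C A (a @ b) (a @ u')"
    by (rule conjugate_over_left[OF Q.gen_conjugate[OF small b g(1)]])
  moreover have "definable C (length (a @ b)) A X"
    using X b ab(1) P.gen_length Q.gen_length by (simp add: bounded_link_def)
  ultimately have "X (a @ u')" using conjugate_definable ab(2) by blast
  then show False using u(2) Q.lt_gen(2)[OF g(2)] g(2) by blast
qed

abbreviation directed :: "('a list \<Rightarrow> 'a list \<Rightarrow> bool) \<Rightarrow> bool" where
  "directed R \<equiv> R = Q.lt \<or> R = (\<lambda>b b'. Q.lt b' b)"

text \<open>Pairs in the relation \<open>R\<close> are all conjugate, so a linked increasing pair
  can be moved onto \<open>b\<close>, \<open>b'\<close>. Elements linked to the same tuple are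
  incomparable, so \<open>a\<close>, \<open>a'\<close> may replace the moved pair.\<close>

lemma monotone_link_iff:
  assumes X: "bounded_link X" and R: "directed R"
    and mono: "\<And>a a' b b'. P.lt a a' \<Longrightarrow> Q.gen A b \<Longrightarrow> Q.gen A b' \<Longrightarrow> X (a @ b) \<Longrightarrow> X (a' @ b') \<Longrightarrow> R b b'"
    and g: "P.gen A a" "P.gen A a'" "Q.gen A b" "Q.gen A b'" "X (a @ b)" "X (a' @ b')"
  shows "P.lt a a' \<longleftrightarrow> R b b'"
proof
  assume lt: "R b b'"
  have asym: "\<not> R b b'" if "R b' b" for b b' using R that Q.lt_asym by blast
  have irr: "\<not> R b b" for b using R Q.lt_irrefl by blast
  have def: "definable C (n + m) A X" using X by (simp add: bounded_link_def)
  obtain a1 a2 where a12: "P.lt a1 a2" using P.ex_above[OF g(1)] by blast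
  obtain b1 b2 where b12: "Q.gen A b1" "X (a1 @ b1)" "Q.gen A b2" "X (a2 @ b2)"
    using bounded_linkD(2)[OF X P.lt_gen(1)[OF a12]] bounded_linkD(2)[OF X P.lt_gen(2)[OF a12]] by blast
  have R12: "R b1 b2" using mono[OF a12 b12(1,3,2,4)] .
  have l: "length b1 = m" "length b2 = m" "length b = m" "length b' = m" "length a1 = n" "length a2 = n"
    using b12 g P.lt_gen[OF a12] P.gen_length Q.gen_length by auto
  have "conjugate C A (b1 @ b2) (b @ b')"
    using R
  proof
    assume "R = (\<lambda>b b'. Q.lt b' b)"
    then have "conjugate C A (b2 @ b1) (b' @ b)" using Q.lt_conjugate R12 lt by blast
    then show ?thesis by (rule conjugate_swap) (simp add: l)
  qed (use Q.lt_conjugate R12 lt in blast)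
  then obtain \<sigma> where \<sigma>: "automorphism C \<sigma>" "\<forall>x\<in>A. \<sigma> x = x" "map \<sigma> b1 = b" "map \<sigma> b2 = b'"
    by (auto simp: conjugate_def l)
  have cj: "conjugate C A x (map \<sigma> x)" for x using \<sigma>(1,2) by (auto simp: conjugate_def)
  let ?a = "map \<sigma> a1" and ?a' = "map \<sigma> a2"
  have lt': "P.lt ?a ?a'" using P.lt_transfer[OF a12, of ?a ?a'] cj[of "a1 @ a2"] by simp
  have Xs: "X (?a @ b)" "X (?a' @ b')"
    using conjugate_definable[OF cj[of "a1 @ b1"], of X] conjugate_definable[OF cj[of "a2 @ b2"], of X]
      def l \<sigma>(3,4) b12 by auto
  have tie: "\<not> P.lt x y" if "X (x @ d)" "X (y @ d)" "Q.gen A d" for x y d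
    using mono[OF _ that(3,3,1,2)] irr by blast
  have "P.lt ?a a'" using P.lt_right[OF _ lt' g(2)] tie[OF g(6) Xs(2) g(4)] by blast
  then show "P.lt a a'" using P.lt_left[OF _ _ g(1)] tie[OF Xs(1) g(5) g(3)] by blast
next
  assume "P.lt a a'"
  then show "R b b'" using mono g(3-6) by blast
qed

text \<open>Here \<open>s'\<close> stands for \<open>s\<close> or its converse, so that increasing
  and decreasing links are treated together.\<close>

lemma isomorphic_if_monotone:
  assumes X: "bounded_link X" and R: "directed R"
    and mono: "\<And>a a' b b'. P.lt a a' \<Longrightarrow> Q.gen A b \<Longrightarrow> Q.gen A b' \<Longrightarrow> X (a @ b) \<Longrightarrow> X (a' @ b') \<Longrightarrow> R b b'"
    and M: "elementary_substructure C M" "small \<kappa> M" "A \<subseteq> M"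
    and r: "is_Inv C A n p M r" and s: "is_Inv C A m q M s"
    and s': "Linear_order s'" "Field s' = Field s"
      "\<And>y y'. y \<in> Field s \<Longrightarrow> y' \<in> Field s \<Longrightarrow> (y, y') \<in> s' \<and> y \<noteq> y' \<longleftrightarrow> R y y'"
  shows "isomorphic r s'"
proof (rule isomorphicI_link)
  have iff: "P.lt a a' \<longleftrightarrow> R b b'"
    if "P.gen A a" "P.gen A a'" "Q.gen A b" "Q.gen A b'" "X (a @ b)" "X (a' @ b')" for a a' b b'
    by (rule monotone_link_iff[OF X R _ that]) (rule mono)
  note r' = P.is_Inv_transversal[OF r] and s1 = Q.is_Inv_transversal[OF s]
  have def: "definable C (n + m) A X" using X by (simp add: bounded_link_def)
  \<comment> \<open>The link matches classes rather than chosen representatives, so linked tuples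
    are sought in the classes of \<open>x\<close> and \<open>y\<close>.\<close>
  define T where "T x y \<longleftrightarrow> (\<exists>a b. P.gen A a \<and> Q.gen A b \<and> X (a @ b) \<and> \<not> P.lt a x \<and> \<not> P.lt x a \<and>
    \<not> Q.lt b y \<and> \<not> Q.lt y b)" for x y
  show "Linear_order r" by (rule r'(1))
  show "Linear_order s'" by (rule s'(1))
  show "\<exists>y\<in>Field s'. T x y" if x: "x \<in> Field r" for x
  proof -
    have gx: "P.gen A x" "set x \<subseteq> M" using r'(2)[OF x] by auto
    have "definable C m M (\<lambda>d. X (x @ d))"
      by (rule definable_mono[OF definable_instance_left[OF def P.gen_length[OF gx(1)]]]) (use M(3) gx(2) in blast)
    moreover obtain b l u where "Q.gen A b" "X (x @ b)" "Q.gen A l" "Q.gen A u"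
      "\<And>d. Q.gen A d \<Longrightarrow> X (x @ d) \<Longrightarrow> \<not> Q.lt d l \<and> \<not> Q.lt u d"
      using bounded_linkD(2,3)[OF X gx(1)] by blast
    ultimately obtain d where d: "Q.gen A d" "X (x @ d)" "set d \<subseteq> M"
      using Q.bounded_in_model[OF M] by blast
    from s1(4)[OF d(1,3)] show ?thesis
      unfolding T_def s'(2) using d gx(1) P.lt_irrefl by metis
  qed
  show "\<exists>x\<in>Field r. T x y" if y: "y \<in> Field s'" for y
  proof -
    have gy: "Q.gen A y" "set y \<subseteq> M" using s1(2) y s'(2) by auto
    have "definable C n M (\<lambda>d. X (d @ y))"
      by (rule definable_mono[OF definable_instance_right[OF def Q.gen_length[OF gy(1)]]]) (use M(3) gy(2) in blast)
    moreover obtain a where a: "P.gen A a" "X (a @ y)" using bounded_linkD(4)[OF X gy(1)] by blast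
    \<comment> \<open>By monotonicity the fibre over \<open>y\<close> lies in one class, so
      \<open>a\<close> serves as lower and as upper bound.\<close>
    moreover have "\<not> P.lt d a \<and> \<not> P.lt a d" if "P.gen A d" "X (d @ y)" for d
      using iff[OF a(1) that(1) gy(1) gy(1) a(2) that(2)] iff[OF that(1) a(1) gy(1) gy(1) that(2) a(2)]
        R Q.lt_irrefl by blast
    ultimately obtain d where d: "P.gen A d" "X (d @ y)" "set d \<subseteq> M"
      using P.bounded_in_model[OF M, of "\<lambda>d. X (d @ y)" a a a] by blast
    from r'(4)[OF d(1,3)] show ?thesis
      unfolding T_def using d gy(1) Q.lt_irrefl by metis
  qed
  fix x y x' y' assume f: "x \<in> Field r" "x' \<in> Field r" "y \<in> Field s'" "y' \<in> Field s'" and T: "T x y" "T x' y'"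
  have gx: "P.gen A x" "P.gen A x'" "Q.gen A y" "Q.gen A y'" using r'(2) s1(2) f s'(2) by auto
  obtain a b where ab: "P.gen A a" "Q.gen A b" "X (a @ b)" "\<not> P.lt a x" "\<not> P.lt x a" "\<not> Q.lt b y" "\<not> Q.lt y b"
    using T(1) by (auto simp: T_def)
  obtain a' b' where ab': "P.gen A a'" "Q.gen A b'" "X (a' @ b')" "\<not> P.lt a' x'" "\<not> P.lt x' a'"
    "\<not> Q.lt b' y'" "\<not> Q.lt y' b'"
    using T(2) by (auto simp: T_def)
  have "P.lt x x' \<longleftrightarrow> P.lt a a'"
    using P.lt_left P.lt_right ab ab' gx by blast
  also have "\<dots> \<longleftrightarrow> R b b'" by (rule iff[OF ab(1) ab'(1) ab(2) ab'(2) ab(3) ab'(3)])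
  also have "\<dots> \<longleftrightarrow> R y y'"
  proof -
    have "Q.lt b b' \<longleftrightarrow> Q.lt y y'" "Q.lt b' b \<longleftrightarrow> Q.lt y' y"
      using Q.lt_left Q.lt_right ab ab' gx by blast+
    then show ?thesis using R by auto
  qed
  finally have "P.lt x x' \<longleftrightarrow> (y, y') \<in> s' \<and> y \<noteq> y'" using s'(3) f s'(2) by simp
  then show "(x, x') \<in> r \<and> x \<noteq> x' \<longleftrightarrow> (y, y') \<in> s' \<and> y \<noteq> y'"
    using r'(3)[OF f(1,2)] P.lt_irrefl by blast
qed

lemma isomorphic_if_increasing:
  assumes "bounded_link X"
    and "\<And>a a' b b'. P.lt a a' \<Longrightarrow> Q.gen A b \<Longrightarrow> Q.gen A b' \<Longrightarrow> X (a @ b) \<Longrightarrow> X (a' @ b') \<Longrightarrow> Q.lt b b'"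
    and M: "elementary_substructure C M" "small \<kappa> M" "A \<subseteq> M"
    and r: "is_Inv C A n p M r" and s: "is_Inv C A m q M s"
  shows "isomorphic r s"
proof (rule isomorphic_if_monotone[where R = Q.lt, OF assms(1) _ _ M r s])
  show "Linear_order s" by (rule Q.is_Inv_transversal(1)[OF s])
  show "(y, y') \<in> s \<and> y \<noteq> y' \<longleftrightarrow> Q.lt y y'" if "y \<in> Field s" "y' \<in> Field s" for y y'
    using Q.is_Inv_transversal(3)[OF s that] Q.lt_irrefl by blast
qed (use assms(2) in simp_all)

lemma anti_isomorphic_if_decreasing:
  assumes "bounded_link X"
    and "\<And>a a' b b'. P.lt a a' \<Longrightarrow> Q.gen A b \<Longrightarrow> Q.gen A b' \<Longrightarrow> X (a @ b) \<Longrightarrow> X (a' @ b') \<Longrightarrow> Q.lt b' b"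
    and M: "elementary_substructure C M" "small \<kappa> M" "A \<subseteq> M"
    and r: "is_Inv C A n p M r" and s: "is_Inv C A m q M s"
  shows "anti_isomorphic r s"
  unfolding anti_isomorphic_def
proof (rule isomorphic_if_monotone[where R = "\<lambda>b b'. Q.lt b' b", OF assms(1) _ _ M r s])
  show "Linear_order (s\<inverse>)" using Q.is_Inv_transversal(1)[OF s] by simp
  show "(y, y') \<in> s\<inverse> \<and> y \<noteq> y' \<longleftrightarrow> Q.lt y' y" if "y \<in> Field s" "y' \<in> Field s" for y y'
    using Q.is_Inv_transversal(3)[OF s that(2,1)] Q.lt_irrefl by blast
qed (use assms(2) in simp_all)

end

section \<open>Independent pairs and uniform definability of dependence\<close>

context regular_pair
begin

lemma product_conjugate:
  assumes "P.gen A a" "Q.gen (A \<union> set a) b" "P.gen A a'" "Q.gen (A \<union> set a') b'"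
  shows "conjugate C A (a @ b) (a' @ b')"
proof -
  obtain b1 where b1: "conjugate C A (a @ b) (a' @ b1)" using P.ex_conjugate[OF assms(1,3)] by blast
  have "Q.gen (A \<union> set a') b1"
    by (rule Q.gen_transfer[OF b1 _ order_refl assms(2)]) (use assms P.gen_length in metis)
  then have "conjugate C (A \<union> set a') b1 b'" using assms(4) by (intro Q.gen_conjugate) (simp add: P.small_base)
  then show ?thesis using b1 conjugate_over_left conjugate_trans by blast
qed

text \<open>Homogeneity spreads definability from one \<open>a\<close> to all: its parameters are
  abstracted, and genericity moves with automorphisms.\<close>

lemma dependence_definable_everywhere:
  assumes a: "P.gen A a" and Y: "definable C m (A \<union> set a) Y"
    "\<And>b. Q.gen A b \<Longrightarrow> Y b \<longleftrightarrow> Q.gen (A \<union> set a) b"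
  shows "\<exists>X. definable C (n + m) A X \<and> (\<forall>a b. P.gen A a \<and> Q.gen A b \<longrightarrow> (X (a @ b) \<longleftrightarrow> Q.gen (A \<union> set a) b))"
proof -
  have la: "length a = n" using P.gen_length[OF a] .
  obtain X where X: "definable C (n + m) A X" "\<And>d. length d = m \<Longrightarrow> X (a @ d) = Y d"
    using definable_abstract[OF Y(1) la] by blast
  have "X (a' @ b') \<longleftrightarrow> Q.gen (A \<union> set a') b'" if g: "P.gen A a'" "Q.gen A b'" for a' b'
  proof -
    obtain b where b: "conjugate C A (a' @ b') (a @ b)" using P.ex_conjugate[OF g(1) a] by blast
    have l: "length a' = n" "length b' = m" using g P.gen_length Q.gen_length by auto
    then have gb: "Q.gen A b" using Q.conjugate_gen[OF conjugate_append(2)[OF b] g(2)] la by simp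
    have "X (a' @ b') \<longleftrightarrow> X (a @ b)" using conjugate_definable[OF b] X(1) l by simp
    also have "\<dots> \<longleftrightarrow> Q.gen (A \<union> set a) b" using X(2) Y(2) gb Q.gen_length by simp
    also have "\<dots> \<longleftrightarrow> Q.gen (A \<union> set a') b'"
      using Q.gen_transfer[OF b _ order_refl] Q.gen_transfer[OF conjugate_sym[OF b] _ order_refl] l la by auto
    finally show ?thesis .
  qed
  then show ?thesis using X(1) by blast
qed

lemma gen_not_lt: "P.gen A a \<Longrightarrow> Q.gen (A \<union> set a) u \<Longrightarrow> Q.gen A d \<Longrightarrow> \<not> Q.gen (A \<union> set a) d \<Longrightarrow> Q.lt d u"
  using Q.lt_if_gen[of "A \<union> set a" d u] by (auto simp: P.small_base)

end

subsection \<open>Products that do not commute\<close>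

locale noncommuting_pair = regular_pair C \<kappa> A n p m q
  for C :: "('f, 'r, 'a) struct" and \<kappa> :: "'k rel" and A :: "'a set"
    and n :: nat and p :: "('f, 'r, 'a) fm set" and m :: nat and q :: "('f, 'r, 'a) fm set" +
  assumes noncommuting: "P.gen A a \<Longrightarrow> Q.gen (A \<union> set a) b \<Longrightarrow> \<not> P.gen (A \<union> set b) a"
begin

lemma swap: "noncommuting_pair C \<kappa> A m q n p"
  by unfold_locales (meson Q.gen_mono noncommuting Un_upper1 P.gen_mono)

text \<open>Otherwise generic points of the first type would be surpassed by elements of the second type in the
  closure of \<open>B \<union> set a\<close>.\<close>

lemma gen_extends:
  assumes B: "A \<subseteq> B" "small \<kappa> B" and a: "\<And>x. P.gen B x \<Longrightarrow> P.gen (B \<union> set a) x" and c: "Q.gen B c"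
  shows "Q.gen (B \<union> set a) c"
proof (rule ccontr)
  assume nc: "\<not> Q.gen (B \<union> set a) c"
  have sB: "small \<kappa> (B \<union> set x)" for x using B(2) by simp
  obtain a0 where a0: "P.gen B a0" using P.gen_exists[OF B(2)] by blast
  obtain c0 where c0: "Q.gen (B \<union> set a0) c0" using Q.gen_exists[OF sB] by blast
  have "conjugate C B c0 c" using Q.gen_conjugate[OF B(2) _ c] Q.gen_mono[OF c0] by blast
  from conjugate_extend[OF this] obtain a1 where a1: "conjugate C B (c0 @ a0) (c @ a1)" by blast
  have lc: "length c0 = length c" using c c0 Q.gen_length by metis
  have a1': "conjugate C B (a0 @ c0) (a1 @ c)" using conjugate_swap[OF a1] lc by blast
  have g1: "P.gen B a1" using P.conjugate_gen[OF conjugate_append(2)[OF a1] a0] lc by blast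
  have gc: "Q.gen (B \<union> set a1) c" using Q.gen_transfer[OF a1' _ B(1) c0] lc by blast
  obtain c2 where c2: "Q.gen (B \<union> set a) c2" using Q.gen_exists[OF sB] by blast
  obtain a2 where a2: "P.gen (B \<union> set a \<union> set c2) a2" using P.gen_exists[OF P.small_set[OF sB]] by blast
  have "conjugate C (B \<union> set a) a1 a2"
    using P.gen_conjugate[OF sB a[OF g1]] P.gen_mono[OF a2] by blast
  \<comment> \<open>By hypothesis \<open>a1\<close> is still generic over \<open>B\<close> and
    \<open>a\<close>, hence conjugate there to \<open>a2\<close>. The image \<open>c1\<close> of
    \<open>c\<close> remains dependent over \<open>B\<close> and \<open>a\<close> but is generic
    over \<open>a2\<close>.\<close>
  from conjugate_extend[OF this] obtain c1 where c1: "conjugate C (B \<union> set a) (a1 @ c) (a2 @ c1)" by blast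
  have la: "length a1 = length a2" using g1 a2 P.gen_length by metis
  have "conjugate C (B \<union> set a) c c1" using conjugate_append(2)[OF c1] la by blast
  then have n1: "\<not> Q.gen (B \<union> set a) c1" using nc Q.conjugate_gen[OF conjugate_sym] by blast
  have "Q.gen (B \<union> set a2) c1"
    by (rule Q.gen_transfer[OF conjugate_mono[OF c1] _ B(1) gc]) (use la in auto)
  then have g2: "Q.gen (A \<union> set a2) c1" using B(1) by (rule Q.gen_mono[OF _ Un_mono]) simp
  have p2: "P.gen A a2" "P.gen (A \<union> set c2) a2" using a2 B(1) by (auto elim: P.gen_mono)
  have q2: "Q.gen A c2" using c2 B(1) by (auto elim: Q.gen_mono)
  \<comment> \<open>Since \<open>a2\<close> is generic over \<open>c2\<close>, the converse fails,
    so \<open>c1\<close> lies above \<open>c2\<close> and inherits its genericity over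
    \<open>B\<close> and \<open>a\<close>.\<close>
  have "\<not> Q.gen (A \<union> set a2) c2" using noncommuting[OF p2(1)] p2(2) by blast
  then have lt: "Q.lt c2 c1" using gen_not_lt[OF p2(1) g2 q2] by blast
  have "Q.gen (B \<union> set a) c1"
    by (rule Q.gen_upward[OF _ sB c2 Q.lt_gen(2)[OF lt] Q.lt_asym[OF lt]]) (use B(1) in blast)
  then show False using n1 by blast
qed

lemma gen_extends_swapped:
  assumes B: "A \<subseteq> B" "small \<kappa> B" and b: "\<And>y. Q.gen B y \<Longrightarrow> Q.gen (B \<union> set b) y" and c: "P.gen B c"
  shows "P.gen (B \<union> set b) c"
proof -
  interpret sw: noncommuting_pair C \<kappa> A m q n p by (rule swap)
  show ?thesis by (rule sw.gen_extends[OF B b c])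
qed

text \<open>Take \<open>l'\<close> below the whole fibre; it lies in the closure of
  \<open>b\<close>. If \<open>a\<close> were generic over \<open>b\<close>, transfer would make it
  generic over \<open>l'\<close>, and then \<open>l'\<close> would belong to the fibre.\<close>

lemma bounded_link_tie:
  assumes X: "bounded_link X" and ab: "P.gen A a" "Q.gen A b" "X (a @ b)"
  shows "\<not> P.gen (A \<union> set b) a"
proof
  assume g: "P.gen (A \<union> set b) a"
  obtain l where l: "Q.gen A l" "\<And>d. Q.gen A d \<Longrightarrow> X (a @ d) \<Longrightarrow> \<not> Q.lt d l"
    using bounded_linkD(3)[OF X ab(1)] by blast
  obtain l' where l': "Q.lt l' l" using Q.ex_below[OF l(1)] by blast
  have gl: "Q.gen A l'" using Q.lt_gen(1)[OF l'] .
  have "Q.lt l' b" using Q.lt_right[OF _ l' ab(2)] l(2)[OF ab(2,3)] by blast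
  then have nl: "\<not> Q.gen (A \<union> set b) l'" using Q.lt_asym ab(2) by (auto simp: Q.lt_def)
  have "P.gen (A \<union> set b \<union> set l') a"
    by (rule gen_extends_swapped[OF _ _ _ g])
      (use Q.gen_closure[of "A \<union> set b" l'] gl nl in \<open>auto simp: P.small_base\<close>)
  then have "P.gen (A \<union> set l') a" by (rule P.gen_mono) blast
  then have "conjugate C A (b @ a) (l' @ a)"
    using regular_pair.product_conjugate[OF regular_pair_axioms[THEN regular_pair.swap]] ab(2) g gl by blast
  then have "conjugate C A (a @ b) (a @ l')" by (rule conjugate_swap) simp
  then have "X (a @ l')"
    using conjugate_definable[of C A "a @ b" "a @ l'" X] bounded_linkD(1)[OF X] ab P.gen_length Q.gen_length
    by simp
  then show False using l(2)[OF gl] l' by blast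
qed

text \<open>By transfer \<open>a'\<close>, generic over \<open>a\<close>, is generic over the
  dependent \<open>b\<close>. Were \<open>b'\<close> not above \<open>b\<close>, it would lie in the
  closure of \<open>b\<close> and \<open>a'\<close> would be generic over \<open>b'\<close> too,
  against \<open>bounded_link_tie\<close>.\<close>

lemma bounded_link_increasing:
  assumes X: "bounded_link X" and lt: "P.lt a a'"
    and b: "Q.gen A b" "Q.gen A b'" "X (a @ b)" "X (a' @ b')"
  shows "Q.lt b b'"
proof (rule ccontr)
  assume n: "\<not> Q.lt b b'"
  have s: "small \<kappa> (A \<union> set x)" for x by (simp add: P.small_base)
  have a: "P.gen A a" "P.gen A a'" "P.gen (A \<union> set a) a'" using lt P.lt_gen[OF lt] by (auto simp: P.lt_def)
  have "P.gen (A \<union> set a \<union> set b) a'"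
    by (rule gen_extends_swapped[OF _ s _ a(3)])
      (use Q.gen_closure[OF _ s b(1) bounded_link_dependent[OF X a(1) b(3)]] in auto)
  then have g: "P.gen (A \<union> set b) a'" by (rule P.gen_mono) blast
  have "\<not> Q.gen (A \<union> set b) b'" using n b(1) by (simp add: Q.lt_def)
  then have "P.gen (A \<union> set b \<union> set b') a'"
    by (intro gen_extends_swapped[OF _ s _ g]) (use Q.gen_closure[OF _ s b(2)] in auto)
  then have "P.gen (A \<union> set b') a'" by (rule P.gen_mono) blast
  then show False using bounded_link_tie[OF X a(2) b(2,4)] by blast
qed

text \<open>If \<open>a\<close> and \<open>b\<close> depended on each other, the conjunction of the
  two open witnesses would have a fibre inside the class of \<open>b\<close>, hence bounded.\<close>

lemma dependent_iff_if_unbounded: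
  assumes unb: "\<not> bounded_type C A n p m q" and ab: "P.gen A a" "Q.gen A b"
  shows "\<not> P.gen (A \<union> set b) a \<longleftrightarrow> Q.gen (A \<union> set a) b"
proof
  show "Q.gen (A \<union> set a) b \<Longrightarrow> \<not> P.gen (A \<union> set b) a" using noncommuting ab(1) by blast
  assume na: "\<not> P.gen (A \<union> set b) a"
  show "Q.gen (A \<union> set a) b"
  proof (rule ccontr)
    assume nb: "\<not> Q.gen (A \<union> set a) b"
    obtain X where X: "definable C (n + m) A X" "X (a @ b)"
      "\<And>d. Q.gen A d \<Longrightarrow> X (a @ d) \<Longrightarrow> \<not> Q.gen (A \<union> set a) d"
      using dependence_open[OF ab nb] ab(1) by blast
    obtain Y where Y: "definable C (m + n) A Y" "Y (b @ a)"
      "\<And>d. Q.gen A d \<Longrightarrow> Y (d @ a) \<Longrightarrow> \<not> P.gen (A \<union> set d) a"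
      using regular_pair.dependence_open[OF regular_pair_axioms[THEN regular_pair.swap] ab(2,1) na] ab(1) by blast
    obtain Z where Z: "definable C (n + m) A Z" "\<And>a b. length a = m \<Longrightarrow> length b = n \<Longrightarrow> Z (b @ a) = Y (a @ b)"
      using definable_swap[OF Y(1)] by blast
    \<comment> \<open>If \<open>a\<close> depends on \<open>d\<close>, it lies in the closure of
      \<open>d\<close>, and by transfer every \<open>d'\<close> above \<open>d\<close> is generic
      over \<open>a\<close>.\<close>
    have tie: "\<not> Q.lt d d'"
      if g: "Q.gen A d" "Q.gen A d'" "\<not> P.gen (A \<union> set d) a" "\<not> Q.gen (A \<union> set a) d'" for d d'
    proof
      assume lt: "Q.lt d d'"
      have s: "small \<kappa> (A \<union> set d)" by (simp add: P.small_base)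
      have "Q.gen (A \<union> set d \<union> set a) d'"
        by (rule gen_extends[OF _ s]) (use lt P.gen_closure[OF _ s ab(1) g(3)] in \<open>auto simp: Q.lt_def\<close>)
      then have "Q.gen (A \<union> set a) d'" by (rule Q.gen_mono) blast
      then show False using g(4) by blast
    qed
    have "bounded_type C A n p m q"
    proof (rule bounded_typeI[OF definable_conj[OF X(1) Z(1)] ab _ ab(2) ab(2)])
      show "X (a @ b) \<and> Z (a @ b)" using X(2) Y(2) Z(2) ab P.gen_length Q.gen_length by simp
      fix d assume d: "Q.gen A d" "X (a @ d) \<and> Z (a @ d)"
      have "\<not> Q.gen (A \<union> set a) d" using X(3) d by blast
      moreover have "\<not> P.gen (A \<union> set d) a" using Y(3) d Z(2) P.gen_length[OF ab(1)] Q.gen_length[OF d(1)] by simp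
      ultimately show "\<not> Q.lt d b \<and> \<not> Q.lt b d" using tie d(1) ab(2) na nb by blast
    qed
    then show False using unb by blast
  qed
qed

text \<open>Dependent pairs are now exactly those with \<open>a\<close> generic over
  \<open>b\<close>. These form one type over \<open>A\<close>, so an open witness at one of them
  holds at all.\<close>

lemma dependence_definable:
  assumes unb: "\<not> bounded_type C A n p m q"
  shows "\<exists>X. definable C (n + m) A X \<and> (\<forall>a b. P.gen A a \<and> Q.gen A b \<longrightarrow> (X (a @ b) \<longleftrightarrow> Q.gen (A \<union> set a) b))"
proof -
  obtain b where b: "Q.gen A b" using Q.gen_exists[OF P.small_base] by blast
  obtain a where a: "P.gen (A \<union> set b) a" using P.gen_exists[of "A \<union> set b"] by (auto simp: P.small_base)
  have ga: "P.gen A a" using a by (rule P.gen_mono) blast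
  have nb: "\<not> Q.gen (A \<union> set a) b" using noncommuting[OF ga] a by blast
  obtain X where X: "definable C (n + m) A X" "X (a @ b)"
    "\<And>a' d. P.gen A a' \<Longrightarrow> Q.gen A d \<Longrightarrow> X (a' @ d) \<Longrightarrow> \<not> Q.gen (A \<union> set a') d"
    using dependence_open[OF ga b nb] by blast
  have "X (a' @ d)" if g: "P.gen A a'" "Q.gen A d" "\<not> Q.gen (A \<union> set a') d" for a' d
  proof -
    have "P.gen (A \<union> set d) a'" using dependent_iff_if_unbounded[OF unb g(1,2)] g(3) by blast
    then have "conjugate C A (b @ a) (d @ a')"
      using regular_pair.product_conjugate[OF regular_pair_axioms[THEN regular_pair.swap]] b a g(2) by blast
    then have "conjugate C A (a @ b) (a' @ d)"
      by (rule conjugate_swap) (use ga g(1) P.gen_length in metis)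
    then show ?thesis using conjugate_definable[of C A "a @ b" "a' @ d" X] X(1,2) ga b P.gen_length Q.gen_length
      by simp
  qed
  then show ?thesis using definable_not[OF X(1)] X(3) by (intro exI[of _ "\<lambda>c. \<not> X c"]) blast
qed

lemma ex_dependent:
  assumes "P.gen A a" shows "\<exists>b. Q.gen A b \<and> \<not> Q.gen (A \<union> set a) b"
proof -
  obtain b0 where b0: "Q.gen A b0" using Q.gen_exists[OF P.small_base] by blast
  obtain a0 where a0: "P.gen (A \<union> set b0) a0" using P.gen_exists[of "A \<union> set b0"] by (auto simp: P.small_base)
  have g0: "P.gen A a0" using a0 by (rule P.gen_mono) blast
  obtain b where b: "conjugate C A (a0 @ b0) (a @ b)" using P.ex_conjugate[OF g0 assms] by blast
  have l: "length a0 = length a" using g0 assms P.gen_length by metis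
  have "Q.gen A b" using Q.conjugate_gen[OF conjugate_append(2)[OF b] b0] l by blast
  moreover have "P.gen (A \<union> set b) a"
    by (rule P.gen_transfer[OF conjugate_swap[OF b] _ order_refl a0]) (use l in blast)+
  ultimately show ?thesis using noncommuting[OF assms] by blast
qed

end

subsection \<open>Products that commute\<close>

locale commuting_pair = regular_pair C \<kappa> A n p m q
  for C :: "('f, 'r, 'a) struct" and \<kappa> :: "'k rel" and A :: "'a set"
    and n :: nat and p :: "('f, 'r, 'a) fm set" and m :: nat and q :: "('f, 'r, 'a) fm set" +
  assumes commuting: "P.gen A a \<Longrightarrow> Q.gen A b \<Longrightarrow> Q.gen (A \<union> set a) b \<longleftrightarrow> P.gen (A \<union> set b) a"
    and nonorthogonal: "\<exists>a b. P.gen A a \<and> Q.gen A b \<and> \<not> Q.gen (A \<union> set a) b"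
begin

lemma swap: "commuting_pair C \<kappa> A m q n p"
  by unfold_locales (use commuting nonorthogonal in blast)+

lemma ex_dependent:
  assumes "P.gen A a" shows "\<exists>b. Q.gen A b \<and> \<not> Q.gen (A \<union> set a) b"
proof -
  obtain a0 b0 where 0: "P.gen A a0" "Q.gen A b0" "\<not> Q.gen (A \<union> set a0) b0" using nonorthogonal by blast
  obtain b where b: "conjugate C A (a0 @ b0) (a @ b)" using P.ex_conjugate[OF 0(1) assms] by blast
  have l: "length a0 = length a" using 0(1) assms P.gen_length by metis
  have "Q.gen A b" using Q.conjugate_gen[OF conjugate_append(2)[OF b] 0(2)] l by blast
  moreover have "\<not> Q.gen (A \<union> set a) b" using Q.gen_transfer[OF conjugate_sym[OF b] _ order_refl] l 0(3) by metis
  ultimately show ?thesis by blast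
qed

text \<open>If \<open>y\<close> disturbed \<open>c\<close> but no realization of \<open>p\<close>,
  every \<open>a\<close> would be conjugate over \<open>y\<close> to \<open>a0\<close> and so depend
  on some \<open>d'\<close> above \<open>c\<close>, hence on \<open>c\<close>. But some
  \<open>a\<close> is generic over \<open>c\<close>.\<close>

lemma gen_extends_base:
  assumes y: "\<And>x. P.gen A x \<Longrightarrow> P.gen (A \<union> set y) x" and c: "Q.gen A c"
  shows "Q.gen (A \<union> set y) c"
proof (rule ccontr)
  assume n: "\<not> Q.gen (A \<union> set y) c"
  have s: "small \<kappa> (A \<union> set y)" by (simp add: P.small_base)
  obtain d where d: "Q.gen (A \<union> set y) d" using Q.gen_exists[OF s] by blast
  have gd: "Q.gen A d" using d by (rule Q.gen_mono) blast
  obtain a0 where a0: "P.gen A a0" "\<not> P.gen (A \<union> set d) a0"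
    using commuting_pair.ex_dependent[OF swap gd] by blast
  have "\<not> P.gen (A \<union> set c) a" if a: "P.gen A a" for a
  proof -
    have "conjugate C (A \<union> set y) a0 a" using P.gen_conjugate[OF s] y a a0(1) by blast
    from conjugate_extend[OF this] obtain d' where d': "conjugate C (A \<union> set y) (a0 @ d) (a @ d')" by blast
    have l: "length a0 = length a" using a a0(1) P.gen_length by metis
    have "Q.gen (A \<union> set y) d'" using Q.conjugate_gen[OF conjugate_append(2)[OF d'] d] l by blast
    then have lt: "Q.lt c d'" using Q.lt_if_gen[OF _ s c n] by blast
    have "conjugate C A (d' @ a) (d @ a0)"
      using conjugate_mono[OF conjugate_sym[OF conjugate_swap[OF d']], of A] l by blast
    from P.gen_transfer[OF this _ order_refl] have "\<not> P.gen (A \<union> set d') a" using a0(2) l by metis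
    then have "\<not> Q.gen (A \<union> set a) d'" using commuting[OF a Q.lt_gen(2)[OF lt]] by blast
    then have "\<not> Q.gen (A \<union> set a) c"
      using Q.gen_upward[of "A \<union> set a" c d'] lt Q.lt_asym Q.lt_gen(2)[OF lt] by (auto simp: P.small_base)
    then show ?thesis using commuting[OF a c] by blast
  qed
  moreover obtain a where a: "P.gen (A \<union> set c) a" using P.gen_exists[of "A \<union> set c"] by (auto simp: P.small_base)
  moreover have "P.gen A a" using a by (rule P.gen_mono) blast
  ultimately show False by blast
qed

text \<open>Replace \<open>a'\<close> by a conjugate over \<open>a\<close> that is generic over the
  lower bound \<open>l\<close> as well. By symmetry \<open>l\<close> is generic over it, so its
  fibre lies below \<open>l\<close> and thus below the fibre at \<open>a\<close>.\<close>

lemma bounded_link_decreasing: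
  assumes X: "bounded_link X" and lt: "P.lt a a'"
    and b: "Q.gen A b" "Q.gen A b'" "X (a @ b)" "X (a' @ b')"
  shows "Q.lt b' b"
proof -
  have ga: "P.gen A a" "P.gen A a'" "P.gen (A \<union> set a) a'" using lt P.lt_gen[OF lt] by (auto simp: P.lt_def)
  have s: "small \<kappa> (A \<union> set a)" by (simp add: P.small_base)
  obtain l where l: "Q.gen A l" "\<And>d. Q.gen A d \<Longrightarrow> X (a @ d) \<Longrightarrow> \<not> Q.lt d l"
    using bounded_linkD(3)[OF X ga(1)] by blast
  obtain a2 where a2: "P.gen (A \<union> set a \<union> set l) a2" using P.gen_exists[OF P.small_set[OF s]] by blast
  then have g2: "P.gen A a2" "P.gen (A \<union> set a) a2" "P.gen (A \<union> set l) a2" by (auto elim: P.gen_mono)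
  obtain \<sigma> where \<sigma>: "automorphism C \<sigma>" "\<forall>x\<in>A \<union> set a. \<sigma> x = x" "map \<sigma> a' = a2"
    using P.gen_conjugate[OF s ga(3) g2(2)] by (auto simp: conjugate_def)
  have cj: "conjugate C A x (map \<sigma> x)" for x using \<sigma>(1,2) by (auto simp: conjugate_def)
  have sa: "map \<sigma> a = a" using \<sigma>(2) by (auto intro: map_idI)
  let ?b = "map \<sigma> b" and ?b' = "map \<sigma> b'"
  have gb: "Q.gen A ?b" "Q.gen A ?b'" using Q.conjugate_gen[OF cj] b by blast+
  have len: "length a = n" "length a' = n" "length b = m" "length b' = m"
    using ga b P.gen_length Q.gen_length by auto
  have Xs: "X (a @ ?b)" "X (a2 @ ?b')"
    using conjugate_definable[OF cj[of "a @ b"], of X] conjugate_definable[OF cj[of "a' @ b'"], of X]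
      bounded_linkD(1)[OF X] b len sa \<sigma>(3) by auto
  have "Q.gen (A \<union> set a2) l" using commuting[OF g2(1) l(1)] g2(3) by blast
  then have "Q.lt ?b' l"
    using gen_not_lt[OF g2(1) _ gb(2) bounded_link_dependent[OF X g2(1) Xs(2)]] by blast
  then have "Q.lt ?b' ?b" using Q.lt_right[OF l(2)[OF gb(1) Xs(1)] _ gb(1)] by blast
  then show ?thesis
    using Q.lt_transfer[of ?b' ?b b' b] conjugate_sym[OF cj[of "b' @ b"]] by simp
qed

text \<open>Dependent elements lie below any \<open>u\<close> generic over \<open>a\<close>. If no
  conjugate of \<open>b\<close> went below \<open>l\<close>, compactness would yield a formula whose
  fibre is bounded by \<open>l\<close> and \<open>u\<close>.\<close>

lemma coinitial_conjugates:
  assumes unb: "\<not> bounded_type C A n p m q"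
    and ab: "P.gen A a" "Q.gen A b" "\<not> Q.gen (A \<union> set a) b" and l: "Q.gen A l"
  shows "\<exists>b'. conjugate C (A \<union> set a) b b' \<and> Q.lt b' l"
proof -
  obtain c where c: "Q.lt c l" using Q.ex_below[OF l] by blast
  have s: "small \<kappa> (A \<union> set x)" for x by (simp add: P.small_base)
  have len: "length a = n" "length b = m" "length c = m"
    using ab Q.lt_gen(1)[OF c] P.gen_length Q.gen_length by auto
  \<comment> \<open>Being below \<open>l\<close> is a complete type over it, namely that of
    \<open>c\<close>, so it can enter a compactness argument.\<close>
  have cl: "conjugate C (A \<union> set l) c d" if "Q.lt d l" for d
    by (rule conjugate_cancel_right[OF Q.lt_conjugate[OF c that]])
      (use len Q.gen_length[OF Q.lt_gen(1)[OF that]] in simp)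
  obtain X0 where X0: "definable C (n + m) A X0" "X0 (a @ b)"
    "\<And>d. Q.gen A d \<Longrightarrow> X0 (a @ d) \<Longrightarrow> \<not> Q.gen (A \<union> set a) d"
    using dependence_open[OF ab] ab(1) by blast
  obtain u where u: "Q.gen (A \<union> set a) u" using Q.gen_exists[OF s] by blast
  have gu: "Q.gen A u" using u by (rule Q.gen_mono) blast
  have "\<exists>d. length d = m \<and> X d \<and> Y d"
    if XY: "definable C m (A \<union> set a) X" "X b" "definable C m (A \<union> set l) Y" "Y c" for X Y
  proof (rule ccontr)
    assume none: "\<not> (\<exists>d. length d = m \<and> X d \<and> Y d)"
    obtain X' where X': "definable C (n + m) A X'" "\<And>d. length d = m \<Longrightarrow> X' (a @ d) = X d"
      using definable_abstract[OF XY(1) len(1)] by blast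
    have "bounded_type C A n p m q"
    proof (rule bounded_typeI[OF definable_conj[OF X0(1) X'(1)] ab(1,2) _ l gu])
      show "X0 (a @ b) \<and> X' (a @ b)" using X0(2) X'(2) XY(2) len by simp
      fix d assume d: "Q.gen A d" "X0 (a @ d) \<and> X' (a @ d)"
      have ld: "length d = m" using Q.gen_length[OF d(1)] .
      have "Y d" if "Q.lt d l" using conjugate_definable[OF cl[OF that], of Y] XY(3,4) len by simp
      then have "\<not> Q.lt d l" using none X'(2)[OF ld] d(2) ld by blast
      moreover have "Q.lt d u" using gen_not_lt[OF ab(1) u d(1)] X0(3) d by blast
      ultimately show "\<not> Q.lt d l \<and> \<not> Q.lt u d" using Q.lt_asym by blast
    qed
    then show False using unb by blast
  qed
  then obtain d where d: "conjugate C (A \<union> set a) b d" "conjugate C (A \<union> set l) c d"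
    using P.realize_both[OF s s len(2,3)] by blast
  have "Q.lt d l"
    by (rule Q.lt_transfer[OF c conjugate_over_right[OF d(2)]]) simp
  then show ?thesis using d(1) by blast
qed

text \<open>Moving a conjugate of \<open>b\<close> below \<open>l\<close> back to \<open>b\<close>
  moves \<open>l\<close> above \<open>b\<close>.\<close>

lemma cofinal_conjugates:
  assumes unb: "\<not> bounded_type C A n p m q"
    and ab: "P.gen A a" "Q.gen A b" "\<not> Q.gen (A \<union> set a) b" and l: "Q.gen A l"
  shows "\<exists>l'. conjugate C (A \<union> set a) l l' \<and> Q.lt b l'"
proof -
  obtain b' where b': "conjugate C (A \<union> set a) b b'" "Q.lt b' l"
    using coinitial_conjugates[OF assms] by blast
  obtain l' where l': "conjugate C (A \<union> set a) (b' @ l) (b @ l')"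
    using conjugate_extend[OF conjugate_sym[OF b'(1)]] by blast
  have "length b' = length b" using conjugate_length[OF b'(1)] by simp
  then have "conjugate C (A \<union> set a) l l'" "Q.lt b l'"
    using conjugate_append(2)[OF l'] Q.lt_transfer[OF b'(2) conjugate_mono[OF l', of A]] by auto
  then show ?thesis by blast
qed

text \<open>If every formula of the generic type over \<open>a\<close> had a dependent solution,
  compactness would give a generic element below a dependent \<open>b0\<close>; but generic elements
  are closed upwards.\<close>

lemma dependence_definable:
  assumes unb: "\<not> bounded_type C A n p m q"
  shows "\<exists>X. definable C (n + m) A X \<and> (\<forall>a b. P.gen A a \<and> Q.gen A b \<longrightarrow> (X (a @ b) \<longleftrightarrow> Q.gen (A \<union> set a) b))"
proof -
  obtain a where a: "P.gen A a" using P.gen_exists[OF P.small_base] by blast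
  obtain b0 where b0: "Q.gen A b0" "\<not> Q.gen (A \<union> set a) b0" using ex_dependent[OF a] by blast
  have s: "small \<kappa> (A \<union> set x)" for x by (simp add: P.small_base)
  obtain c1 where c1: "Q.gen (A \<union> set a) c1" using Q.gen_exists[OF s] by blast
  obtain c where c: "Q.lt c b0" using Q.ex_below[OF b0(1)] by blast
  have len: "length c1 = m" "length c = m" using c1 Q.lt_gen(1)[OF c] Q.gen_length by auto
  have "\<exists>Y. definable C m (A \<union> set a) Y \<and> Y c1 \<and> (\<forall>b. Q.gen A b \<and> Y b \<longrightarrow> Q.gen (A \<union> set a) b)"
  proof (rule ccontr)
    assume none: "\<not> ?thesis"
    have "\<exists>d. length d = m \<and> X d \<and> Y d"
      if XY: "definable C m (A \<union> set a) X" "X c1" "definable C m (A \<union> set b0) Y" "Y c" for X Y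
    proof -
      obtain b where b: "Q.gen A b" "X b" "\<not> Q.gen (A \<union> set a) b" using none XY(1,2) by blast
      obtain b1 where b1: "conjugate C (A \<union> set a) b0 b1" "Q.lt b b1"
        using cofinal_conjugates[OF unb a b(1,3) b0(1)] by blast
      \<comment> \<open>Returning \<open>b1\<close> to \<open>b0\<close> over \<open>a\<close> moves
        the dependent solution \<open>b\<close> below \<open>b0\<close> and keeps
        \<open>X\<close>.\<close>
      obtain d where d: "conjugate C (A \<union> set a) (b1 @ b) (b0 @ d)"
        using conjugate_extend[OF conjugate_sym[OF b1(1)]] by blast
      have l: "length b1 = length b0" "length b = m"
        using conjugate_length[OF b1(1)] Q.gen_length[OF b(1)] by auto
      have "conjugate C A (b @ b1) (d @ b0)"
        using conjugate_mono[OF conjugate_swap[OF d], of A] l by blast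
      from Q.lt_transfer[OF b1(2) this] have lt: "Q.lt d b0" using l by blast
      have ld: "length d = m" using Q.gen_length[OF Q.lt_gen(1)[OF lt]] .
      have "X d" using conjugate_definable[OF conjugate_append(2)[OF d], of X] XY(1) b(2) l by simp
      moreover have "conjugate C (A \<union> set b0) c d"
        by (rule conjugate_cancel_right[OF Q.lt_conjugate[OF c lt]]) (simp add: len ld)
      then have "Y d" using conjugate_definable[of C "A \<union> set b0" c d Y] XY(3,4) len by simp
      ultimately show ?thesis using ld by blast
    qed
    then obtain d where d: "conjugate C (A \<union> set a) c1 d" "conjugate C (A \<union> set b0) c d"
      using P.realize_both[OF s s len] by blast
    have lt: "Q.lt d b0" by (rule Q.lt_transfer[OF c conjugate_over_right[OF d(2)]]) simp
    have "Q.gen (A \<union> set a) b0"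
      by (rule Q.gen_upward[OF _ s Q.conjugate_gen[OF d(1) c1] b0(1) Q.lt_asym[OF lt]]) blast
    then show False using b0(2) by blast
  qed
  then obtain Y where Y: "definable C m (A \<union> set a) Y" "Y c1" "\<And>b. Q.gen A b \<Longrightarrow> Y b \<Longrightarrow> Q.gen (A \<union> set a) b" by blast
  have "Y b" if "Q.gen (A \<union> set a) b" for b
    using conjugate_definable[OF Q.gen_conjugate[OF s c1 that], of Y] Y(1,2) len by simp
  then show ?thesis using dependence_definable_everywhere[OF a Y(1)] Y(3) by blast
qed

end

subsection \<open>Unbounded non-orthogonality\<close>

text \<open>What the two unbounded cases share. The alternatives in \<open>aligned\<close> are the
  noncommuting and the commuting case; each is symmetric in the two types, so the roles can be
  exchanged.\<close>

locale aligned_pair = regular_pair C \<kappa> A n p m q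
  for C :: "('f, 'r, 'a) struct" and \<kappa> :: "'k rel" and A :: "'a set"
    and n :: nat and p :: "('f, 'r, 'a) fm set" and m :: nat and q :: "('f, 'r, 'a) fm set" +
  assumes aligned:
      "(\<forall>a b. P.gen A a \<and> Q.gen A b \<longrightarrow> (\<not> P.gen (A \<union> set b) a \<longleftrightarrow> Q.gen (A \<union> set a) b)) \<or>
       (\<forall>a b. P.gen A a \<and> Q.gen A b \<longrightarrow> (\<not> P.gen (A \<union> set b) a \<longleftrightarrow> \<not> Q.gen (A \<union> set a) b))"
    and dependence_definable: "\<exists>X. definable C (n + m) A X \<and>
      (\<forall>a b. P.gen A a \<and> Q.gen A b \<longrightarrow> (X (a @ b) \<longleftrightarrow> \<not> P.gen (A \<union> set b) a))"
    and ex_dependent: "P.gen A a \<Longrightarrow> \<exists>b. Q.gen A b \<and> \<not> Q.gen (A \<union> set a) b"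
      "Q.gen A b \<Longrightarrow> \<exists>a. P.gen A a \<and> \<not> P.gen (A \<union> set b) a"
    and gen_extends: "(\<And>x. P.gen A x \<Longrightarrow> P.gen (A \<union> set y) x) \<Longrightarrow> Q.gen A b \<Longrightarrow> Q.gen (A \<union> set y) b"
      "(\<And>x. Q.gen A x \<Longrightarrow> Q.gen (A \<union> set y) x) \<Longrightarrow> P.gen A a \<Longrightarrow> P.gen (A \<union> set y) a"
begin

lemma swap: "aligned_pair C \<kappa> A m q n p"
proof unfold_locales
  obtain X where X: "definable C (n + m) A X"
    "\<And>a b. P.gen A a \<Longrightarrow> Q.gen A b \<Longrightarrow> X (a @ b) \<longleftrightarrow> \<not> P.gen (A \<union> set b) a"
    using dependence_definable by blast
  obtain Y where Y: "definable C (m + n) A Y" "\<And>a b. length a = n \<Longrightarrow> length b = m \<Longrightarrow> Y (b @ a) = X (a @ b)"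
    using definable_swap[OF X(1)] by blast
  have YX: "Y (b @ a) \<longleftrightarrow> \<not> P.gen (A \<union> set b) a" if "P.gen A a" "Q.gen A b" for a b
    using X(2) Y(2) that P.gen_length Q.gen_length by simp
  show "\<exists>X. definable C (m + n) A X \<and>
      (\<forall>b a. Q.gen A b \<and> P.gen A a \<longrightarrow> (X (b @ a) \<longleftrightarrow> \<not> Q.gen (A \<union> set a) b))"
    using aligned
  proof
    assume "\<forall>a b. P.gen A a \<and> Q.gen A b \<longrightarrow> (\<not> P.gen (A \<union> set b) a \<longleftrightarrow> Q.gen (A \<union> set a) b)"
    then show ?thesis using YX definable_not[OF Y(1)] by (intro exI[of _ "\<lambda>c. \<not> Y c"]) blast
  next
    assume "\<forall>a b. P.gen A a \<and> Q.gen A b \<longrightarrow> (\<not> P.gen (A \<union> set b) a \<longleftrightarrow> \<not> Q.gen (A \<union> set a) b)"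
    then show ?thesis using YX Y(1) by (intro exI[of _ Y]) blast
  qed
  show "(\<forall>b a. Q.gen A b \<and> P.gen A a \<longrightarrow> (\<not> Q.gen (A \<union> set a) b \<longleftrightarrow> P.gen (A \<union> set b) a)) \<or>
      (\<forall>b a. Q.gen A b \<and> P.gen A a \<longrightarrow> (\<not> Q.gen (A \<union> set a) b \<longleftrightarrow> \<not> P.gen (A \<union> set b) a))"
    using aligned by blast
qed (use ex_dependent gen_extends in blast)+

lemma left_upward:
  assumes "P.gen (A \<union> set b) a" "P.gen A a'" "\<not> P.lt a' a" shows "P.gen (A \<union> set b) a'"
  by (rule P.gen_upward[OF _ _ assms]) (simp_all add: P.small_base)

lemma right_upward:
  assumes "Q.gen (A \<union> set a) b" "Q.gen A b'" "\<not> Q.lt b' b" shows "Q.gen (A \<union> set a) b'"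
  by (rule Q.gen_upward[OF _ _ assms]) (simp_all add: P.small_base)

text \<open>Choose \<open>b0\<close> on which \<open>a\<close> depends and \<open>a2\<close> generic
  over \<open>a\<close> and \<open>b0\<close>. Then \<open>a2\<close> is conjugate to
  \<open>a'\<close> over \<open>a\<close>, and the image of \<open>b0\<close> separates
  \<open>a\<close> from \<open>a'\<close>.\<close>

lemma ex_between:
  assumes lt: "P.lt a a'"
  shows "\<exists>b. Q.gen A b \<and> \<not> P.gen (A \<union> set b) a \<and> P.gen (A \<union> set b) a'"
proof -
  have a: "P.gen A a" using P.lt_gen[OF lt] by blast
  have s: "small \<kappa> (A \<union> set x)" for x by (simp add: P.small_base)
  obtain b0 where b0: "Q.gen A b0" "\<not> P.gen (A \<union> set b0) a"
    using aligned
  proof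
    assume al: "\<forall>a b. P.gen A a \<and> Q.gen A b \<longrightarrow> (\<not> P.gen (A \<union> set b) a \<longleftrightarrow> Q.gen (A \<union> set a) b)"
    obtain b where "Q.gen (A \<union> set a) b" using Q.gen_exists[OF s] by blast
    moreover from this have "Q.gen A b" by (rule Q.gen_mono) blast
    ultimately show ?thesis using al a that by blast
  qed (use ex_dependent(1)[OF a] a that in blast)
  obtain a2 where a2: "P.gen (A \<union> set a \<union> set b0) a2" using P.gen_exists[OF P.small_set[OF s]] by blast
  then have g2: "P.gen (A \<union> set a) a2" "P.gen (A \<union> set b0) a2" by (auto elim: P.gen_mono)
  have lt2: "P.lt a a2" using a g2(1) by (simp add: P.lt_def)
  have "conjugate C (A \<union> set a) a2 a'" using P.gen_conjugate[OF s g2(1)] lt by (simp add: P.lt_def)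
  from conjugate_extend[OF this] obtain b where b: "conjugate C (A \<union> set a) (a2 @ b0) (a' @ b)" by blast
  have l: "length a2 = length a'" using P.lt_gen(2)[OF lt] P.lt_gen(2)[OF lt2] P.gen_length by metis
  have cb: "conjugate C (A \<union> set a) b0 b" using conjugate_append(2)[OF b] l by blast
  have "Q.gen A b" using Q.conjugate_gen[OF conjugate_mono[OF cb]] b0(1) by blast
  moreover have "P.gen (A \<union> set b) a'"
    by (rule P.gen_transfer[OF conjugate_mono[OF conjugate_swap[OF b]] _ order_refl g2(2)]) (use l in auto)
  moreover have "\<not> P.gen (A \<union> set b) a"
    using P.gen_transfer[OF conjugate_over_right[OF conjugate_sym[OF cb]] _ order_refl] b0(2) by blast
  ultimately show ?thesis by blast
qed

text \<open>Strong regularity of the second type lets the existential quantifier over its realizations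
  range over a formula instead: solutions of that formula that do not realize the type are
  not noticed by the first type.\<close>

lemma lt_definable:
  assumes "strongly_regular C \<kappa> A m q"
  shows "\<exists>Z. definable C (n + n) A Z \<and> (\<forall>a a'. P.gen A a \<and> P.gen A a' \<longrightarrow> (Z (a @ a') \<longleftrightarrow> P.lt a a'))"
proof -
  obtain Y where Y: "definable C m A Y" "\<And>b. Q.gen A b \<Longrightarrow> Y b"
    "\<And>y c. length y = m \<Longrightarrow> Y y \<Longrightarrow> \<not> Q.gen A y \<Longrightarrow> Q.gen A c \<Longrightarrow> Q.gen (A \<union> set y) c"
    using Q.strongly_regular_definable[OF assms] by blast
  obtain X where X: "definable C (n + m) A X"
    "\<And>a b. P.gen A a \<Longrightarrow> Q.gen A b \<Longrightarrow> X (a @ b) \<longleftrightarrow> \<not> P.gen (A \<union> set b) a"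
    using dependence_definable by blast
  \<comment> \<open>In a tuple \<open>a @ a' @ y\<close> this skips the middle block, so
    \<open>?X1\<close> reads \<open>a @ y\<close> while \<open>?X2\<close> reads
    \<open>a' @ y\<close>.\<close>
  let ?f = "\<lambda>i. if i < n then i else n + i"
  let ?X1 = "\<lambda>c. X (map (\<lambda>i. c ! ?f i) [0..<n + m])"
  let ?X2 = "\<lambda>c. X (map (\<lambda>i. c ! (n + i)) [0..<n + m])"
  let ?Y = "\<lambda>c. Y (map (\<lambda>i. c ! (n + n + i)) [0..<m])"
  let ?Z = "\<lambda>c. ?Y c \<and> ?X1 c \<and> \<not> ?X2 c"
  have "definable C (n + n + m) A ?Z"
    by (intro definable_conj definable_not definable_reindex X(1) Y(1)) auto
  then have def: "definable C (n + n) A (\<lambda>c. \<exists>y. length y = m \<and> ?Z (c @ y))" by (rule definable_ex)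
  have Z: "?Z ((a @ a') @ y) \<longleftrightarrow> Y y \<and> X (a @ y) \<and> \<not> X (a' @ y)"
    if "length a = n" "length a' = n" "length y = m" for a a' y
  proof -
    have "map (\<lambda>i. ((a @ a') @ y) ! ?f i) [0..<n + m] = a @ y"
      "map (\<lambda>i. ((a @ a') @ y) ! (n + i)) [0..<n + m] = a' @ y"
      "map (\<lambda>i. ((a @ a') @ y) ! (n + n + i)) [0..<m] = y"
      by (rule nth_equalityI; use that in \<open>auto simp: nth_append\<close>)+
    then show ?thesis by simp
  qed
  have "(\<exists>y. length y = m \<and> ?Z ((a @ a') @ y)) \<longleftrightarrow> P.lt a a'" if g: "P.gen A a" "P.gen A a'" for a a'
  proof
    assume "\<exists>y. length y = m \<and> ?Z ((a @ a') @ y)"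
    then obtain y where y: "length y = m" "Y y" "X (a @ y)" "\<not> X (a' @ y)"
      using Z g P.gen_length by blast
    have "Q.gen A y"
    proof (rule ccontr)
      assume n: "\<not> Q.gen A y"
      have *: "P.gen (A \<union> set y) c" if "P.gen A c" for c
        using gen_extends(2)[OF Y(3)[OF y(1,2) n] that] by blast
      \<comment> \<open>Both tuples are generic over \<open>y\<close>, so they have the same type
        over it and \<open>X\<close> cannot separate them.\<close>
      have "conjugate C A (a @ y) (a' @ y)"
        by (rule conjugate_over_right[OF P.gen_conjugate[OF _ *[OF g(1)] *[OF g(2)]]]) (simp add: P.small_base)
      then show False using conjugate_definable[of C A "a @ y" "a' @ y" X] X(1) y g P.gen_length by simp
    qed
    then have "\<not> P.gen (A \<union> set y) a" "P.gen (A \<union> set y) a'" using X(2) g y(3,4) by blast+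
    then show "P.lt a a'" using P.lt_if_gen[OF _ _ g(1), of "A \<union> set y"] by (auto simp: P.small_base)
  next
    assume "P.lt a a'"
    from ex_between[OF this] obtain b where
      b: "Q.gen A b" "\<not> P.gen (A \<union> set b) a" "P.gen (A \<union> set b) a'" by blast
    then show "\<exists>y. length y = m \<and> ?Z ((a @ a') @ y)"
      using Z X(2)[OF g(1) b(1)] X(2)[OF g(2) b(1)] Y(2)[OF b(1)] g P.gen_length Q.gen_length[OF b(1)] by blast
  qed
  then show ?thesis using def by blast
qed

lemma simple_left: "strongly_regular C \<kappa> A m q \<Longrightarrow> simple C A n p"
  using lt_definable P.simpleI by blast

text \<open>The elements separating \<open>a\<close> from \<open>a'\<close> solve a formula over
  \<open>M\<close>. Each is generic over one of the two and dependent on the other, which bounds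
  them on both sides.\<close>

lemma between_in_model:
  assumes M: "elementary_substructure C M" "small \<kappa> M" "A \<subseteq> M"
    and lt: "P.lt a a'" and sub: "set a \<subseteq> M" "set a' \<subseteq> M"
  shows "\<exists>b. Q.gen A b \<and> set b \<subseteq> M \<and> \<not> P.gen (A \<union> set b) a \<and> P.gen (A \<union> set b) a'"
proof -
  have g: "P.gen A a" "P.gen A a'" using P.lt_gen[OF lt] by auto
  obtain X where X: "definable C (n + m) A X"
    "\<And>a b. P.gen A a \<Longrightarrow> Q.gen A b \<Longrightarrow> X (a @ b) \<longleftrightarrow> \<not> P.gen (A \<union> set b) a"
    using dependence_definable by blast
  have "definable C m M (\<lambda>d. X (c @ d))" if "P.gen A c" "set c \<subseteq> M" for c
    by (rule definable_mono[OF definable_instance_left[OF X(1) P.gen_length[OF that(1)]]])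
      (use M(3) that(2) in blast)
  then have def: "definable C m M (\<lambda>d. X (a @ d) \<and> \<not> X (a' @ d))"
    using g sub by (intro definable_conj definable_not)
  obtain b where b: "Q.gen A b" "\<not> P.gen (A \<union> set b) a" "P.gen (A \<union> set b) a'"
    using ex_between[OF lt] by blast
  have bounds: "\<exists>l u. Q.gen A l \<and> Q.gen A u \<and>
      (\<forall>d. Q.gen A d \<and> Q.gen (A \<union> set c) d \<and> \<not> Q.gen (A \<union> set c') d \<longrightarrow> \<not> Q.lt d l \<and> \<not> Q.lt u d)"
    if c: "P.gen A c" "P.gen A c'" for c c'
  proof -
    obtain l where l: "Q.gen A l" "\<not> Q.gen (A \<union> set c) l" using ex_dependent(1)[OF c(1)] by blast
    obtain u where u: "Q.gen (A \<union> set c') u" using Q.gen_exists[of "A \<union> set c'"] by (auto simp: P.small_base)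
    have gu: "Q.gen A u" using u by (rule Q.gen_mono) blast
    have "\<not> Q.lt d l \<and> \<not> Q.lt u d"
      if d: "Q.gen A d" "Q.gen (A \<union> set c) d" "\<not> Q.gen (A \<union> set c') d" for d
      using right_upward[OF u d(1)] d(3) right_upward[OF d(2) l(1)] l(2) Q.lt_asym[of d l] Q.lt_asym[of u d]
      by argo
    then show ?thesis using l(1) gu by blast
  qed
  obtain l u where lu: "Q.gen A l" "Q.gen A u"
    "\<And>d. Q.gen A d \<Longrightarrow> X (a @ d) \<and> \<not> X (a' @ d) \<Longrightarrow> \<not> Q.lt d l \<and> \<not> Q.lt u d"
    using aligned
  proof
    assume al: "\<forall>a b. P.gen A a \<and> Q.gen A b \<longrightarrow> (\<not> P.gen (A \<union> set b) a \<longleftrightarrow> Q.gen (A \<union> set a) b)"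
    obtain l u where lu: "Q.gen A l" "Q.gen A u" "\<And>d. Q.gen A d \<Longrightarrow> Q.gen (A \<union> set a) d \<Longrightarrow>
        \<not> Q.gen (A \<union> set a') d \<Longrightarrow> \<not> Q.lt d l \<and> \<not> Q.lt u d"
      using bounds[OF g] by blast
    show ?thesis by (rule that[OF lu(1,2)]) (use al X(2) g lu(3) in blast)
  next
    assume al: "\<forall>a b. P.gen A a \<and> Q.gen A b \<longrightarrow> (\<not> P.gen (A \<union> set b) a \<longleftrightarrow> \<not> Q.gen (A \<union> set a) b)"
    obtain l u where lu: "Q.gen A l" "Q.gen A u" "\<And>d. Q.gen A d \<Longrightarrow> Q.gen (A \<union> set a') d \<Longrightarrow>
        \<not> Q.gen (A \<union> set a) d \<Longrightarrow> \<not> Q.lt d l \<and> \<not> Q.lt u d"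
      using bounds[OF g(2,1)] by blast
    show ?thesis by (rule that[OF lu(1,2)]) (use al X(2) g lu(3) in blast)
  qed
  have "X (a @ b) \<and> \<not> X (a' @ b)" using X(2) g b by blast
  from Q.bounded_in_model[OF M def b(1) this lu] show ?thesis using X(2) g by blast
qed

text \<open>All Morley pairs are conjugate and one of them has an element in between; definability
  of the order then brings such an element into \<open>M\<close>.\<close>

lemma dense_in_model:
  assumes sr: "strongly_regular C \<kappa> A m q"
    and M: "elementary_substructure C M" "small \<kappa> M" "A \<subseteq> M"
    and lt: "P.lt a a'" and sub: "set a \<subseteq> M" "set a' \<subseteq> M"
  shows "\<exists>c. set c \<subseteq> M \<and> P.lt a c \<and> P.lt c a'"
proof -
  have g: "P.gen A a" "P.gen A a'" using P.lt_gen[OF lt] by auto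
  have len: "length a = n" "length a' = n" using g P.gen_length by auto
  obtain Z where Z: "definable C (n + n) A Z" "\<And>a a'. P.gen A a \<Longrightarrow> P.gen A a' \<Longrightarrow> Z (a @ a') \<longleftrightarrow> P.lt a a'"
    using lt_definable[OF sr] by blast
  obtain c where c: "P.lt a c" using P.ex_above[OF g(1)] by blast
  obtain d where d: "P.lt c d" using P.ex_above P.lt_gen(2)[OF c] by blast
  have ld: "length d = n" "length c = n" using P.lt_gen[OF d] P.gen_length by auto
  obtain \<sigma> where \<sigma>: "automorphism C \<sigma>" "\<forall>x\<in>A. \<sigma> x = x" "map \<sigma> a = a" "map \<sigma> d = a'"
    using P.lt_conjugate[OF P.lt_trans[OF c d] lt] len ld by (auto simp: conjugate_def)
  have cj: "conjugate C A x (map \<sigma> x)" for x using \<sigma>(1,2) by (auto simp: conjugate_def)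
  have between: "P.lt a (map \<sigma> c)" "P.lt (map \<sigma> c) a'"
    using P.lt_transfer[OF c, of a "map \<sigma> c"] P.lt_transfer[OF d, of "map \<sigma> c" a'] cj[of "a @ c"] cj[of "c @ d"] \<sigma>
    by auto
  have "definable C n M (\<lambda>x. Z (a @ x))"
    by (rule definable_mono[OF definable_instance_left[OF Z(1) len(1)]]) (use M(3) sub in blast)
  moreover have "definable C n M (\<lambda>x. Z (x @ a'))"
    by (rule definable_mono[OF definable_instance_right[OF Z(1) len(2)]]) (use M(3) sub in blast)
  ultimately have def: "definable C n M (\<lambda>x. Z (a @ x) \<and> Z (x @ a'))" by (rule definable_conj)
  have "\<exists>x. P.gen A x \<and> (Z (a @ x) \<and> Z (x @ a')) \<and> set x \<subseteq> M"
  proof (rule P.bounded_in_model[OF M def])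
    show "P.gen A (map \<sigma> c)" using P.lt_gen(2)[OF between(1)] .
    then show "Z (a @ map \<sigma> c) \<and> Z (map \<sigma> c @ a')" using Z(2) g between by blast
    show "\<not> P.lt x a \<and> \<not> P.lt a' x" if "P.gen A x" "Z (a @ x) \<and> Z (x @ a')" for x
      using that Z(2) g P.lt_asym by blast
  qed (rule g)+
  then show ?thesis using Z(2) g by blast
qed

lemma dense_transversal:
  assumes sr: "strongly_regular C \<kappa> A m q"
    and M: "elementary_substructure C M" "small \<kappa> M" "A \<subseteq> M" and r: "is_Inv C A n p M r"
    and x: "(x, x') \<in> r" "x \<noteq> x'"
  shows "\<exists>z. (x, z) \<in> r \<and> (z, x') \<in> r \<and> z \<noteq> x \<and> z \<noteq> x'"
proof -
  note r' = P.is_Inv_transversal[OF r]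
  have f: "x \<in> Field r" "x' \<in> Field r" using x(1) by (auto simp: Field_def)
  have lt: "P.lt x x'" using r'(3)[OF f] x by blast
  obtain c where c: "set c \<subseteq> M" "P.lt x c" "P.lt c x'"
    using dense_in_model[OF sr M lt] r'(2)[OF f(1)] r'(2)[OF f(2)] by blast
  obtain z where z: "z \<in> Field r" "\<not> P.lt z c" "\<not> P.lt c z"
    using r'(4)[OF P.lt_gen(2)[OF c(2)] c(1)] by blast
  have gz: "P.gen A z" using r'(2)[OF z(1)] by blast
  have "P.lt x z" using P.lt_right[OF z(2) c(2) gz] .
  moreover have "P.lt z x'" using P.lt_left[OF z(3) c(3) gz] .
  ultimately show ?thesis using r'(3)[OF f(1) z(1)] r'(3)[OF z(1) f(2)] P.lt_irrefl by blast
qed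

text \<open>Genericity over \<open>a\<close> depends only on the class, and alignment turns this
  into a statement about genericity of \<open>a\<close>. So the separating \<open>b\<close> may be
  replaced by its representative in \<open>s\<close>.\<close>

lemma between_transversal:
  assumes M: "elementary_substructure C M" "small \<kappa> M" "A \<subseteq> M"
    and r: "is_Inv C A n p M r" and s: "is_Inv C A m q M s"
    and x: "(x, x') \<in> r" "x \<noteq> x'"
  shows "\<exists>y\<in>Field s. \<not> P.gen (A \<union> set y) x \<and> P.gen (A \<union> set y) x'"
proof -
  note r' = P.is_Inv_transversal[OF r] and s' = Q.is_Inv_transversal[OF s]
  have f: "x \<in> Field r" "x' \<in> Field r" using x(1) by (auto simp: Field_def)
  have g: "P.gen A x" "P.gen A x'" using r'(2) f by auto
  have lt: "P.lt x x'" using r'(3)[OF f] x by blast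
  obtain b where b: "Q.gen A b" "set b \<subseteq> M" "\<not> P.gen (A \<union> set b) x" "P.gen (A \<union> set b) x'"
    using between_in_model[OF M lt] r'(2)[OF f(1)] r'(2)[OF f(2)] by blast
  obtain y where y: "y \<in> Field s" "\<not> Q.lt y b" "\<not> Q.lt b y" using s'(4)[OF b(1,2)] by blast
  have gy: "Q.gen A y" using s'(2)[OF y(1)] by blast
  have Q: "Q.gen (A \<union> set a) b \<longleftrightarrow> Q.gen (A \<union> set a) y" for a
    using right_upward[OF _ gy y(2)] right_upward[OF _ b(1) y(3)] by blast
  have "P.gen (A \<union> set b) a \<longleftrightarrow> P.gen (A \<union> set y) a" if "P.gen A a" for a
    using aligned Q[of a] that b(1) gy by blast
  then show ?thesis using b(3,4) g y(1) by blast
qed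

lemma isomorphic_dedekind_completions:
  assumes sr: "strongly_regular C \<kappa> A n p" "strongly_regular C \<kappa> A m q"
    and M: "elementary_substructure C M" "small \<kappa> M" "A \<subseteq> M"
    and r: "is_Inv C A n p M r" and s: "is_Inv C A m q M s"
    and s': "s' = s \<and> (\<forall>a b. P.gen A a \<and> Q.gen A b \<longrightarrow> (\<not> P.gen (A \<union> set b) a \<longleftrightarrow> Q.gen (A \<union> set a) b)) \<or>
      s' = s\<inverse> \<and> (\<forall>a b. P.gen A a \<and> Q.gen A b \<longrightarrow> (\<not> P.gen (A \<union> set b) a \<longleftrightarrow> \<not> Q.gen (A \<union> set a) b))"
  shows "isomorphic (dedekind_completion r) (dedekind_completion s')"
proof -
  interpret sw: aligned_pair C \<kappa> A m q n p by (rule swap)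
  note r' = P.is_Inv_transversal[OF r] and s1 = Q.is_Inv_transversal[OF s]
  \<comment> \<open>The elements dependent on \<open>y\<close> form an initial segment, so
    dependence on \<open>y\<close> means lying below the cut made by \<open>y\<close>.\<close>
  let ?L = "\<lambda>x y. \<not> P.gen (A \<union> set y) x"
  have F: "Field s' = Field s" using s' by auto
  have gr: "P.gen A x" if "x \<in> Field r" for x using r'(2)[OF that] by blast
  have gs: "Q.gen A y" if "y \<in> Field s" for y using s1(2)[OF that] by blast
  have sF: "(y, y') \<in> s \<Longrightarrow> y \<in> Field s \<and> y' \<in> Field s" for y y' by (auto simp: Field_def)
  have not_lt: "\<not> Q.lt y' y" if "(y, y') \<in> s" for y y'
    using s1(3)[of y y'] sF[OF that] that Q.lt_asym Q.lt_irrefl by blast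
  interpret interleaved r s' ?L
  proof
    show "Linear_order r" by (rule r'(1))
    show "Linear_order s'" using s' s1(1) by auto
    show "?L x' y" if "(x', x) \<in> r" "y \<in> Field s'" "?L x y" for x' x y
    proof -
      have f: "x' \<in> Field r" "x \<in> Field r" using that(1) by (auto simp: Field_def)
      have "\<not> P.lt x x'" using r'(3)[OF f] that(1) P.lt_asym P.lt_irrefl by blast
      then show ?thesis using left_upward[OF _ gr[OF f(2)]] that(3) by blast
    qed
    show "?L x y'" if y: "(y, y') \<in> s'" "x \<in> Field r" "?L x y" for y y' x
      using s'
    proof (elim disjE conjE)
      assume 1: "s' = s" "\<forall>a b. P.gen A a \<and> Q.gen A b \<longrightarrow> (\<not> P.gen (A \<union> set b) a \<longleftrightarrow> Q.gen (A \<union> set a) b)"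
      then have f: "(y, y') \<in> s" "Q.gen A y" "Q.gen A y'" using y(1) sF gs by blast+
      have "Q.gen (A \<union> set x) y" using 1(2) f(2) gr[OF y(2)] y(3) by blast
      from right_upward[OF this f(3) not_lt[OF f(1)]] show ?thesis using 1(2) f(3) gr[OF y(2)] by blast
    next
      assume 2: "s' = s\<inverse>" "\<forall>a b. P.gen A a \<and> Q.gen A b \<longrightarrow> (\<not> P.gen (A \<union> set b) a \<longleftrightarrow> \<not> Q.gen (A \<union> set a) b)"
      then have f: "(y', y) \<in> s" "Q.gen A y" "Q.gen A y'" using y(1) sF gs by blast+
      have "\<not> Q.gen (A \<union> set x) y" using 2(2) f(2) gr[OF y(2)] y(3) by blast
      then have "\<not> Q.gen (A \<union> set x) y'" using right_upward[OF _ f(2) not_lt[OF f(1)]] by blast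
      then show ?thesis using 2(2) f(3) gr[OF y(2)] by blast
    qed
    show "\<exists>z. (x, z) \<in> r \<and> (z, x') \<in> r \<and> z \<noteq> x \<and> z \<noteq> x'" if "(x, x') \<in> r" "x \<noteq> x'" for x x'
      by (rule dense_transversal[OF sr(2) M r that])
    show "\<exists>z. (y, z) \<in> s' \<and> (z, y') \<in> s' \<and> z \<noteq> y \<and> z \<noteq> y'" if y: "(y, y') \<in> s'" "y \<noteq> y'" for y y'
      using s' sw.dense_transversal[OF sr(1) M s] y by (metis converse_iff)
    show "\<exists>y\<in>Field s'. ?L x y \<and> \<not> ?L x' y" if "(x, x') \<in> r" "x \<noteq> x'" for x x'
      using between_transversal[OF M r s that] F by simp
    show "\<exists>x\<in>Field r. \<not> ?L x y \<and> ?L x y'" if y: "(y, y') \<in> s'" "y \<noteq> y'" for y y'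
      using s'
    proof (elim disjE conjE)
      assume 1: "s' = s" "\<forall>a b. P.gen A a \<and> Q.gen A b \<longrightarrow> (\<not> P.gen (A \<union> set b) a \<longleftrightarrow> Q.gen (A \<union> set a) b)"
      have f: "(y, y') \<in> s" "Q.gen A y" "Q.gen A y'" using 1(1) y(1) sF gs by blast+
      show ?thesis using sw.between_transversal[OF M s r f(1) y(2)] 1(2) f(2,3) gr by blast
    next
      assume 2: "s' = s\<inverse>" "\<forall>a b. P.gen A a \<and> Q.gen A b \<longrightarrow> (\<not> P.gen (A \<union> set b) a \<longleftrightarrow> \<not> Q.gen (A \<union> set a) b)"
      have f: "(y', y) \<in> s" "Q.gen A y" "Q.gen A y'" using 2(1) y(1) sF gs by blast+
      show ?thesis using sw.between_transversal[OF M s r f(1)] y(2) 2(2) f(2,3) gr by blast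
    qed
  qed
  show ?thesis by (rule isomorphic_dedekind_completion)
qed

end

lemma (in noncommuting_pair) aligned_if_unbounded:
  assumes unb: "\<not> bounded_type C A n p m q"
  shows "aligned_pair C \<kappa> A n p m q"
proof unfold_locales
  interpret sw: noncommuting_pair C \<kappa> A m q n p by (rule swap)
  note iff = dependent_iff_if_unbounded[OF unb]
  show "(\<forall>a b. P.gen A a \<and> Q.gen A b \<longrightarrow> (\<not> P.gen (A \<union> set b) a \<longleftrightarrow> Q.gen (A \<union> set a) b)) \<or>
      (\<forall>a b. P.gen A a \<and> Q.gen A b \<longrightarrow> (\<not> P.gen (A \<union> set b) a \<longleftrightarrow> \<not> Q.gen (A \<union> set a) b))"
    using iff by blast
  show "\<exists>X. definable C (n + m) A X \<and>
      (\<forall>a b. P.gen A a \<and> Q.gen A b \<longrightarrow> (X (a @ b) \<longleftrightarrow> \<not> P.gen (A \<union> set b) a))"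
    using dependence_definable[OF unb] iff by blast
  show "P.gen A a \<Longrightarrow> \<exists>b. Q.gen A b \<and> \<not> Q.gen (A \<union> set a) b" for a by (rule ex_dependent)
  show "Q.gen A b \<Longrightarrow> \<exists>a. P.gen A a \<and> \<not> P.gen (A \<union> set b) a" for b by (rule sw.ex_dependent)
  show "Q.gen (A \<union> set y) b" if "\<And>x. P.gen A x \<Longrightarrow> P.gen (A \<union> set y) x" "Q.gen A b" for y b
    by (rule gen_extends[OF order_refl P.small_base that])
  show "P.gen (A \<union> set y) a" if "\<And>x. Q.gen A x \<Longrightarrow> Q.gen (A \<union> set y) x" "P.gen A a" for y a
    by (rule gen_extends_swapped[OF order_refl P.small_base that])
qed

lemma (in commuting_pair) aligned_if_unbounded:
  assumes unb: "\<not> bounded_type C A n p m q"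
  shows "aligned_pair C \<kappa> A n p m q"
proof unfold_locales
  interpret sw: commuting_pair C \<kappa> A m q n p by (rule swap)
  show "(\<forall>a b. P.gen A a \<and> Q.gen A b \<longrightarrow> (\<not> P.gen (A \<union> set b) a \<longleftrightarrow> Q.gen (A \<union> set a) b)) \<or>
      (\<forall>a b. P.gen A a \<and> Q.gen A b \<longrightarrow> (\<not> P.gen (A \<union> set b) a \<longleftrightarrow> \<not> Q.gen (A \<union> set a) b))"
    using commuting by blast
  obtain X where X: "definable C (n + m) A X"
    "\<And>a b. P.gen A a \<Longrightarrow> Q.gen A b \<Longrightarrow> X (a @ b) \<longleftrightarrow> Q.gen (A \<union> set a) b"
    using dependence_definable[OF unb] by blast
  then show "\<exists>X. definable C (n + m) A X \<and>
      (\<forall>a b. P.gen A a \<and> Q.gen A b \<longrightarrow> (X (a @ b) \<longleftrightarrow> \<not> P.gen (A \<union> set b) a))"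
    using definable_not[OF X(1)] commuting by (intro exI[of _ "\<lambda>c. \<not> X c"]) blast
  show "P.gen A a \<Longrightarrow> \<exists>b. Q.gen A b \<and> \<not> Q.gen (A \<union> set a) b" for a by (rule ex_dependent)
  show "Q.gen A b \<Longrightarrow> \<exists>a. P.gen A a \<and> \<not> P.gen (A \<union> set b) a" for b by (rule sw.ex_dependent)
  show "Q.gen (A \<union> set y) b" if "\<And>x. P.gen A x \<Longrightarrow> P.gen (A \<union> set y) x" "Q.gen A b" for y b
    by (rule gen_extends_base[OF that])
  show "P.gen (A \<union> set y) a" if "\<And>x. Q.gen A x \<Longrightarrow> Q.gen (A \<union> set y) x" "P.gen A a" for y a
    by (rule sw.gen_extends_base[OF that])
qed

section \<open>From the hypothesis on products to the two kinds of pairs\<close>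

context regular_pair
begin

text \<open>For formulas over \<open>A\<close> the parameter sets in the product collapse to
  \<open>A\<close>, and independent pairs share one type, so a single pair decides
  membership.\<close>

lemma restr_product_pq:
  assumes "P.gen A a" "Q.gen (A \<union> set a) b"
  shows "restr (product_pq C A n p m q) A = tp C (a @ b) A"
proof -
  have len: "length (a @ b) = n + m" using assms P.gen_length Q.gen_length by simp
  have *: "holds C (a' @ b') \<phi> \<longleftrightarrow> holds C (a @ b) \<phi>"
    if "P.gen A a'" "Q.gen (A \<union> set a') b'" "\<phi> \<in> formulas C (n + m) A" for a' b' \<phi>
    using conjugate_definable[OF product_conjugate[OF assms that(1,2)], of "\<lambda>c. holds C c \<phi>"]
      definableI[OF that(3)] len by simp
  have "\<phi> \<in> restr (product_pq C A n p m q) A \<longleftrightarrow> \<phi> \<in> tp C (a @ b) A" for \<phi>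
  proof (cases "\<phi> \<in> formulas C (n + m) A")
    case True
    then have "\<phi> \<in> formulas C (n + m) UNIV" "pars \<phi> \<subseteq> A" "A \<union> pars \<phi> = A" by (auto simp: formulas_def)
    then have "\<phi> \<in> restr (product_pq C A n p m q) A \<longleftrightarrow>
        (\<exists>a b. P.gen A a \<and> Q.gen (A \<union> set a) b \<and> holds C (a @ b) \<phi>)"
      by (simp add: restr_def product_pq_def)
    also have "\<dots> \<longleftrightarrow> holds C (a @ b) \<phi>" using assms *[OF _ _ True] by blast
    also have "\<dots> \<longleftrightarrow> \<phi> \<in> tp C (a @ b) A" unfolding tp_def len using True by blast
    finally show ?thesis .
  next
    case False
    moreover have "\<phi> \<notin> tp C (a @ b) A" unfolding tp_def len using False by blast
    ultimately show ?thesis by (simp add: restr_def product_pq_def formulas_def)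
  qed
  then show ?thesis by blast
qed

lemma restr_product_qp:
  assumes "Q.gen A b" "P.gen (A \<union> set b) a"
  shows "restr (product_qp C A n p m q) A = tp C (a @ b) A"
proof -
  have len: "length (a @ b) = n + m" using assms P.gen_length Q.gen_length by simp
  have *: "holds C (a' @ b') \<phi> \<longleftrightarrow> holds C (a @ b) \<phi>"
    if "Q.gen A b'" "P.gen (A \<union> set b') a'" "\<phi> \<in> formulas C (n + m) A" for a' b' \<phi>
  proof -
    have "conjugate C A (b @ a) (b' @ a')"
      using regular_pair.product_conjugate[OF swap] assms that(1,2) by blast
    then have "conjugate C A (a @ b) (a' @ b')"
      by (rule conjugate_swap) (use assms that Q.gen_length in metis)
    then show ?thesis
      using conjugate_definable[of C A "a @ b" "a' @ b'" "\<lambda>c. holds C c \<phi>"] definableI[OF that(3)] len by simp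
  qed
  have "\<phi> \<in> restr (product_qp C A n p m q) A \<longleftrightarrow> \<phi> \<in> tp C (a @ b) A" for \<phi>
  proof (cases "\<phi> \<in> formulas C (n + m) A")
    case True
    then have "\<phi> \<in> formulas C (n + m) UNIV" "pars \<phi> \<subseteq> A" "A \<union> pars \<phi> = A" by (auto simp: formulas_def)
    then have "\<phi> \<in> restr (product_qp C A n p m q) A \<longleftrightarrow>
        (\<exists>b a. Q.gen A b \<and> P.gen (A \<union> set b) a \<and> holds C (a @ b) \<phi>)"
      by (simp add: restr_def product_qp_def)
    also have "\<dots> \<longleftrightarrow> holds C (a @ b) \<phi>" using assms *[OF _ _ True] by blast
    also have "\<dots> \<longleftrightarrow> \<phi> \<in> tp C (a @ b) A" unfolding tp_def len using True by blast
    finally show ?thesis .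
  next
    case False
    moreover have "\<phi> \<notin> tp C (a @ b) A" unfolding tp_def len using False by blast
    ultimately show ?thesis by (simp add: restr_def product_qp_def formulas_def)
  qed
  then show ?thesis by blast
qed

text \<open>A pair generic in both directions would realize both products over
  \<open>A\<close>.\<close>

lemma noncommuting_pairI:
  assumes "restr (product_pq C A n p m q) A \<noteq> restr (product_qp C A n p m q) A"
  shows "noncommuting_pair C \<kappa> A n p m q"
proof unfold_locales
  fix a b assume ab: "P.gen A a" "Q.gen (A \<union> set a) b"
  have "Q.gen A b" using ab(2) by (rule Q.gen_mono) blast
  then show "\<not> P.gen (A \<union> set b) a" using restr_product_pq[OF ab] restr_product_qp[of b a] assms by metis
qed

text \<open>Equal products make pairs chosen in either order conjugate, so genericity in one
  direction gives the other. If no pair were dependent, all pairs would have one type, against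
  non-orthogonality.\<close>

lemma commuting_pairI:
  assumes eq: "restr (product_pq C A n p m q) A = restr (product_qp C A n p m q) A"
    and nwo: "\<not> weakly_orthogonal C A n (restr p A) m (restr q A)"
  shows "commuting_pair C \<kappa> A n p m q"
proof unfold_locales
  obtain a0 where a0: "P.gen A a0" using P.gen_exists[OF P.small_base] by blast
  obtain b0 where b0: "Q.gen (A \<union> set a0) b0" using Q.gen_exists[of "A \<union> set a0"] by (auto simp: P.small_base)
  obtain b1 where b1: "Q.gen A b1" using Q.gen_exists[OF P.small_base] by blast
  obtain a1 where a1: "P.gen (A \<union> set b1) a1" using P.gen_exists[of "A \<union> set b1"] by (auto simp: P.small_base)
  have g: "Q.gen A b0" "P.gen A a1"
    using b0 a1 by (auto elim: Q.gen_mono P.gen_mono)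
  have len: "length a0 = n" "length b0 = m" "length a1 = n" "length b1 = m"
    using a0 b1 g P.gen_length Q.gen_length by auto
  have "tp C (a0 @ b0) A = tp C (a1 @ b1) A"
    using restr_product_pq[OF a0 b0] restr_product_qp[OF b1 a1] eq by simp
  then have c: "conjugate C A (a0 @ b0) (a1 @ b1)"
    using P.conjugate_iff_tp[OF P.small_base, of "a0 @ b0" "a1 @ b1"] len by simp
  have 1: "Q.gen (A \<union> set a1) b1" using Q.gen_transfer[OF c _ order_refl b0] len by simp
  show "Q.gen (A \<union> set a) b \<longleftrightarrow> P.gen (A \<union> set b) a" if ab: "P.gen A a" "Q.gen A b" for a b
  proof
    have l: "length a = n" "length b = m" using ab P.gen_length Q.gen_length by auto
    assume "Q.gen (A \<union> set a) b"
    then have "conjugate C A (a1 @ b1) (a @ b)" using product_conjugate[OF g(2) 1 ab(1)] by blast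
    then have "conjugate C A (b1 @ a1) (b @ a)" by (rule conjugate_swap) (simp add: l len)
    from P.gen_transfer[OF this _ order_refl a1] show "P.gen (A \<union> set b) a" by (simp add: l len)
  next
    have l: "length a = n" "length b = m" using ab P.gen_length Q.gen_length by auto
    assume "P.gen (A \<union> set b) a"
    then have "conjugate C A (b1 @ a1) (b @ a)"
      using regular_pair.product_conjugate[OF swap b1 a1 ab(2)] by blast
    then have "conjugate C A (a1 @ b1) (a @ b)" by (rule conjugate_swap) (simp add: l len)
    from Q.gen_transfer[OF this _ order_refl 1] show "Q.gen (A \<union> set a) b" by (simp add: l len)
  qed
  show "\<exists>a b. P.gen A a \<and> Q.gen A b \<and> \<not> Q.gen (A \<union> set a) b"
  proof (rule ccontr)
    assume "\<not> ?thesis"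
    then have "tp C (a @ b) A = tp C (a' @ b') A"
      if "P.gen A a" "P.gen A a'" "Q.gen A b" "Q.gen A b'" for a a' b b'
      using product_conjugate[of a b a' b'] that conjugate_tp by blast
    then show False using nwo unfolding weakly_orthogonal_def by blast
  qed
qed

end

theorem theorem4:
  fixes C :: "('f, 'r, 'a) struct" and \<kappa> :: "'k rel"
    and A M :: "'a set" and n m :: nat and p q :: "('f, 'r, 'a) fm set"
  assumes "monster C \<kappa>" and "small \<kappa> A"
    and "global_type C n p" and "global_type C m q"
    and "regular C \<kappa> A n p" and "regular C \<kappa> A m q"
    and "convex C A n p" and "convex C A m q"
    and "asymmetric C A n p" and "asymmetric C A m q"
    and "\<not> weakly_orthogonal C A n (restr p A) m (restr q A)"
    and "elementary_substructure C M" and "small \<kappa> M" and "A \<subseteq> M"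
  shows
    "(bounded_type C A n p m q \<longrightarrow>
       (restr (product_pq C A n p m q) A \<noteq> restr (product_qp C A n p m q) A \<longrightarrow>
          (\<forall>r s. is_Inv C A n p M r \<and> is_Inv C A m q M s \<longrightarrow> isomorphic r s)) \<and>
       (restr (product_pq C A n p m q) A = restr (product_qp C A n p m q) A \<longrightarrow>
          (\<forall>r s. is_Inv C A n p M r \<and> is_Inv C A m q M s \<longrightarrow> anti_isomorphic r s)))
     \<and>
     (strongly_regular C \<kappa> A n p \<and> strongly_regular C \<kappa> A m q \<and> \<not> bounded_type C A n p m q \<longrightarrow>
       simple C A n p \<and> simple C A m q \<and>
       (restr (product_pq C A n p m q) A \<noteq> restr (product_qp C A n p m q) A \<longrightarrow>
          (\<forall>r s. is_Inv C A n p M r \<and> is_Inv C A m q M s \<longrightarrow>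
             isomorphic (dedekind_completion r) (dedekind_completion s))) \<and>
       (restr (product_pq C A n p m q) A = restr (product_qp C A n p m q) A \<longrightarrow>
          (\<forall>r s. is_Inv C A n p M r \<and> is_Inv C A m q M s \<longrightarrow>
             anti_isomorphic (dedekind_completion r) (dedekind_completion s))))"
proof -
  interpret regular_pair C \<kappa> A n p m q
    by unfold_locales (use assms in auto)
  let ?eq = "restr (product_pq C A n p m q) A = restr (product_qp C A n p m q) A"
  note M = assms(12-14)
  have bounded: "(\<not> ?eq \<longrightarrow> isomorphic r s) \<and> (?eq \<longrightarrow> anti_isomorphic r s)"
    if b: "bounded_type C A n p m q" and rs: "is_Inv C A n p M r" "is_Inv C A m q M s" for r s
  proof -
    obtain X where X: "bounded_link X" using bounded_typeE[OF b] by blast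
    show ?thesis
    proof (intro conjI impI)
      assume "\<not> ?eq"
      then interpret noncommuting_pair C \<kappa> A n p m q by (rule noncommuting_pairI)
      show "isomorphic r s"
        by (rule isomorphic_if_increasing[OF X _ M rs]) (rule bounded_link_increasing[OF X])
    next
      assume "?eq"
      then interpret commuting_pair C \<kappa> A n p m q by (rule commuting_pairI[OF _ assms(11)])
      show "anti_isomorphic r s"
        by (rule anti_isomorphic_if_decreasing[OF X _ M rs]) (rule bounded_link_decreasing[OF X])
    qed
  qed
  have unbounded: "simple C A n p \<and> simple C A m q \<and>
      (\<forall>r s. is_Inv C A n p M r \<and> is_Inv C A m q M s \<longrightarrow>
        (\<not> ?eq \<longrightarrow> isomorphic (dedekind_completion r) (dedekind_completion s)) \<and>
        (?eq \<longrightarrow> anti_isomorphic (dedekind_completion r) (dedekind_completion s)))"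
    if sr: "strongly_regular C \<kappa> A n p" "strongly_regular C \<kappa> A m q" and unb: "\<not> bounded_type C A n p m q"
  proof -
    interpret aligned_pair C \<kappa> A n p m q
      using noncommuting_pair.aligned_if_unbounded[OF noncommuting_pairI unb]
        commuting_pair.aligned_if_unbounded[OF commuting_pairI[OF _ assms(11)] unb] by blast
    interpret sw: aligned_pair C \<kappa> A m q n p by (rule swap)
    have "(\<not> ?eq \<longrightarrow> isomorphic (dedekind_completion r) (dedekind_completion s)) \<and>
        (?eq \<longrightarrow> anti_isomorphic (dedekind_completion r) (dedekind_completion s))"
      if rs: "is_Inv C A n p M r" "is_Inv C A m q M s" for r s
    proof (intro conjI impI)
      assume "\<not> ?eq"
      then interpret noncommuting_pair C \<kappa> A n p m q by (rule noncommuting_pairI)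
      show "isomorphic (dedekind_completion r) (dedekind_completion s)"
        by (rule isomorphic_dedekind_completions[OF sr M rs]) (use dependent_iff_if_unbounded[OF unb] in blast)
    next
      assume "?eq"
      then interpret commuting_pair C \<kappa> A n p m q by (rule commuting_pairI[OF _ assms(11)])
      have "isomorphic (dedekind_completion r) (dedekind_completion (s\<inverse>))"
        by (rule isomorphic_dedekind_completions[OF sr M rs]) (use commuting in blast)
      then show "anti_isomorphic (dedekind_completion r) (dedekind_completion s)"
        unfolding anti_isomorphic_def
        using isomorphic_trans isomorphic_dedekind_completion_converse by blast
    qed
    then show ?thesis using simple_left[OF sr(2)] sw.simple_left[OF sr(1)] by blast
  qed
  show ?thesis using bounded unbounded by blast
qed

end
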